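(* Let $(\Omega,\Sigma,\mu)$ be a measure space, let $1<p<\infty$, and let $(T_t)_{t\ge 0}$ be an individually eventually positive $C_0$-semigroup on $L^p(\Omega,\mu)$ with generator $A$. Then $$\omega_0(T)=s(A).$$
   Context: $L^p(\Omega,\mu)$ is the complex Banach lattice of (equivalence classes of) complex-valued measurable functions on $\Omega$ with integrable $p$-th power of the modulus; its positive cone $L^p(\Omega,\mu)_+$ consists of the real-valued elements $f$ with $f\ge 0$ almost everywhere, and $f\ge 0$ means $f\in L^p(\Omega,\mu)_+$. A $C_0$-semigroup $(T_t)_{t\ge 0}$ on a complex Banach lattice $E$ with positive cone $E_+$ is called individually eventually positive if for every $f\in E_+$ there exists $t_f\ge 0$ (possibly depending on $f$) such that $T_tf\ge 0$ for all $t\ge t_f$. The spectral bound of the generator $A$ is $s(A):=\sup\{\operatorname{Re}\lambda:\lambda\in\sigma(A)\}$ (an element of $[-\infty,\infty)$, with value $-\infty$ if $\sigma(A)=\emptyset$). The growth bound of the semigroup is $$\omega_0(T):=\inf\{\omega\in\mathbb R:\text{ there exists } M\ge 1 \text{ such that } \|T_t\|\le Me^{\omega t}\text{ for all } t\ge 0\},$$ an element of $[-\infty,\infty)$. *)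

theory Defs
  imports "HOL-Analysis.Analysis"
begin

text \<open>
  The space \<open>L\<^sup>p(M)\<close> depends on a measure and an exponent, hence it cannot be a type; spaces are
  therefore given by an explicit carrier together with their operations, norm and positive cone.
  The record only carries the data; the definitions below are meant for complex Banach lattices.
\<close>

record 'e cspace =
  vecs :: "'e set"
  vadd :: "'e \<Rightarrow> 'e \<Rightarrow> 'e"
  vscale :: "complex \<Rightarrow> 'e \<Rightarrow> 'e"
  vnorm :: "'e \<Rightarrow> real"
  vpos :: "'e set"

definition vminus :: "'e cspace \<Rightarrow> 'e \<Rightarrow> 'e \<Rightarrow> 'e" where
  "vminus E x y = vadd E x (vscale E (-1) y)"

definition bounded_operator :: "'e cspace \<Rightarrow> ('e \<Rightarrow> 'e) \<Rightarrow> bool" where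
  "bounded_operator E S \<longleftrightarrow>
     (\<forall>x\<in>vecs E. S x \<in> vecs E) \<and>
     (\<forall>x\<in>vecs E. \<forall>y\<in>vecs E. S (vadd E x y) = vadd E (S x) (S y)) \<and>
     (\<forall>c. \<forall>x\<in>vecs E. S (vscale E c x) = vscale E c (S x)) \<and>
     (\<exists>K. \<forall>x\<in>vecs E. vnorm E (S x) \<le> K * vnorm E x)"

text \<open>As for \<^const>\<open>onorm\<close>, the quotient at the zero vector is \<open>0 / 0 = 0\<close>.\<close>

definition operator_norm :: "'e cspace \<Rightarrow> ('e \<Rightarrow> 'e) \<Rightarrow> real" where
  "operator_norm E S = (SUP x\<in>vecs E. vnorm E (S x) / vnorm E x)"

definition C0_semigroup :: "'e cspace \<Rightarrow> (real \<Rightarrow> 'e \<Rightarrow> 'e) \<Rightarrow> bool" where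
  "C0_semigroup E T \<longleftrightarrow>
     (\<forall>t\<ge>0. bounded_operator E (T t)) \<and>
     (\<forall>x\<in>vecs E. T 0 x = x) \<and>
     (\<forall>s\<ge>0. \<forall>t\<ge>0. \<forall>x\<in>vecs E. T (s + t) x = T s (T t x)) \<and>
     (\<forall>x\<in>vecs E. ((\<lambda>t. vnorm E (vminus E (T t x) x)) \<longlongrightarrow> 0) (at_right 0))"

definition individually_eventually_positive :: "'e cspace \<Rightarrow> (real \<Rightarrow> 'e \<Rightarrow> 'e) \<Rightarrow> bool" where
  "individually_eventually_positive E T \<longleftrightarrow>
     (\<forall>f\<in>vpos E. \<exists>t\<^sub>f\<ge>0. \<forall>t\<ge>t\<^sub>f. T t f \<in> vpos E)"

text \<open>
  \<open>has_generator_value E T x y\<close> says that \<open>(T\<^sub>t x - x) / t\<close> converges to \<open>y\<close> in norm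
  as \<open>t\<close> decreases to \<open>0\<close>.
\<close>

definition has_generator_value ::
    "'e cspace \<Rightarrow> (real \<Rightarrow> 'e \<Rightarrow> 'e) \<Rightarrow> 'e \<Rightarrow> 'e \<Rightarrow> bool" where
  "has_generator_value E T x y \<longleftrightarrow>
     ((\<lambda>t. vnorm E (vminus E (vscale E (complex_of_real (1 / t)) (vminus E (T t x) x)) y))
        \<longlongrightarrow> 0) (at_right 0)"

definition generator_dom :: "'e cspace \<Rightarrow> (real \<Rightarrow> 'e \<Rightarrow> 'e) \<Rightarrow> 'e set" where
  "generator_dom E T = {x \<in> vecs E. \<exists>y\<in>vecs E. has_generator_value E T x y}"

definition generator :: "'e cspace \<Rightarrow> (real \<Rightarrow> 'e \<Rightarrow> 'e) \<Rightarrow> 'e \<Rightarrow> 'e" where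
  "generator E T x = (THE y. y \<in> vecs E \<and> has_generator_value E T x y)"

text \<open>An unbounded operator is given by its domain \<open>D\<close> and a function \<open>A\<close>, relevant only on \<open>D\<close>.\<close>

definition resolvent_set :: "'e cspace \<Rightarrow> 'e set \<Rightarrow> ('e \<Rightarrow> 'e) \<Rightarrow> complex set" where
  "resolvent_set E D A =
     {l. bij_betw (\<lambda>x. vminus E (vscale E l x) (A x)) D (vecs E) \<and>
         bounded_operator E (inv_into D (\<lambda>x. vminus E (vscale E l x) (A x)))}"

definition spectrum :: "'e cspace \<Rightarrow> 'e set \<Rightarrow> ('e \<Rightarrow> 'e) \<Rightarrow> complex set" where
  "spectrum E D A = - resolvent_set E D A"

definition spectral_bound :: "'e cspace \<Rightarrow> 'e set \<Rightarrow> ('e \<Rightarrow> 'e) \<Rightarrow> ereal" where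
  "spectral_bound E D A = (SUP l\<in>spectrum E D A. ereal (Re l))"

definition growth_bound :: "'e cspace \<Rightarrow> (real \<Rightarrow> 'e \<Rightarrow> 'e) \<Rightarrow> ereal" where
  "growth_bound E T =
     (INF w\<in>{w. \<exists>C\<ge>1. \<forall>t\<ge>0. operator_norm E (T t) \<le> C * exp (w * t)}. ereal w)"

definition Lp_fun :: "'a measure \<Rightarrow> real \<Rightarrow> ('a \<Rightarrow> complex) set" where
  "Lp_fun M p = {f \<in> borel_measurable M. integrable M (\<lambda>x. norm (f x) powr p)}"

definition ae_eq :: "'a measure \<Rightarrow> real \<Rightarrow> (('a \<Rightarrow> complex) \<times> ('a \<Rightarrow> complex)) set" where
  "ae_eq M p = {(f, g). f \<in> Lp_fun M p \<and> g \<in> Lp_fun M p \<and> (AE x in M. f x = g x)}"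

definition Lp_class :: "'a measure \<Rightarrow> real \<Rightarrow> ('a \<Rightarrow> complex) \<Rightarrow> ('a \<Rightarrow> complex) set" where
  "Lp_class M p f = ae_eq M p `` {f}"

definition Lp_rep :: "('a \<Rightarrow> complex) set \<Rightarrow> 'a \<Rightarrow> complex" where
  "Lp_rep X = (SOME f. f \<in> X)"

definition Lp :: "'a measure \<Rightarrow> real \<Rightarrow> ('a \<Rightarrow> complex) set cspace" where
  "Lp M p =
     \<lparr> vecs = Lp_fun M p // ae_eq M p,
       vadd = (\<lambda>X Y. Lp_class M p (\<lambda>x. Lp_rep X x + Lp_rep Y x)),
       vscale = (\<lambda>c X. Lp_class M p (\<lambda>x. c * Lp_rep X x)),
       vnorm = (\<lambda>X. (\<integral>x. norm (Lp_rep X x) powr p \<partial>M) powr (1 / p)),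
       vpos = {X \<in> Lp_fun M p // ae_eq M p.
                 \<forall>f\<in>X. AE x in M. f x \<in> \<real> \<and> 0 \<le> Re (f x)} \<rparr>"

end

theory Submission
  imports Defs "HOL-Probability.Discrete_Topology"
begin

text \<open>
  After rescaling one may assume \<open>s(A) < 0\<close>, so that \<open>Q = (- A)\<^sup>-\<^sup>1\<close> exists. Let \<open>P\<close> be the closed cone of all
  vectors whose whole orbit is positive. The resolvent at large real points leaves \<open>P\<close> invariant, and by the
  Neumann series this persists down to the point \<open>0\<close>. Hence for \<open>f \<in> P\<close> the integral of the orbit over
  \<open>[0, t]\<close>, which is \<open>Q f - T\<^sub>t Q f\<close>, lies between \<open>0\<close> and \<open>Q f\<close>.

  By Baire's theorem there are \<open>a \<ge> 0\<close> and \<open>e \<in> P\<close> such that \<open>T\<^sub>a h + \<parallel>h\<parallel> e \<in> P\<close> for all \<open>h \<ge> 0\<close>. Thus the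
  negative part of \<open>T\<^sub>t T\<^sub>a h\<close> is at most \<open>\<parallel>h\<parallel> T\<^sub>t e\<close>, and the moduli of the operators \<open>T\<^sub>t T\<^sub>a\<close>, taken on step
  functions, still have a bounded integral over \<open>t\<close>. Young's inequality for convolutions, applied at each point
  of the measure space, shows that the convolution with \<open>t \<mapsto> T\<^sub>t\<^sub>+\<^sub>a\<close> is bounded on \<open>L\<^sup>p([0, l]; L\<^sup>p)\<close>
  uniformly in \<open>l\<close>. On the orbit of \<open>f\<close> this convolution is \<open>t T\<^sub>t\<^sub>+\<^sub>a f\<close>, and the resulting estimate of
  \<open>\<integral> \<parallel>t T\<^sub>t\<^sub>+\<^sub>a f\<parallel>\<^sup>p dt\<close> by \<open>\<integral> \<parallel>T\<^sub>t f\<parallel>\<^sup>p dt\<close> over \<open>[0, l]\<close> forces exponential decay. To avoid functions with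
  values in \<open>L\<^sup>p\<close>, the convolution is discretised with \<open>\<integral>\<^sub>0\<^sup>d T\<^sub>t dt = Q - T\<^sub>d Q\<close> in place of \<open>d\<close>.
\<close>

section \<open>Strongly continuous semigroups on closed subspaces of Banach spaces\<close>

text \<open>Positivity of single orbits from some time on need not make any operator
  \<open>S t\<close> positive. An order bound on \<open>S t\<close> is therefore replaced by a
  comparison with the orbit of one fixed vector \<open>e\<close>, and the cone \<open>pos\<close>,
  which need not be invariant, by the cone of positive orbits. The moduli of the operators form no
  semigroup; they are tested only against finitely many disjoint indicators, so that finitely many
  null sets suffice. The gain comes from the weight: all vectors
  \<open>S (t - s + a) (S s f)\<close> with \<open>s \<le> t\<close> equal
  \<open>S (t + a) f\<close>, so the convolution over [0, t] multiplies by t, while its bound K does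
  not grow with the length l. Where t exceeds 3 K the weight outweighs K, and the p-th power mass of
  an orbit is halved from one time window to the next. Discretising keeps the constant: the
  integrals over the intervals [s d, (s + 1) d] telescope, so their sum is dominated by
  \<open>Q g\<close> with \<open>g = S a h + (2 * norm h) *\<^sub>R e\<close> for every d. The 2
  comes from writing the modulus of a real number as the number plus twice its negative
  part.\<close>

lemma Baire_closed_cover:
  fixes E :: "'v::complete_space set" and C :: "nat \<Rightarrow> 'v set"
  assumes "closed E" "E \<noteq> {}" "\<And>n. closed (C n)" "\<And>n. C n \<subseteq> E" "E \<subseteq> (\<Union>n. C n)"
  obtains n x r where "x \<in> E" "0 < r" "ball x r \<inter> E \<subseteq> C n"
proof -
  let ?X = "top_of_set E"
  have cm: "completely_metrizable_space ?X"
    by (rule completely_metrizable_space_closedin[OF completely_metrizable_space_euclidean])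
      (use assms(1) in auto)
  have "\<exists>n. ?X interior_of (C n) \<noteq> {}"
  proof (rule ccontr)
    assume a: "\<nexists>n. ?X interior_of (C n) \<noteq> {}"
    have "?X interior_of \<Union>(range C) = {}"
    proof (rule Baire_category_alt)
      fix T assume "T \<in> range C"
      then obtain n where "T = C n" by auto
      then show "closedin ?X T \<and> ?X interior_of T = {}"
        using a assms(3,4) by (auto simp: closed_subset)
    qed (use cm in auto)
    moreover have "\<Union>(range C) = E" using assms(4,5) by auto
    moreover have "?X interior_of E = E" by (simp add: interior_of_topspace[of ?X, simplified])
    ultimately show False using assms(2) by simp
  qed
  then obtain n where n: "?X interior_of (C n) \<noteq> {}" by blast
  then obtain x where x: "x \<in> ?X interior_of (C n)" by blast
  then obtain T where T: "openin ?X T" "x \<in> T" "T \<subseteq> C n" unfolding interior_of_def by blast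
  moreover from T obtain r where "0 < r" "ball x r \<inter> E \<subseteq> T"
    unfolding openin_contains_ball by blast
  moreover have "x \<in> E" using T unfolding openin_contains_ball by blast
  ultimately show ?thesis using that by blast
qed

section \<open>Riemann sums and closed cones\<close>

lemma eventually_at_right_0I: "(\<And>t::real. 0 < t \<Longrightarrow> P t) \<Longrightarrow> \<forall>\<^sub>F t in at_right 0. P t"
  by (auto simp: eventually_at_right_field intro!: exI[of _ 1])

text \<open>The operators \<open>S t\<close> are linear and bounded only on \<open>E\<close>, so
  operators and cone membership are carried through an integral by way of finite sums. Uniform
  continuity makes the error on each piece at most \<open>e\<close> times its length, and these
  errors add up to \<open>e * a\<close>.\<close>

lemma riemann_sums_tendsto:
  fixes g :: "real \<Rightarrow> 'b::banach"
  assumes cont: "continuous_on {0..a} g" and "0 \<le> a"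
  shows "(\<lambda>m. (a / real m) *\<^sub>R (\<Sum>k<m. g (real k * a / real m))) \<longlonglongrightarrow> integral {0..a} g"
proof (rule LIMSEQ_I)
  fix r :: real assume r: "0 < r"
  \<comment> \<open>The summand 1 makes \<open>e\<close> positive even for \<open>a = 0\<close>, and
    \<open>e * a\<close> is at most \<open>r / 2\<close>.\<close>
  define e where "e = r / (2 * (a + 1))"
  have e: "0 < e" using r \<open>0 \<le> a\<close> by (simp add: e_def)
  have "uniformly_continuous_on {0..a} g" using cont by (simp add: compact_uniformly_continuous)
  then obtain d where d: "0 < d" and
      gd: "\<And>x y. x \<in> {0..a} \<Longrightarrow> y \<in> {0..a} \<Longrightarrow> dist x y < d \<Longrightarrow> dist (g x) (g y) < e"
    using e unfolding uniformly_continuous_on_def by metis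
  obtain N where N: "a / d < real N" using reals_Archimedean2 by blast
  show "\<exists>no. \<forall>m\<ge>no. norm ((a / real m) *\<^sub>R (\<Sum>k<m. g (real k * a / real m)) - integral {0..a} g) < r"
  proof (intro exI allI impI)
    fix m assume m: "Suc N \<le> m"
    define h where "h = a / real m"
    have hd: "h < d"
    proof -
      have "a / d < real m" using N m by linarith
      then show ?thesis using d m by (simp add: h_def field_simps)
    qed
    have h0: "0 \<le> h" using \<open>0 \<le> a\<close> by (simp add: h_def)
    have mh: "real m * h = a" using m by (simp add: h_def)
    have le: "real n * h \<le> a" if "n \<le> m" for n
      unfolding mh[symmetric] using that h0 by (intro mult_right_mono) auto
    have int: "g integrable_on {u..v}" if "0 \<le> u" "v \<le> a" for u v
      using that by (intro integrable_continuous_real continuous_on_subset[OF cont]) auto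
    have *: "norm (integral {0..real n * h} g - h *\<^sub>R (\<Sum>k<n. g (real k * h))) \<le> e * (real n * h)" if "n \<le> m" for n
      using that
    proof (induction n)
      case (Suc n)
      let ?u = "real n * h" and ?v = "real (Suc n) * h"
      have uv: "0 \<le> ?u" "?u \<le> ?v" "?v \<le> a" "?v - ?u = h" using h0 le[OF Suc.prems] by (auto simp: algebra_simps)
      have "integral {0..?u} g + integral {?u..?v} g = integral {0..?v} g"
        by (rule Henstock_Kurzweil_Integration.integral_combine) (use uv int in auto)
      moreover have "norm (integral {?u..?v} (\<lambda>t. g t - g ?u)) \<le> e * (?v - ?u)"
      proof (rule integral_bound)
        show "continuous_on {?u..?v} (\<lambda>t. g t - g ?u)"
          using uv by (intro continuous_intros continuous_on_subset[OF cont]) auto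
        show "norm (g t - g ?u) \<le> e" if "t \<in> {?u..?v}" for t
        proof -
          have "?u \<le> t" "t \<le> ?v" using that by auto
          then have "t \<in> {0..a}" "?u \<in> {0..a}" using uv h0 by (auto simp del: of_nat_Suc intro: order_trans[of 0 ?u])
          moreover have "dist t ?u < d" using that uv hd by (auto simp: dist_norm)
          ultimately show ?thesis using gd[of t ?u] by (simp add: dist_norm less_imp_le)
        qed
      qed (use uv in auto)
      moreover have "integral {?u..?v} (\<lambda>t. g t - g ?u) = integral {?u..?v} g - h *\<^sub>R g ?u"
        using uv int[of ?u ?v] by (subst Henstock_Kurzweil_Integration.integral_diff) auto
      ultimately have "norm (integral {?u..?v} g - h *\<^sub>R g ?u) \<le> e * h"
        and s: "integral {0..?v} g = integral {0..?u} g + integral {?u..?v} g" using uv by auto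
      moreover have "norm (integral {0..?u} g - h *\<^sub>R (\<Sum>k<n. g (real k * h))) \<le> e * ?u" using Suc by auto
      moreover have "integral {0..?v} g - h *\<^sub>R (\<Sum>k<Suc n. g (real k * h)) =
        (integral {0..?u} g - h *\<^sub>R (\<Sum>k<n. g (real k * h))) + (integral {?u..?v} g - h *\<^sub>R g ?u)"
        unfolding s by (simp add: scaleR_add_right)
      ultimately have "norm (integral {0..?v} g - h *\<^sub>R (\<Sum>k<Suc n. g (real k * h))) \<le> e * ?u + e * h"
        by (metis norm_triangle_mono)
      then show ?case by (simp add: algebra_simps)
    qed auto
    have "norm (integral {0..a} g - h *\<^sub>R (\<Sum>k<m. g (real k * h))) \<le> e * a" using *[of m] mh by simp
    also have "e * a < r"
    proof -
      have "e * a \<le> r / 2" using r \<open>0 \<le> a\<close> by (simp add: e_def field_simps)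
      then show ?thesis using r by linarith
    qed
    finally show "norm ((a / real m) *\<^sub>R (\<Sum>k<m. g (real k * a / real m)) - integral {0..a} g) < r"
      by (simp add: h_def norm_minus_commute)
  qed
qed

text \<open>Lines through 0 are allowed, so closed subspaces are cones too.
  \<open>closed_cone_integral\<close> thus gives both the positivity of orbit integrals and their
  membership in \<open>E\<close>.\<close>

definition closed_cone :: "'v::real_normed_vector set \<Rightarrow> bool" where
  "closed_cone P \<longleftrightarrow> closed P \<and> 0 \<in> P \<and> (\<forall>x\<in>P. \<forall>y\<in>P. x + y \<in> P) \<and> (\<forall>c\<ge>0. \<forall>x\<in>P. c *\<^sub>R x \<in> P)"

lemma closed_cone_add: "closed_cone P \<Longrightarrow> x \<in> P \<Longrightarrow> y \<in> P \<Longrightarrow> x + y \<in> P"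
  and closed_cone_scale: "closed_cone P \<Longrightarrow> 0 \<le> c \<Longrightarrow> x \<in> P \<Longrightarrow> c *\<^sub>R x \<in> P"
  by (auto simp: closed_cone_def)

lemma closed_cone_sum: "closed_cone P \<Longrightarrow> (\<And>i. i \<in> I \<Longrightarrow> f i \<in> P) \<Longrightarrow> sum f I \<in> P"
  by (induction I rule: infinite_finite_induct) (auto simp: closed_cone_def)

lemma closed_cone_limit:
  assumes "closed_cone P" "X \<longlonglongrightarrow> x" "\<And>n. X n \<in> P" shows "x \<in> P"
  using assms closed_sequentially unfolding closed_cone_def by blast

lemma closed_cone_integral:
  fixes g :: "real \<Rightarrow> 'b::banach"
  assumes "closed_cone P" "continuous_on {0..a} g" "0 \<le> a" "\<And>t. t \<in> {0..a} \<Longrightarrow> g t \<in> P"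
  shows "integral {0..a} g \<in> P"
proof (rule closed_cone_limit[OF assms(1) riemann_sums_tendsto[OF assms(2,3)]])
  fix m :: nat
  show "(a / real m) *\<^sub>R (\<Sum>k<m. g (real k * a / real m)) \<in> P"
    using assms(3) by (intro closed_cone_scale closed_cone_sum assms(1,4)) (auto simp: field_simps intro!: mult_left_mono)
qed

lemma closed_cone_subspace: "subspace E \<Longrightarrow> closed E \<Longrightarrow> closed_cone E"
  by (auto simp: closed_cone_def subspace_def)

text \<open>Only the real structure appears here; complex scalars enter later as operators commuting
  with the semigroup. Each operator is merely assumed bounded on its own, and uniformity in
  \<open>t\<close> is derived in \<open>growth\<close>.\<close>

locale strongly_continuous_semigroup =
  fixes E :: "'v::banach set" and S :: "real \<Rightarrow> 'v \<Rightarrow> 'v"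
  assumes subspace: "subspace E" and closed: "closed E"
    and S_in: "\<And>t x. 0 \<le> t \<Longrightarrow> x \<in> E \<Longrightarrow> S t x \<in> E"
    and S_add: "\<And>t x y. 0 \<le> t \<Longrightarrow> x \<in> E \<Longrightarrow> y \<in> E \<Longrightarrow> S t (x + y) = S t x + S t y"
    and S_scale: "\<And>t c x. 0 \<le> t \<Longrightarrow> x \<in> E \<Longrightarrow> S t (c *\<^sub>R x) = c *\<^sub>R S t x"
    and S_bdd: "\<And>t. 0 \<le> t \<Longrightarrow> \<exists>K. \<forall>x\<in>E. norm (S t x) \<le> K * norm x"
    and S_0: "\<And>x. x \<in> E \<Longrightarrow> S 0 x = x"
    and S_plus: "\<And>s t x. 0 \<le> s \<Longrightarrow> 0 \<le> t \<Longrightarrow> x \<in> E \<Longrightarrow> S (s + t) x = S s (S t x)"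
    and S_cont: "\<And>x. x \<in> E \<Longrightarrow> ((\<lambda>t. S t x) \<longlongrightarrow> x) (at_right 0)"
begin

lemma E_add: "x \<in> E \<Longrightarrow> y \<in> E \<Longrightarrow> x + y \<in> E" and E_diff: "x \<in> E \<Longrightarrow> y \<in> E \<Longrightarrow> x - y \<in> E"
  and E_scale: "x \<in> E \<Longrightarrow> c *\<^sub>R x \<in> E" and E_0: "0 \<in> E" and E_minus: "x \<in> E \<Longrightarrow> - x \<in> E"
  using subspace by (auto simp: subspace_def subspace_diff subspace_neg)

lemma E_sum: "(\<And>i. i \<in> I \<Longrightarrow> f i \<in> E) \<Longrightarrow> sum f I \<in> E"
  using subspace by (rule subspace_sum)

lemma S_minus: "0 \<le> t \<Longrightarrow> x \<in> E \<Longrightarrow> S t (- x) = - S t x"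
  using S_scale[of t x "-1"] by simp

lemma S_diff: "0 \<le> t \<Longrightarrow> x \<in> E \<Longrightarrow> y \<in> E \<Longrightarrow> S t (x - y) = S t x - S t y"
  using S_add[of t x "- y"] S_minus[of t y] E_minus[of y] by simp

lemma S_zero: "0 \<le> t \<Longrightarrow> S t 0 = 0"
  using S_scale[of t 0 0] E_0 by simp

lemma S_sum: "0 \<le> t \<Longrightarrow> (\<And>i. i \<in> I \<Longrightarrow> f i \<in> E) \<Longrightarrow> S t (sum f I) = (\<Sum>i\<in>I. S t (f i))"
  by (induction I rule: infinite_finite_induct) (auto simp: S_zero S_add E_sum)

lemma S_limit:
  assumes "0 \<le> t" "\<And>n. X n \<in> E" "x \<in> E" "(X \<longlongrightarrow> x) F"
  shows "((\<lambda>n. S t (X n)) \<longlongrightarrow> S t x) F"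
proof -
  obtain K where K: "\<forall>x\<in>E. norm (S t x) \<le> K * norm x" using S_bdd assms(1) by blast
  have "((\<lambda>n. norm (X n - x)) \<longlongrightarrow> 0) F" using assms(4) by (simp add: LIM_zero tendsto_norm_zero)
  then have "((\<lambda>n. K * norm (X n - x)) \<longlongrightarrow> 0) F" by (rule tendsto_mult_right_zero)
  moreover have "norm (S t (X n) - S t x) \<le> K * norm (X n - x)" for n
    using K[rule_format, of "X n - x"] assms by (simp add: S_diff E_diff)
  ultimately have "((\<lambda>n. S t (X n) - S t x) \<longlongrightarrow> 0) F"
    by (intro Lim_null_comparison[of "\<lambda>n. S t (X n) - S t x" "\<lambda>n. K * norm (X n - x)"]) auto
  then show ?thesis by (simp add: LIM_zero_iff)
qed

text \<open>With \<open>t = k h + s\<close> and \<open>0 \<le> s \<le> h\<close>, the power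
  \<open>r ^ k\<close> differs from \<open>exp (ln r / h * t)\<close> by a factor of at most
  \<open>exp \<bar>ln r\<bar>\<close>. Taking \<open>r \<ge> 1\<close> gives exponential growth
  bounds, taking \<open>r = 1 / 2\<close> gives decay.\<close>

lemma exponential_bound_of_step:
  assumes h: "0 < h" and B: "0 \<le> B" "\<And>t x. t \<in> {0..h} \<Longrightarrow> x \<in> E \<Longrightarrow> norm (S t x) \<le> B * norm x"
    and r: "0 < r" "\<And>x. x \<in> E \<Longrightarrow> norm (S h x) \<le> r * norm x" and t: "0 \<le> t" and x: "x \<in> E"
  shows "norm (S t x) \<le> B * exp \<bar>ln r\<bar> * exp (ln r / h * t) * norm x"
proof -
  have pow: "norm (S (real k * h) x) \<le> r ^ k * norm x" for k
  proof (induction k)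
    case (Suc k)
    have "norm (S (real (Suc k) * h) x) = norm (S h (S (real k * h) x))"
      using S_plus[of h "real k * h" x] h x by (simp add: algebra_simps)
    also have "\<dots> \<le> r * norm (S (real k * h) x)" using h x by (intro r S_in) auto
    also have "\<dots> \<le> r * (r ^ k * norm x)" using r Suc by (intro mult_left_mono) auto
    finally show ?case by simp
  qed (use S_0 x in auto)
  define k where "k = nat \<lfloor>t / h\<rfloor>"
  define s where "s = t - real k * h"
  have s: "0 \<le> s" "s \<le> h"
  proof -
    have "0 \<le> t / h" using t h by simp
    then have "real k = of_int \<lfloor>t / h\<rfloor>" unfolding k_def by simp
    then have "real k \<le> t / h" "t / h \<le> real k + 1" by linarith+
    then show "0 \<le> s" "s \<le> h" using h by (auto simp: s_def field_simps)
  qed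
  have "S t x = S s (S (real k * h) x)"
    using S_plus[of s "real k * h" x] s h x by (simp add: s_def)
  then have "norm (S t x) \<le> B * norm (S (real k * h) x)" using B(2) s h x S_in by simp
  also have "\<dots> \<le> B * (r ^ k * norm x)" using B pow by (intro mult_left_mono) auto
  also have "r ^ k = exp (ln r / h * t) * exp (- (ln r / h * s))"
  proof -
    have "r ^ k = exp (ln r * real k)" using r by (simp add: exp_of_nat2_mult)
    also have "ln r * real k = ln r / h * t + - (ln r / h * s)" using h by (simp add: s_def field_simps)
    finally show ?thesis by (simp only: exp_add)
  qed
  also have "B * (exp (ln r / h * t) * exp (- (ln r / h * s)) * norm x) \<le> B * (exp (ln r / h * t) * exp \<bar>ln r\<bar> * norm x)"
  proof -
    have "\<bar>ln r / h * s\<bar> \<le> \<bar>ln r\<bar>"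
      using s h mult_left_mono[of "s / h" 1 "\<bar>ln r\<bar>"] by (simp add: abs_mult)
    then have "- (ln r / h * s) \<le> \<bar>ln r\<bar>" by linarith
    then show ?thesis using B by (intro mult_left_mono mult_right_mono) auto
  qed
  finally show ?thesis by (simp add: mult_ac)
qed

text \<open>This is uniform boundedness with an interval that is not known beforehand. Baire's
  theorem yields a ball on which one bound and one interval work, linearity spreads the bound over
  \<open>E\<close>, and \<open>exponential_bound_of_step\<close> extends it to all times.\<close>

lemma growth: "\<exists>M w. 1 \<le> M \<and> 0 \<le> w \<and> (\<forall>t\<ge>0. \<forall>x\<in>E. norm (S t x) \<le> M * exp (w * t) * norm x)"
proof -
  \<comment> \<open>One index governs both the bound and the length of the interval, because
    continuity at 0 gives each vector its own pair of these.\<close>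
  define C where "C n = {x\<in>E. \<forall>t\<in>{0..1 / real (Suc n)}. norm (S t x) \<le> real (Suc n)}" for n
  have cl: "closed (C n)" for n
    unfolding closed_sequential_limits
  proof (intro allI impI, elim conjE)
    fix X l assume X: "\<forall>k. X k \<in> C n" "X \<longlonglongrightarrow> l"
    then have XE: "\<And>k. X k \<in> E" by (auto simp: C_def)
    then have lE: "l \<in> E" using X closed closed_sequentially by blast
    have "norm (S t l) \<le> real (Suc n)" if "t \<in> {0..1 / real (Suc n)}" for t
    proof (rule LIMSEQ_le_const2)
      show "(\<lambda>k. norm (S t (X k))) \<longlonglongrightarrow> norm (S t l)"
        using that X XE lE by (intro tendsto_norm S_limit) auto
      show "\<exists>N. \<forall>k\<ge>N. norm (S t (X k)) \<le> real (Suc n)" using X that by (auto simp: C_def)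
    qed
    then show "l \<in> C n" using lE by (auto simp: C_def)
  qed
  have cov: "E \<subseteq> (\<Union>n. C n)"
  proof
    fix x assume x: "x \<in> E"
    have "\<forall>\<^sub>F t in at_right 0. dist (S t x) x < 1" using S_cont[OF x] tendstoD zero_less_one by blast
    then obtain b where b: "0 < b" "\<And>t. 0 < t \<Longrightarrow> t < b \<Longrightarrow> dist (S t x) x < 1"
      by (auto simp: eventually_at_right_field)
    obtain n where n: "max (1 / b) (norm x + 1) < real n" using reals_Archimedean2 by blast
    have "x \<in> C n"
    proof -
      have "norm (S t x) \<le> real (Suc n)" if t: "t \<in> {0..1 / real (Suc n)}" for t
      proof (cases "t = 0")
        case True then show ?thesis using n x S_0 by auto
      next
        case False
        have "1 / b < real (Suc n)" using n by auto
        then have "1 / real (Suc n) < b" using b(1) by (simp add: field_simps)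
        then have "dist (S t x) x < 1" using b(2) t False by auto
        then have "norm (S t x) < norm x + 1" unfolding dist_norm by norm
        then show ?thesis using n by auto
      qed
      then show ?thesis using x by (auto simp: C_def)
    qed
    then show "x \<in> (\<Union>n. C n)" by blast
  qed
  obtain n x0 r where x0: "x0 \<in> E" "0 < r" "ball x0 r \<inter> E \<subseteq> C n"
  proof (rule Baire_closed_cover[OF closed _ cl _ cov])
    show "E \<noteq> {}" using E_0 by blast
    show "C n \<subseteq> E" for n by (auto simp: C_def)
  qed
  define h where "h = 1 / real (Suc n)"
  \<comment> \<open>Scaling \<open>y\<close> to length \<open>r / 2\<close> costs the factor
    \<open>2 / r\<close>, and taking a difference of two vectors of \<open>C n\<close> costs another
    2. The summand 1 ensures \<open>1 \<le> M\<close>.\<close>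
  define M where "M = 4 * real (Suc n) / r + 1"
  have h: "0 < h" by (simp add: h_def)
  have M: "1 \<le> M" using x0 by (simp add: M_def)
  have loc: "norm (S t y) \<le> M * norm y" if t: "t \<in> {0..h}" and y: "y \<in> E" for t y
  proof (cases "y = 0")
    case True then show ?thesis using S_zero t by auto
  next
    case False
    define c where "c = r / (2 * norm y)"
    have c: "0 < c" "c * norm y < r" using False x0(2) by (auto simp: c_def)
    have "x0 + c *\<^sub>R y \<in> C n" "x0 \<in> C n"
      using x0 c y by (auto intro!: subsetD[OF x0(3)] E_add E_scale simp: dist_norm)
    then have "norm (S t (x0 + c *\<^sub>R y)) \<le> real (Suc n)" "norm (S t x0) \<le> real (Suc n)"
      using t by (auto simp: C_def h_def)
    moreover have "S t (c *\<^sub>R y) = S t (x0 + c *\<^sub>R y) - S t x0"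
      using t x0 y by (simp add: S_add E_scale)
    ultimately have "norm (S t (c *\<^sub>R y)) \<le> 2 * real (Suc n)" by (metis norm_triangle_le_diff mult_2 add_mono)
    then have "c * norm (S t y) \<le> 2 * real (Suc n)" using t y c by (simp add: S_scale)
    then have "norm (S t y) \<le> 2 * real (Suc n) / c" using c by (simp add: field_simps)
    also have "\<dots> = 4 * real (Suc n) / r * norm y" using x0 False by (simp add: c_def field_simps)
    also have "\<dots> \<le> M * norm y" by (simp add: M_def algebra_simps)
    finally show ?thesis .
  qed
  have "norm (S t x) \<le> M * exp \<bar>ln M\<bar> * exp (ln M / h * t) * norm x" if "0 \<le> t" "x \<in> E" for t x
    using h M loc that by (intro exponential_bound_of_step) auto
  moreover have "1 \<le> M * exp \<bar>ln M\<bar>" using M mult_mono[of 1 M 1 "exp \<bar>ln M\<bar>"] by simp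
  moreover have "0 \<le> ln M / h" using M h by simp
  ultimately show ?thesis by blast
qed

lemma locally_bounded:
  "\<exists>M\<ge>1. \<forall>t\<in>{0..a}. \<forall>x\<in>E. norm (S t x) \<le> M * norm x"
proof -
  obtain M w where M: "1 \<le> M" "0 \<le> w" "\<forall>t\<ge>0. \<forall>x\<in>E. norm (S t x) \<le> M * exp (w * t) * norm x" using growth by blast
  have "norm (S t x) \<le> M * exp (w * \<bar>a\<bar>) * norm x" if "t \<in> {0..a}" "x \<in> E" for t x
  proof -
    have "norm (S t x) \<le> M * exp (w * t) * norm x" using M that by auto
    also have "\<dots> \<le> M * exp (w * \<bar>a\<bar>) * norm x"
      using M that by (intro mult_left_mono mult_right_mono) (auto intro!: mult_left_mono)
    finally show ?thesis .
  qed
  moreover have "1 \<le> M * exp (w * \<bar>a\<bar>)" using M mult_mono[of 1 M 1 "exp (w * \<bar>a\<bar>)"] by simp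
  ultimately show ?thesis by blast
qed

text \<open>Right continuity at 0 suffices for both sides: for \<open>u \<le> v\<close> the smaller
  time is factored out, \<open>S v x - S u x = S u (S (v - u) x - x)\<close>, and \<open>S u\<close>
  is bounded uniformly on the interval.\<close>

lemma orbit_continuous: "x \<in> E \<Longrightarrow> continuous_on {0..a} (\<lambda>t. S t x)"
  unfolding continuous_on_iff
proof (intro ballI allI impI)
  fix s e :: real assume x: "x \<in> E" and s: "s \<in> {0..a}" and e: "0 < e"
  obtain M where M: "1 \<le> M" "\<forall>t\<in>{0..a}. \<forall>x\<in>E. norm (S t x) \<le> M * norm x" using locally_bounded by blast
  have eM: "0 < e / M" using e M by simp
  have "\<forall>\<^sub>F t in at_right 0. dist (S t x) x < e / M" using S_cont[OF x] tendstoD eM by blast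
  then obtain b where b: "0 < b" "\<And>t. 0 < t \<Longrightarrow> t < b \<Longrightarrow> dist (S t x) x < e / M"
    by (auto simp: eventually_at_right_field)
  have *: "norm (S v x - S u x) < e" if "0 \<le> u" "u \<le> v" "v \<le> a" "v - u < b" for u v
  proof (cases "u = v")
    case False
    have "S v x = S u (S (v - u) x)" using S_plus[of u "v - u" x] that x by simp
    then have "norm (S v x - S u x) = norm (S u (S (v - u) x - x))"
      using that x by (simp add: S_diff S_in)
    also have "\<dots> \<le> M * norm (S (v - u) x - x)" using M(2)[rule_format, of u "S (v - u) x - x"] E_diff[OF S_in x] that x
      by simp
    also have "\<dots> < M * (e / M)" using b(2)[of "v - u"] that False M by (intro mult_strict_left_mono) (auto simp: dist_norm)
    finally show ?thesis using M by simp
  qed (use e in simp)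
  show "\<exists>d>0. \<forall>t\<in>{0..a}. dist t s < d \<longrightarrow> dist (S t x) (S s x) < e"
  proof (intro exI[of _ b] conjI ballI impI)
    fix t assume t: "t \<in> {0..a}" "dist t s < b"
    show "dist (S t x) (S s x) < e"
    proof (cases "s \<le> t")
      case True then show ?thesis using *[of s t] t s by (auto simp: dist_norm)
    next
      case False then show ?thesis using *[of t s] t s by (auto simp: dist_norm norm_minus_commute)
    qed
  qed (use b in auto)
qed

text \<open>The graph of the generator. In relational form it is closed under sums, multiples and
  the semigroup without any reference to a domain.\<close>

definition gen :: "'v \<Rightarrow> 'v \<Rightarrow> bool" where
  "gen x y \<longleftrightarrow> x \<in> E \<and> y \<in> E \<and> ((\<lambda>t. (1 / t) *\<^sub>R (S t x - x)) \<longlongrightarrow> y) (at_right 0)"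

lemma gen_in: "gen x y \<Longrightarrow> x \<in> E" "gen x y \<Longrightarrow> y \<in> E"
  by (auto simp: gen_def)

lemma gen_unique: "gen x y \<Longrightarrow> gen x z \<Longrightarrow> y = z"
  unfolding gen_def using tendsto_unique[of "at_right (0::real)"] by auto

lemma gen_add: assumes "gen x y" "gen x' y'" shows "gen (x + x') (y + y')"
proof -
  have "((\<lambda>t. (1 / t) *\<^sub>R (S t x - x) + (1 / t) *\<^sub>R (S t x' - x')) \<longlongrightarrow> y + y') (at_right 0)"
    using assms by (intro tendsto_add) (auto simp: gen_def)
  moreover have "\<forall>\<^sub>F t in at_right 0. (1 / t) *\<^sub>R (S t x - x) + (1 / t) *\<^sub>R (S t x' - x') = (1 / t) *\<^sub>R (S t (x + x') - (x + x'))"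
    using assms by (intro eventually_at_right_0I) (simp add: gen_def S_add algebra_simps)
  ultimately show ?thesis using assms by (auto simp: gen_def E_add tendsto_cong)
qed

lemma gen_scale: assumes "gen x y" shows "gen (c *\<^sub>R x) (c *\<^sub>R y)"
proof -
  have "((\<lambda>t. c *\<^sub>R ((1 / t) *\<^sub>R (S t x - x))) \<longlongrightarrow> c *\<^sub>R y) (at_right 0)"
    using assms by (intro tendsto_intros) (auto simp: gen_def)
  moreover have "\<forall>\<^sub>F t in at_right 0. c *\<^sub>R ((1 / t) *\<^sub>R (S t x - x)) = (1 / t) *\<^sub>R (S t (c *\<^sub>R x) - c *\<^sub>R x)"
    using assms by (intro eventually_at_right_0I) (simp add: gen_def S_scale algebra_simps)
  ultimately show ?thesis using assms by (auto simp: gen_def E_scale tendsto_cong)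
qed

lemma gen_S: assumes "gen x y" "0 \<le> s" shows "gen (S s x) (S s y)"
proof -
  have xy: "x \<in> E" "y \<in> E" using assms by (auto simp: gen_def)
  \<comment> \<open>The value 0 away from positive times keeps every \<open>X t\<close> in
    \<open>E\<close>, as \<open>S_limit\<close> demands.\<close>
  define X where "X t = (if 0 < t then (1 / t) *\<^sub>R (S t x - x) else 0)" for t
  have XE: "X t \<in> E" for t using xy by (auto simp: X_def intro!: E_scale E_diff S_in E_0)
  have ev: "\<forall>\<^sub>F t in at_right 0. X t = (1 / t) *\<^sub>R (S t x - x)"
    by (rule eventually_at_right_0I) (simp add: X_def)
  have "(X \<longlongrightarrow> y) (at_right 0)" using assms(1) ev by (auto simp: gen_def tendsto_cong)
  then have "((\<lambda>t. S s (X t)) \<longlongrightarrow> S s y) (at_right 0)" by (intro S_limit XE xy assms)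
  moreover have "\<forall>\<^sub>F t in at_right 0. S s (X t) = (1 / t) *\<^sub>R (S t (S s x) - S s x)"
  proof -
    have "S s (X t) = (1 / t) *\<^sub>R (S t (S s x) - S s x)" if "0 < t" for t
      using that xy assms(2) S_plus[of s t x] S_plus[of t s x]
      by (simp add: X_def S_scale S_diff S_in E_diff add.commute)
    then show ?thesis by (rule eventually_at_right_0I)
  qed
  ultimately show ?thesis using xy assms(2) by (auto simp: gen_def S_in tendsto_cong)
qed

text \<open>The fundamental theorem without differentiating the orbit: with step
  \<open>h = a / m\<close> the difference \<open>S a x - x\<close> telescopes into a Riemann sum
  built from the quotient \<open>z h\<close> in place of \<open>y\<close>. As \<open>z h\<close>
  tends to \<open>y\<close> and the semigroup is bounded on [0, a], it has the same limit as the
  Riemann sum of \<open>y\<close>.\<close>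

lemma gen_integral:
  assumes "gen x y" "0 \<le> a" shows "integral {0..a} (\<lambda>t. S t y) = S a x - x"
proof -
  have xy: "x \<in> E" "y \<in> E" using assms by (auto simp: gen_def)
  obtain M where M: "1 \<le> M" "\<forall>t\<in>{0..a}. \<forall>x\<in>E. norm (S t x) \<le> M * norm x" using locally_bounded by blast
  let ?R = "\<lambda>m. (a / real m) *\<^sub>R (\<Sum>k<m. S (real k * a / real m) y)"
  have lim: "?R \<longlonglongrightarrow> integral {0..a} (\<lambda>t. S t y)"
    by (rule riemann_sums_tendsto) (use assms xy orbit_continuous in auto)
  have "?R \<longlonglongrightarrow> S a x - x"
  proof (cases "a = 0")
    case True then show ?thesis using xy S_0 by simp
  next
    case False
    then have a: "0 < a" using assms by simp
    define z where "z h = (1 / h) *\<^sub>R (S h x - x)" for h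
    have "filterlim (\<lambda>m. a / real m) (at_right 0) sequentially"
    proof (intro filterlim_at_withinI)
      show "(\<lambda>m. a / real m) \<longlonglongrightarrow> 0" by (rule lim_const_over_n)
      show "\<forall>\<^sub>F m in sequentially. a / real m \<in> {0<..} - {0}" using a
        by (auto intro!: eventually_sequentiallyI[of 1])
    qed
    then have zl: "(\<lambda>m. z (a / real m)) \<longlonglongrightarrow> y"
      using assms(1) unfolding gen_def z_def
      by (auto dest: filterlim_compose[rotated] simp del: divide_divide_eq_right divide_divide_eq_left)
    have bound: "norm ((S a x - x) - ?R m) \<le> a * M * norm (z (a / real m) - y)" if m: "1 \<le> m" for m
    proof -
      define h where "h = a / real m"
      have h: "0 < h" "real m * h = a" using m a by (auto simp: h_def)
      have zE: "z h \<in> E" using h xy by (auto simp: z_def intro!: E_scale E_diff S_in)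
      have tele: "S (real n * h) x - x = h *\<^sub>R (\<Sum>k<n. S (real k * h) (z h))" for n
      proof (induction n)
        case (Suc n)
        have "S (real (Suc n) * h) x = S (real n * h) (S h x)"
          using S_plus[of "real n * h" h x] h xy by (simp add: algebra_simps)
        moreover have "h *\<^sub>R S (real n * h) (z h) = S (real n * h) (S h x) - S (real n * h) x"
          using h xy by (simp add: z_def S_scale S_diff S_in E_diff)
        ultimately show ?case using Suc by (simp add: scaleR_add_right del: of_nat_Suc) (simp add: algebra_simps)
      qed (use xy S_0 in simp)
      have "(S a x - x) - ?R m = h *\<^sub>R (\<Sum>k<m. S (real k * h) (z h - y))"
      proof -
        have "(\<Sum>k<m. S (real k * h) (z h - y)) = (\<Sum>k<m. S (real k * h) (z h)) - (\<Sum>k<m. S (real k * h) y)"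
          using h zE xy by (simp add: S_diff sum_subtractf)
        then show ?thesis using tele[of m] h by (simp add: h_def scaleR_diff_right)
      qed
      also have "norm \<dots> \<le> h * (\<Sum>k<m. M * norm (z h - y))"
      proof -
        have "norm (\<Sum>k<m. S (real k * h) (z h - y)) \<le> (\<Sum>k<m. M * norm (z h - y))"
        proof (rule sum_norm_le)
          fix k assume k: "k \<in> {..<m}"
          then have "real k * h \<le> a" unfolding h(2)[symmetric] using h by (intro mult_right_mono) auto
          then show "norm (S (real k * h) (z h - y)) \<le> M * norm (z h - y)"
            using M h zE xy by (auto intro!: E_diff)
        qed
        then show ?thesis using h by simp
      qed
      also have "\<dots> = a * M * norm (z (a / real m) - y)" using h by (simp add: h_def[symmetric] flip: h(2))
      finally show ?thesis .
    qed
    have "(\<lambda>m. a * M * norm (z (a / real m) - y)) \<longlonglongrightarrow> 0"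
      using zl by (intro tendsto_mult_right_zero) (simp add: LIM_zero tendsto_norm_zero)
    then have "(\<lambda>m. (S a x - x) - ?R m) \<longlonglongrightarrow> 0"
      by (rule Lim_null_comparison[rotated]) (use bound in \<open>auto intro!: eventually_sequentiallyI[of 1]\<close>)
    then have "(\<lambda>m. (S a x - x) - ((S a x - x) - ?R m)) \<longlonglongrightarrow> (S a x - x) - 0"
      by (intro tendsto_diff tendsto_const)
    then show ?thesis by simp
  qed
  with lim show ?thesis using LIMSEQ_unique by blast
qed

lemma integral_orbit_in: "x \<in> E \<Longrightarrow> 0 \<le> a \<Longrightarrow> integral {0..a} (\<lambda>t. S t x) \<in> E"
  by (rule closed_cone_integral[OF closed_cone_subspace[OF subspace closed]]) (auto intro: orbit_continuous S_in)

lemma S_integral: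
  assumes "x \<in> E" "0 \<le> a" "0 \<le> s"
  shows "S s (integral {0..a} (\<lambda>t. S t x)) = integral {0..a + s} (\<lambda>t. S t x) - integral {0..s} (\<lambda>t. S t x)"
proof -
  have c: "continuous_on {0..b} (\<lambda>t. S t x)" for b using orbit_continuous assms by blast
  let ?R = "\<lambda>m. (a / real m) *\<^sub>R (\<Sum>k<m. S (real k * a / real m) x)"
  have RE: "?R m \<in> E" for m using assms by (auto intro!: E_scale E_sum S_in)
  have "?R \<longlonglongrightarrow> integral {0..a} (\<lambda>t. S t x)" by (rule riemann_sums_tendsto[OF c assms(2)])
  then have 1: "(\<lambda>m. S s (?R m)) \<longlonglongrightarrow> S s (integral {0..a} (\<lambda>t. S t x))"
    using assms RE by (intro S_limit integral_orbit_in) auto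
  have eq: "S s (?R m) = (a / real m) *\<^sub>R (\<Sum>k<m. S (real k * a / real m + s) x)" for m
    using assms by (auto simp: S_scale E_sum S_in S_sum S_plus add.commute intro!: sum.cong)
  have cs: "continuous_on {0..a} (\<lambda>t. S (t + s) x)"
    using assms by (intro continuous_on_compose2[OF c[of "a + s"]] continuous_intros) auto
  have "(\<lambda>m. S s (?R m)) \<longlonglongrightarrow> integral {0..a} (\<lambda>t. S (t + s) x)"
    unfolding eq by (rule riemann_sums_tendsto[OF cs assms(2)])
  with 1 have "S s (integral {0..a} (\<lambda>t. S t x)) = integral {0..a} (\<lambda>t. S (t + s) x)" using LIMSEQ_unique by blast
  also have "\<dots> = integral {s..a + s} (\<lambda>t. S t x)"
    using integral_shift_Icc_real[of 0 a "\<lambda>t. S t x" s] by (simp add: o_def add.commute)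
  also have "\<dots> = integral {0..a + s} (\<lambda>t. S t x) - integral {0..s} (\<lambda>t. S t x)"
    using Henstock_Kurzweil_Integration.integral_combine[of 0 s "a + s" "\<lambda>t. S t x"] assms
    by (simp add: integrable_continuous_real c algebra_simps)
  finally show ?thesis .
qed

lemma S_norm_nonneg_bound:
  "0 \<le> t \<Longrightarrow> \<exists>K\<ge>0. \<forall>x\<in>E. norm (S t x) \<le> K * norm x"
  using locally_bounded[of t] by (meson atLeastAtMost_iff order_refl order_trans zero_le_one)

text \<open>The improper integral of the orbit converges along integers since the pieces decay geometrically.\<close>

lemma exponentially_stable_generator_surjective:
  assumes "0 < e" and decay: "\<And>t x. 0 \<le> t \<Longrightarrow> x \<in> E \<Longrightarrow> norm (S t x) \<le> C * exp (- e * t) * norm x"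
  obtains K where "\<And>f. f \<in> E \<Longrightarrow> \<exists>x. gen x (- f) \<and> norm x \<le> K * norm f"
proof -
  define q where "q = exp (- e)"
  have q: "0 < q" "q < 1" using assms(1) by (auto simp: q_def)
  have "\<exists>x. gen x (- f) \<and> norm x \<le> (\<bar>C\<bar> / (1 - q)) * norm f" if f: "f \<in> E" for f
  proof -
    define I where "I a = integral {0..a} (\<lambda>t. S t f)" for a
    have c: "continuous_on {0..b} (\<lambda>t. S t f)" for b using orbit_continuous f by blast
    have IE: "I a \<in> E" if "0 \<le> a" for a unfolding I_def using f that by (rule integral_orbit_in)
    have comb: "I v - I u = integral {u..v} (\<lambda>t. S t f)" if "0 \<le> u" "u \<le> v" for u v
      using Henstock_Kurzweil_Integration.integral_combine[of 0 u v "\<lambda>t. S t f"] that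
      by (simp add: integrable_continuous_real c algebra_simps I_def)
    have piece: "norm (I v - I u) \<le> \<bar>C\<bar> * exp (- e * u) * norm f * (v - u)" if "0 \<le> u" "u \<le> v" for u v
      unfolding comb[OF that]
    proof (rule integral_bound)
      show "continuous_on {u..v} (\<lambda>t. S t f)" using that by (intro continuous_on_subset[OF c[of v]]) auto
      show "norm (S t f) \<le> \<bar>C\<bar> * exp (- e * u) * norm f" if "t \<in> {u..v}" for t
      proof -
        have "norm (S t f) \<le> C * exp (- e * t) * norm f" using decay[of t f] that \<open>0 \<le> u\<close> f by auto
        also have "\<dots> \<le> \<bar>C\<bar> * exp (- e * u) * norm f"
          using that assms(1) by (intro mult_right_mono mult_mono) auto
        finally show ?thesis .
      qed
    qed (use that in auto)
    define d where "d n = I (real (Suc n)) - I (real n)" for n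
    have qn: "exp (- e * real n) = q ^ n" for n using exp_of_nat2_mult[of "- e" n] by (simp add: q_def)
    have dn: "norm (d n) \<le> \<bar>C\<bar> * norm f * q ^ n" for n
      using piece[of "real n" "real (Suc n)"] qn[of n] by (simp add: d_def mult_ac)
    have geo: "summable (\<lambda>n. \<bar>C\<bar> * norm f * q ^ n)"
      using q by (intro summable_mult summable_geometric) auto
    have nd: "summable (\<lambda>n. norm (d n))" by (rule summable_comparison_test'[OF geo]) (use dn in auto)
    then have sd: "summable d" by (rule summable_norm_cancel)
    have part: "(\<Sum>k<n. d k) = I (real n)" for n
      unfolding d_def using sum_lessThan_telescope[of "\<lambda>k. I (real k)" n] by (simp add: I_def)
    define x where "x = suminf d"
    have Ix: "(\<lambda>n. I (real n)) \<longlonglongrightarrow> x"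
      using summable_LIMSEQ[OF sd] unfolding part x_def .
    have xE: "x \<in> E" using Ix closed closed_sequentially IE by (metis of_nat_0_le_iff)
    have "norm x \<le> (\<Sum>n. \<bar>C\<bar> * norm f * q ^ n)"
      unfolding x_def using summable_norm[OF nd] suminf_le[OF dn nd geo] by linarith
    also have "\<dots> = \<bar>C\<bar> / (1 - q) * norm f"
      using q by (simp add: suminf_mult suminf_geometric summable_geometric)
    finally have nx: "norm x \<le> \<bar>C\<bar> / (1 - q) * norm f" .
    \<comment> \<open>In the limit along integers the tail between \<open>n\<close> and
      \<open>n + h\<close> vanishes, and \<open>x\<close> satisfies the integrated equation.
      Dividing by \<open>h\<close> then produces the generator value \<open>- f\<close>.\<close>
    have Sx: "S h x - x = - I h" if h: "0 \<le> h" for h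
    proof -
      have "(\<lambda>n. S h (I (real n))) \<longlonglongrightarrow> S h x" by (intro S_limit h IE xE Ix) auto
      moreover have "S h (I (real n)) = I (real n) - I h + (I (real n + h) - I (real n))" for n
        using S_integral[OF f _ h, of "real n"] by (simp add: I_def)
      moreover have "(\<lambda>n. I (real n + h) - I (real n)) \<longlonglongrightarrow> 0"
      proof (rule Lim_null_comparison)
        show "\<forall>\<^sub>F n in sequentially. norm (I (real n + h) - I (real n)) \<le> \<bar>C\<bar> * norm f * h * q ^ n"
          using piece[of "real n" "real n + h" for n] h qn by (auto simp: mult_ac)
        show "(\<lambda>n. \<bar>C\<bar> * norm f * h * q ^ n) \<longlonglongrightarrow> 0"
          using q by (intro tendsto_mult_right_zero LIMSEQ_power_zero) auto
      qed
      then have "(\<lambda>n. I (real n) - I h + (I (real n + h) - I (real n))) \<longlonglongrightarrow> x - I h + 0"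
        by (intro tendsto_intros Ix)
      ultimately have "S h x = x - I h + 0" using LIMSEQ_unique by simp
      then show ?thesis by simp
    qed
    have If: "((\<lambda>t. (1 / t) *\<^sub>R I t) \<longlongrightarrow> f) (at_right 0)"
    proof (rule tendstoI)
      fix r :: real assume r: "0 < r"
      have "\<forall>\<^sub>F t in at_right 0. dist (S t f) f < r / 2" using S_cont[OF f] tendstoD r half_gt_zero by blast
      then obtain b where b: "0 < b" "\<And>t. 0 < t \<Longrightarrow> t < b \<Longrightarrow> dist (S t f) f < r / 2"
        by (auto simp: eventually_at_right_field)
      have "dist ((1 / t) *\<^sub>R I t) f < r" if t: "0 < t" "t < b" for t
      proof -
        have "norm (integral {0..t} (\<lambda>s. S s f - f)) \<le> (r / 2) * (t - 0)"
        proof (rule integral_bound)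
          show "norm (S s f - f) \<le> r / 2" if "s \<in> {0..t}" for s
            using b(2)[of s] that t r f S_0 by (cases "s = 0") (auto simp: dist_norm)
        qed (use t in \<open>auto intro!: continuous_intros c\<close>)
        moreover have "integral {0..t} (\<lambda>s. S s f - f) = I t - t *\<^sub>R f"
          using t by (subst Henstock_Kurzweil_Integration.integral_diff) (auto simp: I_def intro!: integrable_continuous_real c)
        ultimately have "norm (I t - t *\<^sub>R f) \<le> r / 2 * t" by simp
        moreover have e: "(1 / t) *\<^sub>R I t - f = (1 / t) *\<^sub>R (I t - t *\<^sub>R f)" using t by (simp add: scaleR_diff_right)
        ultimately have "dist ((1 / t) *\<^sub>R I t) f \<le> r / 2" unfolding dist_norm e norm_scaleR using t by (simp add: field_simps)
        then show ?thesis using r by linarith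
      qed
      then show "\<forall>\<^sub>F t in at_right 0. dist ((1 / t) *\<^sub>R I t) f < r"
        using b by (auto simp: eventually_at_right_field)
    qed
    have "((\<lambda>t. (1 / t) *\<^sub>R (S t x - x)) \<longlongrightarrow> - f) (at_right 0)"
    proof (rule Lim_transform_eventually)
      show "((\<lambda>t. - ((1 / t) *\<^sub>R I t)) \<longlongrightarrow> - f) (at_right 0)" by (intro tendsto_minus If)
      show "\<forall>\<^sub>F t in at_right 0. - ((1 / t) *\<^sub>R I t) = (1 / t) *\<^sub>R (S t x - x)"
        using Sx by (intro eventually_at_right_0I) simp
    qed
    then show ?thesis using xE f nx by (auto simp: gen_def E_minus)
  qed
  then show ?thesis using that by blast
qed

text \<open>A vector in the kernel of the generator has a constant orbit by
  \<open>gen_integral\<close>, and a constant orbit that decays is zero.\<close>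

lemma exponentially_stable_generator_injective:
  assumes "0 < e" and decay: "\<And>t x. 0 \<le> t \<Longrightarrow> x \<in> E \<Longrightarrow> norm (S t x) \<le> C * exp (- e * t) * norm x"
    and "gen x 0"
  shows "x = 0"
proof -
  have x: "x \<in> E" using assms(3) by (auto simp: gen_def)
  have "norm x \<le> C * exp (- e * real n) * norm x" for n
  proof -
    have "integral {0..real n} (\<lambda>t. S t 0) = integral {0..real n} (\<lambda>t. 0)"
      by (rule integral_cong) (simp add: S_zero)
    then have "S (real n) x = x" using gen_integral[OF assms(3), of "real n"] by simp
    then show ?thesis using decay[of "real n" x] x by simp
  qed
  moreover have "(\<lambda>n. C * exp (- e * real n) * norm x) \<longlonglongrightarrow> C * 0 * norm x"
  proof -
    have "(\<lambda>n. exp (- e) ^ n) \<longlonglongrightarrow> 0" using assms(1) by (intro LIMSEQ_power_zero) auto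
    then have "(\<lambda>n. exp (- e * real n)) \<longlonglongrightarrow> 0" unfolding exp_of_nat2_mult .
    then show ?thesis by (intro tendsto_intros)
  qed
  ultimately have "norm x \<le> 0"
    using LIMSEQ_le_const[of "\<lambda>n. C * exp (- e * real n) * norm x" 0 "norm x"] by auto
  then show ?thesis by simp
qed

text \<open>The three conjuncts say that \<open>R\<close> is a right inverse, a left inverse, and a
  bounded one, of \<open>l\<close> minus the generator. Values of \<open>R\<close> outside
  \<open>E\<close> stay unspecified.\<close>

definition resolvent :: "real \<Rightarrow> ('v \<Rightarrow> 'v) \<Rightarrow> bool" where
  "resolvent l R \<longleftrightarrow> (\<forall>f\<in>E. gen (R f) (l *\<^sub>R R f - f)) \<and> (\<forall>x y. gen x y \<longrightarrow> R (l *\<^sub>R x - y) = x) \<and>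
     (\<exists>K. \<forall>f\<in>E. norm (R f) \<le> K * norm f)"

lemma resolvent_gen: "resolvent l R \<Longrightarrow> f \<in> E \<Longrightarrow> gen (R f) (l *\<^sub>R R f - f)"
  and resolvent_left: "resolvent l R \<Longrightarrow> gen x y \<Longrightarrow> R (l *\<^sub>R x - y) = x"
  and resolvent_bdd: "resolvent l R \<Longrightarrow> \<exists>K. \<forall>f\<in>E. norm (R f) \<le> K * norm f"
  by (auto simp: resolvent_def)

lemma resolvent_in: "resolvent l R \<Longrightarrow> f \<in> E \<Longrightarrow> R f \<in> E"
  using gen_in(1) resolvent_gen by blast

text \<open>Linearity is not part of the definition; it comes from applying the left inverse to the
  sum of two pairs of the graph. Scaling and commutation with \<open>S t\<close> follow in the same
  way.\<close>

lemma resolvent_add: assumes "resolvent l R" "f \<in> E" "g \<in> E" shows "R (f + g) = R f + R g"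
  using resolvent_left[OF assms(1) gen_add[OF resolvent_gen[OF assms(1,2)] resolvent_gen[OF assms(1,3)]]]
  by (simp add: algebra_simps)

lemma resolvent_scale: assumes "resolvent l R" "f \<in> E" shows "R (c *\<^sub>R f) = c *\<^sub>R R f"
  using resolvent_left[OF assms(1) gen_scale[OF resolvent_gen[OF assms(1,2)]], of c]
  by (simp add: algebra_simps)

lemma resolvent_S: assumes "resolvent l R" "f \<in> E" "0 \<le> t" shows "R (S t f) = S t (R f)"
  using resolvent_left[OF assms(1) gen_S[OF resolvent_gen[OF assms(1,2)] assms(3)]] assms resolvent_in[OF assms(1,2)]
  by (simp add: S_diff S_scale E_scale)

lemma rescale: "strongly_continuous_semigroup E (\<lambda>t x. exp (- l * t) *\<^sub>R S t x)"
proof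
  fix t :: real assume "0 \<le> t"
  then obtain K where "\<forall>x\<in>E. norm (S t x) \<le> K * norm x" using S_bdd by blast
  then have "\<forall>x\<in>E. norm (exp (- l * t) *\<^sub>R S t x) \<le> (exp (- l * t) * K) * norm x" by auto
  then show "\<exists>K. \<forall>x\<in>E. norm (exp (- l * t) *\<^sub>R S t x) \<le> K * norm x" by blast
next
  fix x assume x: "x \<in> E"
  have "((\<lambda>t. exp (- l * t)) \<longlongrightarrow> exp (- l * 0)) (at_right 0)" by (intro tendsto_intros)
  then have "((\<lambda>t. exp (- l * t) *\<^sub>R S t x) \<longlongrightarrow> exp (- l * 0) *\<^sub>R x) (at_right 0)" by (intro tendsto_scaleR S_cont x)
  then show "((\<lambda>t. exp (- l * t) *\<^sub>R S t x) \<longlongrightarrow> x) (at_right 0)" by simp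
next
  fix s t :: real and x assume "0 \<le> s" "0 \<le> t" "x \<in> E"
  moreover have "exp (- l * (s + t)) = exp (- l * s) * exp (- l * t)" by (simp add: ring_distribs flip: exp_add)
  ultimately show "exp (- l * (s + t)) *\<^sub>R S (s + t) x = exp (- l * s) *\<^sub>R S s (exp (- l * t) *\<^sub>R S t x)"
    by (simp add: S_plus S_scale S_in)
qed (auto simp: subspace closed E_scale S_in S_add S_scale S_0 scaleR_add_right)

lemma gen_rescale:
  assumes "gen x y"
  shows "strongly_continuous_semigroup.gen E (\<lambda>t x. exp (- l * t) *\<^sub>R S t x) x (y - l *\<^sub>R x)"
proof -
  interpret r: strongly_continuous_semigroup E "\<lambda>t x. exp (- l * t) *\<^sub>R S t x" by (rule rescale)
  have xy: "x \<in> E" "y \<in> E" using assms by (auto simp: gen_def)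
  have e0: "((\<lambda>t. exp (- l * t)) \<longlongrightarrow> exp (- l * 0)) (at_right 0)" by (intro tendsto_intros)
  have "((\<lambda>t. exp (- l * t)) has_field_derivative - l) (at 0)" by (auto intro!: derivative_eq_intros)
  then have "((\<lambda>t. (exp (- l * t) - 1) / t) \<longlongrightarrow> - l) (at 0)" by (simp add: has_field_derivative_iff)
  then have d: "((\<lambda>t. (exp (- l * t) - 1) / t) \<longlongrightarrow> - l) (at_right 0)" by (rule filterlim_mono) (auto simp: at_le)
  have "((\<lambda>t. exp (- l * t) *\<^sub>R ((1 / t) *\<^sub>R (S t x - x)) + ((exp (- l * t) - 1) / t) *\<^sub>R x)
      \<longlongrightarrow> exp (- l * 0) *\<^sub>R y + (- l) *\<^sub>R x) (at_right 0)"
    using assms d e0 by (intro tendsto_intros) (auto simp: gen_def)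
  moreover have "exp (- l * t) *\<^sub>R ((1 / t) *\<^sub>R (S t x - x)) + ((exp (- l * t) - 1) / t) *\<^sub>R x
     = (1 / t) *\<^sub>R (exp (- l * t) *\<^sub>R S t x - x)" for t
    by (cases "t = 0") (simp_all add: algebra_simps diff_divide_distrib)
  ultimately show ?thesis using xy unfolding r.gen_def by (simp add: E_diff E_scale)
qed

text \<open>For \<open>l\<close> beyond the growth rate, \<open>R f\<close> is the Laplace transform
  of the orbit. The truncated transform lies in \<open>P\<close> as an integral over a cone, and by
  \<open>gen_integral\<close> for the rescaled semigroup it equals \<open>x\<close> minus a term
  that tends to 0.\<close>

lemma resolvent_positive_large:
  assumes P: "closed_cone P" "P \<subseteq> E" "\<And>t x. 0 \<le> t \<Longrightarrow> x \<in> P \<Longrightarrow> S t x \<in> P"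
    and growth: "\<And>t x. 0 \<le> t \<Longrightarrow> x \<in> E \<Longrightarrow> norm (S t x) \<le> M * exp (w * t) * norm x"
    and "w < l" "resolvent l R" "f \<in> P"
  shows "R f \<in> P"
proof -
  interpret r: strongly_continuous_semigroup E "\<lambda>t x. exp (- l * t) *\<^sub>R S t x" by (rule rescale)
  define x where "x = R f"
  have f: "f \<in> E" using assms by blast
  have "gen x (l *\<^sub>R x - f)" unfolding x_def using resolvent_gen assms(6) f by blast
  then have g: "r.gen x (- f)" using gen_rescale[of x "l *\<^sub>R x - f" l] by simp
  have xE: "x \<in> E" using g r.gen_in by blast
  let ?y = "\<lambda>n. x - exp (- l * real n) *\<^sub>R S (real n) x"
  have yP: "?y n \<in> P" for n
  proof -
    have "- ?y n = integral {0..real n} (\<lambda>t. exp (- l * t) *\<^sub>R S t (- f))"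
      using r.gen_integral[OF g, of "real n"] by simp
    also have "\<dots> = - integral {0..real n} (\<lambda>t. exp (- l * t) *\<^sub>R S t f)"
      unfolding Henstock_Kurzweil_Integration.integral_neg[symmetric]
      by (rule integral_cong) (simp add: S_minus f)
    finally have "?y n = integral {0..real n} (\<lambda>t. exp (- l * t) *\<^sub>R S t f)"
      unfolding neg_equal_iff_equal .
    moreover have "integral {0..real n} (\<lambda>t. exp (- l * t) *\<^sub>R S t f) \<in> P"
      by (intro closed_cone_integral r.orbit_continuous f P(1)) (auto intro!: closed_cone_scale P assms)
    ultimately show ?thesis by simp
  qed
  have "(\<lambda>n. exp (- l * real n) *\<^sub>R S (real n) x) \<longlonglongrightarrow> 0"
  proof (rule Lim_null_comparison)
    show "\<forall>\<^sub>F n in sequentially. norm (exp (- l * real n) *\<^sub>R S (real n) x) \<le> exp (w - l) ^ n * (M * norm x)"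
    proof (rule always_eventually, rule allI)
      fix n
      have "norm (exp (- l * real n) *\<^sub>R S (real n) x) \<le> exp (- l * real n) * (M * exp (w * real n) * norm x)"
        using growth[of "real n" x] xE by simp
      also have "\<dots> = exp ((w - l) * real n) * (M * norm x)"
        by (simp add: left_diff_distrib exp_diff exp_minus field_simps)
      finally show "norm (exp (- l * real n) *\<^sub>R S (real n) x) \<le> exp (w - l) ^ n * (M * norm x)"
        by (simp add: exp_of_nat2_mult)
    qed
    show "(\<lambda>n. exp (w - l) ^ n * (M * norm x)) \<longlonglongrightarrow> 0"
      using assms(5) by (intro tendsto_mult_left_zero LIMSEQ_power_zero) auto
  qed
  then have "?y \<longlonglongrightarrow> x - 0" by (intro tendsto_intros)
  then show ?thesis using closed_cone_limit[OF P(1)] yP unfolding x_def by simp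
qed

text \<open>Invariance of \<open>P\<close> passes from a point \<open>l\<close> to a smaller point
  \<open>m\<close> by the Neumann series. The radius \<open>r\<close> depends on \<open>l0\<close>
  alone and not on the point where invariance is already known, which is what an infimum argument
  requires.\<close>

lemma resolvent_positive_near:
  assumes P: "closed_cone P" "P \<subseteq> E" and "resolvent l0 R0"
  shows "\<exists>r>0. \<forall>l m R R'. \<bar>l - l0\<bar> < r \<longrightarrow> \<bar>m - l0\<bar> < r \<longrightarrow> m \<le> l \<longrightarrow> resolvent l R \<longrightarrow> resolvent m R' \<longrightarrow>
      (\<forall>f\<in>P. R f \<in> P) \<longrightarrow> (\<forall>f\<in>P. R' f \<in> P)"
proof -
  obtain K' where K': "\<forall>f\<in>E. norm (R0 f) \<le> K' * norm f" using resolvent_bdd assms(3) by blast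
  define K where "K = \<bar>K'\<bar> + 1"
  have K1: "1 \<le> K" by (simp add: K_def)
  have K: "norm (R0 f) \<le> K * norm f" if "f \<in> E" for f
  proof -
    have "K' * norm f \<le> K * norm f" by (intro mult_right_mono) (auto simp: K_def)
    then show ?thesis using K' that by fastforce
  qed
  \<comment> \<open>With \<open>K * r = 1 / 8\<close> every resolvent within \<open>r\<close> of
    \<open>l0\<close> has norm at most \<open>2 * K\<close>. Two such points differ by at most
    \<open>2 * r\<close>, so the iteration below contracts with factor
    \<open>4 * (K * r) = 1 / 2\<close>.\<close>
  define r where "r = 1 / (8 * K)"
  have r: "0 < r" "K * r = 1 / 8" using K1 by (auto simp: r_def)
  have main: "R' f \<in> P" if h: "\<bar>l - l0\<bar> < r" "\<bar>m - l0\<bar> < r" "m \<le> l" "resolvent l R" "resolvent m R'"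
    "\<And>f. f \<in> P \<Longrightarrow> R f \<in> P" "f \<in> P" for l m R R' f
  proof -
    have bd: "norm (R g) \<le> 2 * K * norm g" if g: "g \<in> E" for g
    proof -
      define x where "x = R g"
      have gx: "gen x (l *\<^sub>R x - g)" unfolding x_def using resolvent_gen h(4) g by blast
      then have x: "x \<in> E" using gen_in by blast
      have "R0 ((l0 - l) *\<^sub>R x + g) = x"
        using resolvent_left[OF assms(3) gx] by (simp add: algebra_simps)
      then have "norm x \<le> K * norm ((l0 - l) *\<^sub>R x + g)"
        using K[of "(l0 - l) *\<^sub>R x + g"] x g by (simp add: E_add E_scale)
      also have "\<dots> \<le> K * (r * norm x + norm g)"
      proof (intro mult_left_mono)
        have "norm ((l0 - l) *\<^sub>R x + g) \<le> \<bar>l0 - l\<bar> * norm x + norm g" by (metis norm_scaleR norm_triangle_ineq)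
        also have "\<dots> \<le> r * norm x + norm g" using h(1) by (intro add_right_mono mult_right_mono) auto
        finally show "norm ((l0 - l) *\<^sub>R x + g) \<le> r * norm x + norm g" .
      qed (use K1 in auto)
      also have "\<dots> = (K * r) * norm x + K * norm g" by (simp add: algebra_simps)
      also have "\<dots> = norm x / 8 + K * norm g" unfolding r by simp
      finally have "norm x * 7 / 8 \<le> K * norm g" by simp
      moreover have "0 \<le> norm x" "0 \<le> K * norm g" using K1 by auto
      ultimately have "norm x \<le> 2 * (K * norm g)" by linarith
      then show ?thesis by (simp add: x_def)
    qed
    define y where "y = R' f"
    have f: "f \<in> E" using h(7) P by blast
    have gy: "gen y (m *\<^sub>R y - f)" unfolding y_def using resolvent_gen h(5) f by blast
    then have y: "y \<in> E" using gen_in by blast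
    define e where "e = l - m"
    have e: "0 \<le> e" "e \<le> 2 * r" using h by (auto simp: e_def)
    have Ry: "R (e *\<^sub>R y + f) = y"
      using resolvent_left[OF h(4) gy] by (simp add: algebra_simps e_def)
    \<comment> \<open>The partial sums of the Neumann series, written as a fixed point iteration
      from 0. Since \<open>e \<ge> 0\<close>, no step leaves \<open>P\<close>.\<close>
    define z where "z = rec_nat 0 (\<lambda>_ v. R (e *\<^sub>R v + f))"
    have z0: "z 0 = 0" and zs: "z (Suc n) = R (e *\<^sub>R z n + f)" for n by (simp_all add: z_def)
    have zP: "z n \<in> P" for n
    proof (induction n)
      case (Suc n) then show ?case unfolding zs using P e h by (intro h closed_cone_add closed_cone_scale) auto
    qed (use P z0 in \<open>simp add: closed_cone_def\<close>)
    have "norm (y - z n) \<le> (1/2) ^ n * norm y" for n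
    proof (induction n)
      case (Suc n)
      have zE: "z n \<in> E" using zP P by blast
      have "R (e *\<^sub>R (y - z n) + (e *\<^sub>R z n + f)) = R (e *\<^sub>R (y - z n)) + R (e *\<^sub>R z n + f)"
        by (intro resolvent_add[OF h(4)] E_scale E_diff E_add y zE f)
      then have "y - z (Suc n) = R (e *\<^sub>R (y - z n))" using Ry by (simp add: zs algebra_simps)
      then have "norm (y - z (Suc n)) \<le> 2 * K * (e * norm (y - z n))"
        using bd[of "e *\<^sub>R (y - z n)"] e by (simp add: E_scale E_diff y zE)
      also have "\<dots> \<le> 2 * K * (2 * r * norm (y - z n))"
        using e K1 by (intro mult_left_mono mult_right_mono) auto
      also have "\<dots> = 4 * (K * r) * norm (y - z n)" by simp
      also have "\<dots> = (1/2) * norm (y - z n)" unfolding r by simp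
      finally show ?case using Suc by simp
    qed (simp add: z0)
    then have "(\<lambda>n. y - z n) \<longlonglongrightarrow> 0"
      by (intro Lim_null_comparison[of "\<lambda>n. y - z n" "\<lambda>n. (1/2)^n * norm y"])
         (auto intro!: tendsto_mult_left_zero LIMSEQ_power_zero)
    then have "(\<lambda>n. y - (y - z n)) \<longlonglongrightarrow> y - 0" by (intro tendsto_intros)
    then show ?thesis using closed_cone_limit[OF P(1)] zP unfolding y_def by simp
  qed
  show ?thesis using r(1) main by blast
qed

text \<open>A continuation argument: invariance holds for all large points, and \<open>l0\<close> is
  the infimum of the points from which on it holds. The preceding lemma carries it past
  \<open>l0\<close>, unless \<open>l0\<close> is already 0.\<close>

lemma resolvent_positive:
  assumes P: "closed_cone P" "P \<subseteq> E" "\<And>t x. 0 \<le> t \<Longrightarrow> x \<in> P \<Longrightarrow> S t x \<in> P"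
    and ex: "\<And>l. 0 \<le> l \<Longrightarrow> \<exists>R. resolvent l R"
    and "resolvent 0 Q" "f \<in> P"
  shows "Q f \<in> P"
proof -
  obtain M w where M: "0 \<le> w" "\<And>t x. 0 \<le> t \<Longrightarrow> x \<in> E \<Longrightarrow> norm (S t x) \<le> M * exp (w * t) * norm x" using growth by blast
  define good where "good l \<longleftrightarrow> (\<forall>R. resolvent l R \<longrightarrow> (\<forall>f\<in>P. R f \<in> P))" for l
  define G where "G = {l. 0 \<le> l \<and> (\<forall>m\<ge>l. good m)}"
  have "good m" if "w + 1 \<le> m" for m
    using resolvent_positive_large[OF P M(2)] that unfolding good_def by force
  then have G: "w + 1 \<in> G" using M(1) by (auto simp: G_def)
  have bb: "bdd_below G" by (rule bdd_belowI[of _ 0]) (auto simp: G_def)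
  define l0 where "l0 = Inf G"
  have l0: "0 \<le> l0" unfolding l0_def using G by (intro cInf_greatest) (auto simp: G_def)
  then obtain R0 where R0: "resolvent l0 R0" using ex by blast
  obtain r where r: "0 < r"
    "\<forall>l m R R'. \<bar>l - l0\<bar> < r \<longrightarrow> \<bar>m - l0\<bar> < r \<longrightarrow> m \<le> l \<longrightarrow> resolvent l R \<longrightarrow> resolvent m R' \<longrightarrow>
      (\<forall>f\<in>P. R f \<in> P) \<longrightarrow> (\<forall>f\<in>P. R' f \<in> P)"
    using resolvent_positive_near[OF P(1,2) R0] by blast
  obtain l where l: "l \<in> G" "l < l0 + r"
    using cInf_lessD[of G "l0 + r"] G r(1) unfolding l0_def by auto
  have ll: "l0 \<le> l" unfolding l0_def using l bb by (intro cInf_lower)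
  have l0': "0 \<le> l" using l by (auto simp: G_def)
  obtain R where R: "resolvent l R" using ex l0' by blast
  have RP: "R f \<in> P" if "f \<in> P" for f using l(1) R that by (auto simp: G_def good_def)
  \<comment> \<open>This point lies strictly below \<open>l0\<close> if \<open>l0 > 0\<close>. As it
    turns out to lie in \<open>G\<close>, both \<open>l0\<close> and \<open>k\<close> must be
    0.\<close>
  define k where "k = max 0 (l0 - r / 2)"
  have "good m" if m: "k \<le> m" for m
  proof (cases "l \<le> m")
    case True then show ?thesis using l(1) by (auto simp: G_def)
  next
    case False
    have "\<bar>m - l0\<bar> < r" using m l ll False r(1) by (auto simp: k_def)
    moreover have "\<bar>l - l0\<bar> < r" using l ll by auto
    ultimately show ?thesis unfolding good_def using r(2)[rule_format, of l m R] R RP False by auto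
  qed
  then have k: "k \<in> G" by (auto simp: G_def k_def)
  then have "l0 \<le> k" unfolding l0_def using bb by (intro cInf_lower)
  then have "l0 = 0" "k = 0" using r(1) l0 by (auto simp: k_def max_def split: if_splits)
  then have "good 0" using k by (auto simp: G_def)
  then show ?thesis using assms by (auto simp: good_def)
qed

text \<open>For \<open>Q = (- A)\<^sup>-\<^sup>1\<close> the vector \<open>Q f - S a (Q f)\<close> is the integral of the orbit of \<open>f\<close> over \<open>[0, a]\<close>.\<close>

lemma resolvent_0_increment_positive:
  assumes P: "closed_cone P" "P \<subseteq> E" "\<And>t x. 0 \<le> t \<Longrightarrow> x \<in> P \<Longrightarrow> S t x \<in> P"
    and "resolvent 0 Q" "f \<in> P" "0 \<le> a"
  shows "Q f - S a (Q f) \<in> P"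
proof -
  have f: "f \<in> E" using assms by blast
  have g: "gen (Q f) (- f)" using resolvent_gen[OF assms(4) f] by simp
  have "S a (Q f) - Q f = integral {0..a} (\<lambda>t. S t (- f))" using gen_integral[OF g assms(6)] by simp
  also have "\<dots> = - integral {0..a} (\<lambda>t. S t f)"
    unfolding Henstock_Kurzweil_Integration.integral_neg[symmetric] by (rule integral_cong) (simp add: S_minus f)
  finally have "Q f - S a (Q f) = integral {0..a} (\<lambda>t. S t f)" by (metis minus_diff_eq minus_minus)
  moreover have "integral {0..a} (\<lambda>t. S t f) \<in> P"
    by (intro closed_cone_integral orbit_continuous f P(1) assms(6)) (auto intro!: assms)
  ultimately show ?thesis by simp
qed

text \<open>The quotient is the mean of the orbit over [0, t]. In the limit of small steps this
  turns the discretised convolution back into the orbit itself.\<close>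

lemma resolvent_0_increment_limit:
  assumes "resolvent 0 Q" "f \<in> E"
  shows "((\<lambda>t. (1 / t) *\<^sub>R (Q f - S t (Q f))) \<longlongrightarrow> f) (at_right 0)"
proof -
  have "gen (Q f) (- f)" using resolvent_gen[OF assms] by simp
  then have "((\<lambda>t. - ((1 / t) *\<^sub>R (S t (Q f) - Q f))) \<longlongrightarrow> - (- f)) (at_right 0)"
    unfolding gen_def by (intro tendsto_minus) auto
  then show ?thesis by (simp add: scaleR_diff_right)
qed

end

section \<open>The Lebesgue spaces as subspaces of one Banach space type\<close>

definition Lp_norm :: "'a measure \<Rightarrow> real \<Rightarrow> ('a \<Rightarrow> complex) \<Rightarrow> real" where
  "Lp_norm M p f = (\<integral>x. norm (f x) powr p \<partial>M) powr (1 / p)"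

lemma Lp_norm_nonneg: "0 \<le> Lp_norm M p f"
  by (simp add: Lp_norm_def)

lemma Lp_fun_measurable: "f \<in> Lp_fun M p \<Longrightarrow> f \<in> borel_measurable M"
  and Lp_fun_integrable: "f \<in> Lp_fun M p \<Longrightarrow> integrable M (\<lambda>x. norm (f x) powr p)"
  by (auto simp: Lp_fun_def)

lemma Lp_norm_powr: "0 < p \<Longrightarrow> Lp_norm M p f powr p = (\<integral>x. norm (f x) powr p \<partial>M)"
  by (simp add: Lp_norm_def powr_powr)

lemma Lp_fun_dominated:
  assumes "f \<in> borel_measurable M" "g \<in> Lp_fun M p" "0 < p" "AE x in M. norm (f x) \<le> norm (g x)"
  shows "f \<in> Lp_fun M p"
proof -
  have [measurable]: "f \<in> borel_measurable M" by fact
  have "integrable M (\<lambda>x. norm (f x) powr p)"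
    by (rule Bochner_Integration.integrable_bound[OF Lp_fun_integrable[OF assms(2)]])
       (use assms(3,4) in \<open>auto elim!: eventually_mono intro: powr_mono2\<close>)
  then show ?thesis by (simp add: Lp_fun_def)
qed

lemma Lp_norm_mono:
  assumes "f \<in> borel_measurable M" "g \<in> Lp_fun M p" "0 < p" "AE x in M. norm (f x) \<le> norm (g x)"
  shows "Lp_norm M p f \<le> Lp_norm M p g"
  unfolding Lp_norm_def
proof (intro powr_mono2 integral_mono_AE)
  show "AE x in M. norm (f x) powr p \<le> norm (g x) powr p"
    using assms(3,4) by (auto elim!: eventually_mono intro: powr_mono2)
qed (use assms Lp_fun_dominated[OF assms] in \<open>auto intro: Lp_fun_integrable\<close>)

lemma Lp_norm_eq_0_iff:
  assumes "f \<in> Lp_fun M p" "0 < p"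
  shows "Lp_norm M p f = 0 \<longleftrightarrow> (AE x in M. f x = 0)"
proof -
  have "Lp_norm M p f = 0 \<longleftrightarrow> (\<integral>x. norm (f x) powr p \<partial>M) = 0" by (simp add: Lp_norm_def)
  also have "\<dots> \<longleftrightarrow> (AE x in M. norm (f x) powr p = 0)"
    by (rule integral_nonneg_eq_0_iff_AE[OF Lp_fun_integrable[OF assms(1)]]) auto
  finally show ?thesis by simp
qed

lemma Lp_fun_zero: "(\<lambda>x. 0) \<in> Lp_fun M p"
  by (simp add: Lp_fun_def)

lemma Lp_fun_scale:
  assumes "f \<in> Lp_fun M p" shows "(\<lambda>x. c * f x) \<in> Lp_fun M p"
  using assms by (auto simp: Lp_fun_def norm_mult powr_mult)

text \<open>A crude replacement for convexity. Its factor \<open>2 powr p\<close> is the origin of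
  the 2 in the constant \<open>2 * K\<close> of \<open>weighted_orbit_estimate\<close>.\<close>

lemma powr_add_le:
  fixes a b p :: real assumes "0 \<le> a" "0 \<le> b" "0 < p"
  shows "(a + b) powr p \<le> 2 powr p * (a powr p + b powr p)"
proof -
  have "(a + b) powr p \<le> (2 * max a b) powr p" using assms by (intro powr_mono2) auto
  also have "\<dots> = 2 powr p * max a b powr p" using assms by (simp add: powr_mult)
  also have "max a b powr p \<le> a powr p + b powr p" by (auto simp: max_def)
  finally show ?thesis by simp
qed

lemma Lp_fun_add:
  assumes "f \<in> Lp_fun M p" "g \<in> Lp_fun M p" "0 < p" shows "(\<lambda>x. f x + g x) \<in> Lp_fun M p"
proof -
  have [measurable]: "f \<in> borel_measurable M" "g \<in> borel_measurable M" using assms by (auto simp: Lp_fun_def)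
  have "integrable M (\<lambda>x. norm (f x + g x) powr p)"
  proof (rule Bochner_Integration.integrable_bound)
    show "integrable M (\<lambda>x. 2 powr p * (norm (f x) powr p + norm (g x) powr p))"
      using assms by (auto simp: Lp_fun_def)
    have "norm (f x + g x) powr p \<le> 2 powr p * (norm (f x) powr p + norm (g x) powr p)" for x
    proof -
      have "norm (f x + g x) powr p \<le> (norm (f x) + norm (g x)) powr p"
        using assms(3) by (intro powr_mono2 norm_triangle_ineq) auto
      also have "\<dots> \<le> 2 powr p * (norm (f x) powr p + norm (g x) powr p)" using assms(3) by (intro powr_add_le) auto
      finally show ?thesis .
    qed
    then show "AE x in M. norm (norm (f x + g x) powr p) \<le> norm (2 powr p * (norm (f x) powr p + norm (g x) powr p))"
      by (simp add: abs_mult)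
  qed auto
  then show ?thesis by (simp add: Lp_fun_def)
qed

lemma Lp_fun_diff:
  assumes "f \<in> Lp_fun M p" "g \<in> Lp_fun M p" "0 < p" shows "(\<lambda>x. f x - g x) \<in> Lp_fun M p"
  using Lp_fun_add[OF assms(1) Lp_fun_scale[OF assms(2), of "-1"] assms(3)] by simp

lemma Lp_fun_sum:
  assumes "\<And>i. i \<in> I \<Longrightarrow> f i \<in> Lp_fun M p" "0 < p" shows "(\<lambda>x. \<Sum>i\<in>I. f i x) \<in> Lp_fun M p"
  using assms(1) by (induction I rule: infinite_finite_induct) (auto simp: Lp_fun_zero Lp_fun_add assms(2))

section \<open>Duality with the conjugate exponent and the isometric embedding\<close>

definition dual_ball :: "'a measure \<Rightarrow> real \<Rightarrow> ('a \<Rightarrow> complex) set" where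
  "dual_ball M p = {g \<in> Lp_fun M (p / (p - 1)). (\<integral>x. norm (g x) powr (p / (p - 1)) \<partial>M) \<le> 1}"

lemma conjugate_exponent:
  fixes p :: real assumes "1 < p" shows "1 < p / (p - 1)" "1 / p + 1 / (p / (p - 1)) = 1"
  using assms by (auto simp: field_simps)

lemma Holder_integrable:
  assumes "1 < p" "f \<in> Lp_fun M p" "g \<in> Lp_fun M (p / (p - 1))"
  shows "integrable M (\<lambda>x. f x * g x)"
proof (rule Bochner_Integration.integrable_bound)
  let ?q = "p / (p - 1)"
  show "integrable M (\<lambda>x. norm (f x) powr p / p + norm (g x) powr ?q / ?q)"
    using assms by (intro Bochner_Integration.integrable_add integrable_divide_zero) (auto simp: Lp_fun_def)
  show "(\<lambda>x. f x * g x) \<in> borel_measurable M" using assms by (auto simp: Lp_fun_def)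
  have "norm (f x * g x) \<le> norm (f x) powr p / p + norm (g x) powr ?q / ?q" for x
    unfolding norm_mult using assms conjugate_exponent[OF assms(1)] by (intro Youngs_inequality) auto
  then show "AE x in M. norm (f x * g x) \<le> norm (norm (f x) powr p / p + norm (g x) powr ?q / ?q)"
    unfolding real_norm_def by (intro always_eventually allI order_trans[OF _ abs_ge_self])
qed

lemma Holder_dual_ball:
  assumes p: "1 < p" and f: "f \<in> Lp_fun M p" and g: "g \<in> dual_ball M p"
  shows "norm (\<integral>x. f x * g x \<partial>M) \<le> Lp_norm M p f"
proof (cases "Lp_norm M p f = 0")
  case True
  then have "AE x in M. f x = 0" using Lp_norm_eq_0_iff[OF f] p by simp
  then have "(\<integral>x. f x * g x \<partial>M) = (\<integral>x. 0 \<partial>M)"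
    using f g by (intro integral_cong_AE) (auto simp: Lp_fun_def dual_ball_def elim!: eventually_mono)
  then show ?thesis by (simp add: Lp_norm_nonneg)
next
  case False
  define N where "N = Lp_norm M p f"
  have N: "0 < N" using False Lp_norm_nonneg[of M p f] by (simp add: N_def)
  let ?q = "p / (p - 1)"
  have gL: "g \<in> Lp_fun M ?q" and g1: "(\<integral>x. norm (g x) powr ?q \<partial>M) \<le> 1" using g by (auto simp: dual_ball_def)
  note q = conjugate_exponent[OF p]
  have int: "integrable M (\<lambda>x. f x * g x)" by (rule Holder_integrable[OF p f gL])
  have i1: "integrable M (\<lambda>x. norm (f x) powr p / N powr p / p)" and i2: "integrable M (\<lambda>x. norm (g x) powr ?q / ?q)"
    using f gL by (auto intro!: integrable_divide_zero Lp_fun_integrable)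
  have "(\<integral>x. norm (f x * g x) / N \<partial>M) \<le> (\<integral>x. norm (f x) powr p / N powr p / p + norm (g x) powr ?q / ?q \<partial>M)"
  proof (rule integral_mono)
    show "norm (f x * g x) / N \<le> norm (f x) powr p / N powr p / p + norm (g x) powr ?q / ?q" for x
      using Youngs_inequality[OF p q, of "norm (f x) / N" "norm (g x)"] N by (simp add: norm_mult powr_divide)
  qed (use int i1 i2 in auto)
  also have "\<dots> = (\<integral>x. norm (f x) powr p \<partial>M) / N powr p / p + (\<integral>x. norm (g x) powr ?q \<partial>M) / ?q"
    using i1 i2 by (subst Bochner_Integration.integral_add) auto
  also have "(\<integral>x. norm (f x) powr p \<partial>M) = N powr p" using p by (simp add: N_def Lp_norm_powr)
  also have "N powr p / N powr p / p + (\<integral>x. norm (g x) powr ?q \<partial>M) / ?q \<le> 1 / p + 1 / ?q"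
    using N p q g1 by (intro add_mono divide_right_mono) auto
  finally have "(\<integral>x. norm (f x * g x) \<partial>M) / N \<le> 1" using q by simp
  then have "(\<integral>x. norm (f x * g x) \<partial>M) \<le> N" using N by (simp add: field_simps)
  then show ?thesis unfolding N_def[symmetric] by (rule order_trans[OF integral_norm_bound])
qed

text \<open>The equality case of Hoelder's inequality is explicit for \<open>1 < p\<close>:
  conjugate \<open>f\<close>, multiply by \<open>norm (f x) powr (p - 2)\<close> and normalise. This
  works on every measure space and makes the embedding isometric.\<close>

lemma dual_ball_attains:
  assumes p: "1 < p" and f: "f \<in> Lp_fun M p"
  shows "\<exists>g\<in>dual_ball M p. (\<integral>x. f x * g x \<partial>M) = of_real (Lp_norm M p f)"
proof (cases "Lp_norm M p f = 0")
  case True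
  then show ?thesis by (intro bexI[of _ "\<lambda>x. 0"]) (auto simp: dual_ball_def Lp_fun_zero)
next
  case False
  define N where "N = Lp_norm M p f"
  have N: "0 < N" using False Lp_norm_nonneg[of M p f] by (simp add: N_def)
  have Np: "(\<integral>x. norm (f x) powr p \<partial>M) = N powr p" using p by (simp add: N_def Lp_norm_powr)
  have [measurable]: "f \<in> borel_measurable M" using f by (simp add: Lp_fun_def)
  let ?q = "p / (p - 1)"
  define g where "g x = cnj (f x) * of_real (norm (f x) powr (p - 2) / N powr (p - 1))" for x
  have [measurable]: "(\<lambda>x. cnj (f x)) \<in> borel_measurable M"
    by (rule borel_measurable_continuous_on[of cnj]) (auto intro: continuous_intros)
  have [measurable]: "g \<in> borel_measurable M" unfolding g_def by measurable
  have ng: "norm (g x) = norm (f x) powr (p - 1) / N powr (p - 1)" for x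
  proof (cases "f x = 0")
    case False
    then have "norm (f x) * norm (f x) powr (p - 2) = norm (f x) powr (p - 1)"
      using powr_add[of "norm (f x)" 1 "p - 2"] by (simp add: powr_one)
    then show ?thesis unfolding g_def norm_mult norm_of_real complex_mod_cnj by simp
  qed (simp add: g_def)
  have gq: "norm (g x) powr ?q = norm (f x) powr p / N powr p" for x
    unfolding ng using p N by (simp add: powr_divide powr_powr)
  have "g \<in> Lp_fun M ?q" using Lp_fun_integrable[OF f] by (simp add: Lp_fun_def gq)
  moreover have "(\<integral>x. norm (g x) powr ?q \<partial>M) \<le> 1" unfolding gq using N Np by simp
  moreover have "(\<integral>x. f x * g x \<partial>M) = of_real N"
  proof -
    have "f x * g x = of_real (norm (f x) powr p / N powr (p - 1))" for x
    proof (cases "f x = 0")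
      case False
      have "f x * g x = of_real (norm (f x) ^ 2 * norm (f x) powr (p - 2) / N powr (p - 1))"
        unfolding g_def using complex_norm_square[of "f x"] by simp
      also have "norm (f x) ^ 2 * norm (f x) powr (p - 2) = norm (f x) powr p"
        using powr_add[of "norm (f x)" 2 "p - 2"] False by simp
      finally show ?thesis .
    qed (use p in \<open>simp add: g_def\<close>)
    then have "(\<integral>x. f x * g x \<partial>M) = of_real (\<integral>x. norm (f x) powr p / N powr (p - 1) \<partial>M)"
      by (simp only: integral_complex_of_real)
    also have "(\<integral>x. norm (f x) powr p / N powr (p - 1) \<partial>M) = N powr p / N powr (p - 1)" using Np by simp
    also have "\<dots> = N" using N powr_diff[of N p "p - 1"] by simp
    finally show ?thesis .
  qed
  ultimately show ?thesis unfolding N_def[symmetric] dual_ball_def by blast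
qed

text \<open>
  The spaces \<open>L\<^sup>p(M)\<close> are embedded isometrically into one Banach space type, by letting functions act
  on the unit ball of \<open>L\<^sup>q(M)\<close>, so that the library on Banach spaces applies.
\<close>

instance bcontfun :: (metric_space, banach) banach ..

type_synonym 'a Lp_target = "('a \<Rightarrow> complex) discrete \<Rightarrow>\<^sub>C complex"

definition Lp_emb :: "'a measure \<Rightarrow> real \<Rightarrow> ('a \<Rightarrow> complex) \<Rightarrow> 'a Lp_target" where
  "Lp_emb M p f = Bcontfun (\<lambda>d. if of_discrete d \<in> dual_ball M p then \<integral>x. f x * of_discrete d x \<partial>M else 0)"

text \<open>Because of the discrete topology, \<open>Lp_target\<close> is the space of all bounded
  functions on the index set with the supremum norm.\<close>

lemma continuous_on_discrete: "continuous_on S (f :: 'a discrete \<Rightarrow> 'b::topological_space)"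
  unfolding continuous_on_topological
proof (intro ballI allI impI)
  fix x B assume "f x \<in> B"
  then show "\<exists>A. open A \<and> x \<in> A \<and> (\<forall>y\<in>S. y \<in> A \<longrightarrow> f y \<in> B)"
    by (intro exI[of _ "{x}"]) (auto simp: open_discrete)
qed

lemma Lp_emb_apply:
  assumes "1 < p" "f \<in> Lp_fun M p"
  shows "apply_bcontfun (Lp_emb M p f) d = (if of_discrete d \<in> dual_ball M p then \<integral>x. f x * of_discrete d x \<partial>M else 0)"
  unfolding Lp_emb_def
  by (subst Bcontfun_inverse, rule bcontfun_normI[OF continuous_on_discrete, of _ "Lp_norm M p f"])
     (use Holder_dual_ball[OF assms] Lp_norm_nonneg in auto)

lemma norm_Lp_emb:
  assumes "1 < p" "f \<in> Lp_fun M p"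
  shows "norm (Lp_emb M p f) = Lp_norm M p f"
proof (rule antisym)
  show "norm (Lp_emb M p f) \<le> Lp_norm M p f"
    by (rule norm_bound) (use Holder_dual_ball[OF assms] Lp_norm_nonneg in \<open>auto simp: Lp_emb_apply[OF assms]\<close>)
  obtain g where g: "g \<in> dual_ball M p" "(\<integral>x. f x * g x \<partial>M) = of_real (Lp_norm M p f)"
    using dual_ball_attains[OF assms] by blast
  then have "norm (apply_bcontfun (Lp_emb M p f) (discrete g)) = Lp_norm M p f"
    using Lp_norm_nonneg[of M p f] by (simp add: Lp_emb_apply[OF assms] discrete_inverse)
  then show "Lp_norm M p f \<le> norm (Lp_emb M p f)" using norm_bounded by metis
qed

lemma Lp_emb_add:
  assumes "1 < p" "f \<in> Lp_fun M p" "g \<in> Lp_fun M p"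
  shows "Lp_emb M p (\<lambda>x. f x + g x) = Lp_emb M p f + Lp_emb M p g"
proof (rule bcontfun_eqI)
  fix d :: "('a \<Rightarrow> complex) discrete"
  have "(\<integral>x. (f x + g x) * of_discrete d x \<partial>M) = (\<integral>x. f x * of_discrete d x \<partial>M) + (\<integral>x. g x * of_discrete d x \<partial>M)"
    if "of_discrete d \<in> dual_ball M p"
    using that assms by (subst Bochner_Integration.integral_add[symmetric])
      (auto simp: dual_ball_def ring_distribs intro!: Holder_integrable)
  then show "apply_bcontfun (Lp_emb M p (\<lambda>x. f x + g x)) d = apply_bcontfun (Lp_emb M p f + Lp_emb M p g) d"
    using assms by (simp add: Lp_emb_apply Lp_fun_add)
qed

lemma Lp_emb_scaleR:
  assumes "1 < p" "f \<in> Lp_fun M p"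
  shows "Lp_emb M p (\<lambda>x. complex_of_real c * f x) = c *\<^sub>R Lp_emb M p f"
proof (rule bcontfun_eqI)
  fix d :: "('a \<Rightarrow> complex) discrete"
  show "apply_bcontfun (Lp_emb M p (\<lambda>x. of_real c * f x)) d = apply_bcontfun (c *\<^sub>R Lp_emb M p f) d"
    using assms by (simp add: Lp_emb_apply Lp_fun_scale mult.assoc scaleR_conv_of_real)
qed

section \<open>The embedded space \<open>E\<close>: completeness, positive cone,
  representatives\<close>

locale Lp_space =
  fixes M :: "'a measure" and p :: real
  assumes p1: "1 < p"
begin

abbreviation L where "L \<equiv> Lp_fun M p"
abbreviation emb where "emb \<equiv> Lp_emb M p"
abbreviation nrm where "nrm \<equiv> Lp_norm M p"

lemma p0: "0 < p" using p1 by simp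

lemmas norm_emb = norm_Lp_emb[OF p1] and emb_add = Lp_emb_add[OF p1] and emb_scaleR = Lp_emb_scaleR[OF p1]

lemma emb_diff: "f \<in> L \<Longrightarrow> g \<in> L \<Longrightarrow> emb (\<lambda>x. f x - g x) = emb f - emb g"
  using emb_add[of f M "\<lambda>x. - 1 * g x"] emb_scaleR[of g M "-1"] Lp_fun_scale[of g M p "-1"] by simp

lemma emb_zero: "emb (\<lambda>x. 0) = 0"
  using emb_scaleR[of "\<lambda>x. 0" M 0] by (simp add: Lp_fun_zero)

lemma emb_sum: "(\<And>i. i \<in> I \<Longrightarrow> f i \<in> L) \<Longrightarrow> emb (\<lambda>x. \<Sum>i\<in>I. f i x) = (\<Sum>i\<in>I. emb (f i))"
  by (induction I rule: infinite_finite_induct) (auto simp: emb_zero emb_add Lp_fun_sum p0)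

lemma emb_eq_iff:
  assumes "f \<in> L" "g \<in> L" shows "emb f = emb g \<longleftrightarrow> (AE x in M. f x = g x)"
proof -
  have "emb f = emb g \<longleftrightarrow> norm (emb (\<lambda>x. f x - g x)) = 0" using assms by (simp add: emb_diff)
  also have "\<dots> \<longleftrightarrow> (AE x in M. f x - g x = 0)"
    using assms by (simp only: norm_emb Lp_fun_diff p0 Lp_norm_eq_0_iff)
  finally show ?thesis by simp
qed

lemma nrm_sum_le: "(\<And>i. i \<in> I \<Longrightarrow> f i \<in> L) \<Longrightarrow> nrm (\<lambda>x. \<Sum>i\<in>I. f i x) \<le> (\<Sum>i\<in>I. nrm (f i))"
  using norm_sum[of "\<lambda>i. emb (f i)" I] by (simp add: emb_sum[symmetric] norm_emb Lp_fun_sum p0)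

definition E where "E = emb ` L"

lemma subspace_E: "subspace E"
  unfolding subspace_def E_def
proof (intro conjI ballI allI)
  show "0 \<in> emb ` L" using emb_zero Lp_fun_zero by (metis image_eqI)
  fix v assume v: "v \<in> emb ` L"
  show "c *\<^sub>R v \<in> emb ` L" for c using v by (auto simp: emb_scaleR[symmetric] intro!: Lp_fun_scale)
  show "v + w \<in> emb ` L" if "w \<in> emb ` L" for w
    using v that by (auto simp: emb_add[symmetric] intro!: Lp_fun_add p0)
qed

lemma Lp_dominated_convergence:
  assumes [measurable]: "\<And>n::nat. f n \<in> borel_measurable M" "h \<in> borel_measurable M" and g: "g \<in> L"
    and lim: "AE x in M. (\<lambda>n. f n x) \<longlonglongrightarrow> h x"
    and dom: "\<And>n. AE x in M. norm (f n x - h x) \<le> norm (g x)"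
  shows "(\<lambda>n. nrm (\<lambda>x. f n x - h x)) \<longlonglongrightarrow> 0"
proof -
  have "(\<lambda>n. \<integral>x. norm (f n x - h x) powr p \<partial>M) \<longlonglongrightarrow> (\<integral>x. 0 \<partial>M)"
  proof (rule integral_dominated_convergence[OF _ _ Lp_fun_integrable[OF g]])
    show "AE x in M. (\<lambda>n. norm (f n x - h x) powr p) \<longlonglongrightarrow> 0"
      using lim
    proof (rule eventually_mono)
      fix x assume "(\<lambda>n. f n x) \<longlonglongrightarrow> h x"
      then have "(\<lambda>n. norm (f n x - h x)) \<longlonglongrightarrow> 0" by (simp add: LIM_zero tendsto_norm_zero)
      then show "(\<lambda>n. norm (f n x - h x) powr p) \<longlonglongrightarrow> 0"
        by (rule tendsto_zero_powrI) (use p0 in auto)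
    qed
    show "AE x in M. norm (norm (f n x - h x) powr p) \<le> norm (g x) powr p" for n
      using dom[of n] p0 by (auto elim!: eventually_mono intro!: powr_mono2)
  qed auto
  then have "(\<lambda>n. \<integral>x. norm (f n x - h x) powr p \<partial>M) \<longlonglongrightarrow> 0" by simp
  then show ?thesis unfolding Lp_norm_def
    by (rule tendsto_zero_powrI[OF _ tendsto_const]) (use p0 in auto)
qed

lemma tendsto_emb:
  assumes "\<And>n::nat. f n \<in> L" "h \<in> L" "(\<lambda>n. nrm (\<lambda>x. f n x - h x)) \<longlonglongrightarrow> 0"
  shows "(\<lambda>n. emb (f n)) \<longlonglongrightarrow> emb h"
proof -
  have "(\<lambda>n. norm (emb (f n) - emb h)) \<longlonglongrightarrow> 0"
    using assms by (simp add: emb_diff[symmetric] norm_emb Lp_fun_diff p0)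
  then show ?thesis by (simp add: LIM_zero_cancel tendsto_norm_zero_iff)
qed

text \<open>The Riesz-Fischer argument: a subsequence with summable increments converges absolutely
  almost everywhere, and the sum of the moduli of the increments is a p-integrable majorant for
  dominated convergence.\<close>

lemma closed_E: "closed E"
  unfolding closed_sequential_limits
proof (intro allI impI, elim conjE)
  fix v l assume v: "\<forall>n. v n \<in> E" "v \<longlonglongrightarrow> l"
  have "\<forall>n. \<exists>f. f \<in> L \<and> v n = emb f" using v by (auto simp: E_def)
  then obtain F where F: "\<And>n. F n \<in> L" "\<And>n. v n = emb (F n)" by metis
  have "Cauchy v" using v by (simp add: LIMSEQ_imp_Cauchy)
  then have "\<forall>k. \<exists>N. \<forall>m\<ge>N. \<forall>n\<ge>N. norm (v m - v n) < (1/2) ^ k" by (auto simp: Cauchy_iff)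
  then obtain N where N: "\<And>k m n. N k \<le> m \<Longrightarrow> N k \<le> n \<Longrightarrow> norm (v m - v n) < (1/2) ^ k" by metis
  \<comment> \<open>Adding up the thresholds makes \<open>r k\<close> exceed \<open>N k\<close>, and
    the summand \<open>k\<close> makes \<open>r\<close> strictly increasing.\<close>
  define r where "r k = k + (\<Sum>i\<le>k. N i)" for k
  have r: "N k \<le> r k" "r k < r (Suc k)" for k
    using member_le_sum[of k "{..k}" N] by (auto simp: r_def)
  then have sm: "strict_mono r" by (simp add: strict_mono_Suc_iff)
  define d where "d k x = F (r (Suc k)) x - F (r k) x" for k x
  have FM [measurable]: "F n \<in> borel_measurable M" for n using F by (auto simp: Lp_fun_def)
  have dL: "d k \<in> L" for k unfolding d_def using F p0 by (intro Lp_fun_diff)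
  have dM [measurable]: "d k \<in> borel_measurable M" for k using dL by (rule Lp_fun_measurable)
  have dn: "nrm (d k) \<le> (1/2) ^ k" for k
  proof -
    have "nrm (d k) = norm (v (r (Suc k)) - v (r k))"
      using F unfolding d_def by (simp add: emb_diff[symmetric] norm_emb Lp_fun_diff p0)
    then show ?thesis using N[of k "r (Suc k)" "r k"] r(1)[of k] r(2)[of k] by auto
  qed
  \<comment> \<open>The norms of these partial sums of moduli stay below the geometric sum 2.
    Monotone convergence then makes their supremum \<open>H\<close>, taken after raising to the
    power \<open>p\<close>, finite almost everywhere.\<close>
  define G where "G n x = (\<Sum>k<n. norm (d k x))" for n x
  have GM [measurable]: "G n \<in> borel_measurable M" for n unfolding G_def by measurable
  have G0: "0 \<le> G n x" for n x by (simp add: G_def sum_nonneg)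
  have Ginc: "G n x \<le> G m x" if "n \<le> m" for n m x
    unfolding G_def using that by (intro sum_mono2) auto
  have absL: "(\<lambda>x. complex_of_real (norm (d k x))) \<in> L" for k using dL[of k] by (auto simp: Lp_fun_def)
  have Geq: "complex_of_real (G n x) = (\<Sum>k<n. complex_of_real (norm (d k x)))" for n x by (simp add: G_def)
  have GL: "(\<lambda>x. complex_of_real (G n x)) \<in> L" for n unfolding Geq by (intro Lp_fun_sum absL p0)
  have Gnrm: "nrm (\<lambda>x. complex_of_real (G n x)) \<le> 2" for n
  proof -
    have "nrm (\<lambda>x. complex_of_real (G n x)) \<le> (\<Sum>k<n. nrm (\<lambda>x. complex_of_real (norm (d k x))))"
      unfolding Geq by (intro nrm_sum_le absL)
    also have "\<dots> = (\<Sum>k<n. nrm (d k))" by (simp add: Lp_norm_def)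
    also have "\<dots> \<le> (\<Sum>k<n. (1/2) ^ k)" by (intro sum_mono dn)
    also have "\<dots> = 2 - 2 * (1/2) ^ n" by (induction n) auto
    also have "\<dots> \<le> 2" by simp
    finally show ?thesis .
  qed
  have Gint: "integrable M (\<lambda>x. G n x powr p)" for n using Lp_fun_integrable[OF GL[of n]] G0[of n] by simp
  have Gbd: "(\<integral>\<^sup>+x. ennreal (G n x powr p) \<partial>M) \<le> ennreal (2 powr p)" for n
  proof -
    have "(\<integral>x. G n x powr p \<partial>M) = nrm (\<lambda>x. complex_of_real (G n x)) powr p"
      using G0 by (simp add: Lp_norm_powr p0)
    also have "\<dots> \<le> 2 powr p" using Gnrm p0 by (intro powr_mono2) (auto simp: Lp_norm_nonneg)
    finally show ?thesis by (subst nn_integral_eq_integral[OF Gint]) (auto intro: ennreal_leI)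
  qed
  define H where "H x = (SUP n. ennreal (G n x powr p))" for x
  have [measurable]: "H \<in> borel_measurable M" unfolding H_def by measurable
  have Hint: "(\<integral>\<^sup>+x. H x \<partial>M) \<le> ennreal (2 powr p)"
  proof -
    have "(\<integral>\<^sup>+x. H x \<partial>M) = (SUP n. \<integral>\<^sup>+x. ennreal (G n x powr p) \<partial>M)"
      unfolding H_def
      by (rule nn_integral_monotone_convergence_SUP)
         (use G0 p0 Ginc in \<open>auto simp: incseq_def le_fun_def intro!: ennreal_leI powr_mono2\<close>)
    also have "\<dots> \<le> ennreal (2 powr p)" using Gbd by (intro SUP_least)
    finally show ?thesis .
  qed
  then have Hfin: "AE x in M. H x \<noteq> \<infinity>"
    by (intro nn_integral_PInf_AE) (auto simp: top_unique)
  have summ: "AE x in M. summable (\<lambda>k. norm (d k x))"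
    using Hfin
  proof (rule eventually_mono)
    fix x assume "H x \<noteq> \<infinity>"
    then obtain B where B: "0 \<le> B" "H x = ennreal B" by (cases "H x") auto
    have "G n x \<le> B powr (1 / p)" for n
    proof -
      have "ennreal (G n x powr p) \<le> ennreal B" unfolding B(2)[symmetric] H_def by (rule SUP_upper) simp
      then have "(G n x powr p) powr (1 / p) \<le> B powr (1 / p)" using B p0 by (intro powr_mono2) auto
      then show ?thesis using G0[of n x] p0 by (simp add: powr_powr)
    qed
    then show "summable (\<lambda>k. norm (d k x))"
      unfolding G_def by (intro bounded_imp_summable[of _ "B powr (1 / p)"]) (auto simp only: lessThan_Suc_atMost[symmetric] norm_ge_zero)
  qed
  define g where "g x = suminf (\<lambda>k. norm (d k x))" for x
  have [measurable]: "g \<in> borel_measurable M" unfolding g_def by measurable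
  have gL: "(\<lambda>x. complex_of_real (g x)) \<in> L"
  proof -
    have "AE x in M. ennreal (norm (norm (complex_of_real (g x)) powr p)) \<le> H x"
      using summ
    proof (rule eventually_mono)
      fix x assume s: "summable (\<lambda>k. norm (d k x))"
      then have "(\<lambda>n. G n x) \<longlonglongrightarrow> g x" unfolding G_def g_def by (rule summable_LIMSEQ)
      then have "(\<lambda>n. ennreal (norm (norm (complex_of_real (G n x)) powr p))) \<longlonglongrightarrow> ennreal (norm (norm (complex_of_real (g x)) powr p))"
        using p0 by (intro tendsto_intros tendsto_powr') auto
      moreover have "ennreal (norm (norm (complex_of_real (G n x)) powr p)) \<le> H x" for n
        using G0[of n x] unfolding H_def by (auto intro: SUP_upper)
      ultimately show "ennreal (norm (norm (complex_of_real (g x)) powr p)) \<le> H x"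
        by (meson LIMSEQ_le_const2)
    qed
    then have "(\<integral>\<^sup>+x. ennreal (norm (norm (complex_of_real (g x)) powr p)) \<partial>M) \<le> (\<integral>\<^sup>+x. H x \<partial>M)"
      by (rule nn_integral_mono_AE)
    also have "\<dots> < \<infinity>" using Hint by (metis ennreal_less_top infinity_ennreal_def order_le_less_trans)
    finally have "integrable M (\<lambda>x. norm (complex_of_real (g x)) powr p)" by (intro integrableI_bounded) auto
    then show ?thesis by (simp add: Lp_fun_def)
  qed
  define f where "f x = F (r 0) x + suminf (\<lambda>k. d k x)" for x
  have [measurable]: "f \<in> borel_measurable M" unfolding f_def by measurable
  \<comment> \<open>The distance to the limit is bounded by the tail of the series of moduli, which
    both tends to 0 and stays below \<open>g\<close>.\<close>
  have ft: "norm (F (r n) x - f x) \<le> g x - G n x" if s: "summable (\<lambda>k. norm (d k x))" for n x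
  proof -
    have sd: "summable (\<lambda>k. d k x)" using s by (rule summable_norm_cancel)
    have "F (r n) x = F (r 0) x + (\<Sum>k<n. d k x)"
      unfolding d_def using sum_lessThan_telescope[of "\<lambda>k. F (r k) x" n] by simp
    then have "f x - F (r n) x = suminf (\<lambda>k. d k x) - (\<Sum>k<n. d k x)" by (simp add: f_def)
    also have "\<dots> = (\<Sum>k. d (k + n) x)" using suminf_minus_initial_segment[OF sd] by simp
    finally have "norm (f x - F (r n) x) \<le> (\<Sum>k. norm (d (k + n) x))"
      using summable_norm[of "\<lambda>k. d (k + n) x"] s summable_iff_shift[of "\<lambda>k. norm (d k x)" n] by simp
    also have "\<dots> = g x - G n x" unfolding g_def G_def using suminf_minus_initial_segment[OF s] by simp
    finally show ?thesis by (simp add: norm_minus_commute)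
  qed
  have dom: "AE x in M. norm (F (r n) x - f x) \<le> norm (complex_of_real (g x))" for n
    using summ
  proof (rule eventually_mono)
    fix x assume "summable (\<lambda>k. norm (d k x))"
    from ft[OF this, of n] show "norm (F (r n) x - f x) \<le> norm (complex_of_real (g x))"
      using G0[of n x] by simp
  qed
  have lim: "AE x in M. (\<lambda>n. F (r n) x) \<longlonglongrightarrow> f x"
    using summ
  proof (rule eventually_mono)
    fix x assume s: "summable (\<lambda>k. norm (d k x))"
    then have "(\<lambda>n. G n x) \<longlonglongrightarrow> g x" unfolding G_def g_def by (rule summable_LIMSEQ)
    then have "(\<lambda>n. g x - G n x) \<longlonglongrightarrow> g x - g x" by (intro tendsto_intros)
    then have "(\<lambda>n. F (r n) x - f x) \<longlonglongrightarrow> 0"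
      by (intro Lim_null_comparison[of "\<lambda>n. F (r n) x - f x" "\<lambda>n. g x - G n x"]) (use ft[OF s] in auto)
    then show "(\<lambda>n. F (r n) x) \<longlonglongrightarrow> f x" by (simp add: LIM_zero_cancel)
  qed
  have fL: "f \<in> L"
  proof -
    have "(\<lambda>x. F (r 0) x - f x) \<in> L" by (rule Lp_fun_dominated[OF _ gL p0 dom]) auto
    from Lp_fun_diff[OF F(1)[of "r 0"] this p0] show ?thesis by simp
  qed
  have "(\<lambda>n. nrm (\<lambda>x. F (r n) x - f x)) \<longlonglongrightarrow> 0"
    by (rule Lp_dominated_convergence[OF _ _ gL lim dom]) auto
  then have "(\<lambda>n. v (r n)) \<longlonglongrightarrow> emb f" unfolding F(2) by (intro tendsto_emb F fL)
  moreover have "(\<lambda>n. v (r n)) \<longlonglongrightarrow> l" using LIMSEQ_subseq_LIMSEQ[OF v(2) sm] by (simp add: o_def)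
  ultimately have "l = emb f" using LIMSEQ_unique by blast
  then show "l \<in> E" using fL by (simp add: E_def)
qed

definition pos_fun :: "('a \<Rightarrow> complex) \<Rightarrow> bool" where
  "pos_fun f \<longleftrightarrow> f \<in> L \<and> (AE x in M. f x \<in> \<real> \<and> 0 \<le> Re (f x))"

definition pos where "pos = emb ` Collect pos_fun"

lemma pos_subset: "pos \<subseteq> E"
  by (auto simp: pos_def E_def pos_fun_def)

lemma emb_in_pos_iff: "f \<in> L \<Longrightarrow> emb f \<in> pos \<longleftrightarrow> pos_fun f"
proof
  assume f: "f \<in> L" and "emb f \<in> pos"
  then obtain g where g: "pos_fun g" "emb f = emb g" by (auto simp: pos_def)
  then have "AE x in M. f x = g x" using emb_eq_iff f by (auto simp: pos_fun_def)
  moreover have "AE x in M. g x \<in> \<real> \<and> 0 \<le> Re (g x)" using g by (simp add: pos_fun_def)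
  ultimately have "AE x in M. f x \<in> \<real> \<and> 0 \<le> Re (f x)" by eventually_elim auto
  then show "pos_fun f" using f by (simp add: pos_fun_def)
qed (auto simp: pos_def)

text \<open>The positive part of the real part is the nearest point on the half line of nonnegative reals.\<close>

lemma closed_pos: "closed pos"
  unfolding closed_sequential_limits
proof (intro allI impI, elim conjE)
  fix v l assume v: "\<forall>n. v n \<in> pos" "v \<longlonglongrightarrow> l"
  have vE: "v n \<in> E" for n using v pos_subset by blast
  then have "l \<in> E" using v closed_E closed_sequentially by blast
  then obtain f where f: "f \<in> L" "l = emb f" by (auto simp: E_def)
  have [measurable]: "f \<in> borel_measurable M" using f by (simp add: Lp_fun_def)
  define h where "h x = f x - complex_of_real (max 0 (Re (f x)))" for x
  have [measurable]: "h \<in> borel_measurable M" unfolding h_def by measurable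
  have hf: "norm (h x) \<le> norm (f x)" for x
    by (auto simp: h_def max_def complex_eq_iff cmod_def intro!: real_sqrt_le_mono)
  have hL: "h \<in> L" by (rule Lp_fun_dominated[OF _ f(1) p0]) (use hf in auto)
  \<comment> \<open>The norm of \<open>h\<close> is a lower bound for the distance from
    \<open>f\<close> to every positive function, so convergence to \<open>f\<close> forces
    \<open>h = 0\<close> almost everywhere.\<close>
  have "nrm h \<le> norm (v n - l)" for n
  proof -
    obtain g where g: "pos_fun g" "v n = emb g" using v by (auto simp: pos_def)
    then have gL: "g \<in> L" and ga: "AE x in M. g x \<in> \<real> \<and> 0 \<le> Re (g x)" by (auto simp: pos_fun_def)
    have "nrm h \<le> nrm (\<lambda>x. g x - f x)"
    proof (rule Lp_norm_mono[OF _ Lp_fun_diff[OF gL f(1) p0] p0])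
      show "AE x in M. norm (h x) \<le> norm (g x - f x)"
        using ga
      proof (rule eventually_mono)
        fix x assume a: "g x \<in> \<real> \<and> 0 \<le> Re (g x)"
        then have "Im (g x) = 0" by (simp add: complex_is_Real_iff)
        moreover have "(Re (f x) - max 0 (Re (f x)))\<^sup>2 \<le> (Re (g x) - Re (f x))\<^sup>2"
          using a by (intro abs_le_square_iff[THEN iffD1]) (auto simp: max_def)
        ultimately show "norm (h x) \<le> norm (g x - f x)"
          by (auto simp: h_def cmod_def intro!: real_sqrt_le_mono)
      qed
    qed auto
    also have "\<dots> = norm (v n - l)" using g f gL by (simp add: emb_diff[symmetric] norm_emb Lp_fun_diff p0)
    finally show ?thesis .
  qed
  moreover have "(\<lambda>n. norm (v n - l)) \<longlonglongrightarrow> 0" using v by (simp add: LIM_zero tendsto_norm_zero)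
  ultimately have "nrm h \<le> 0" by (intro LIMSEQ_le_const) auto
  then have "nrm h = 0" using Lp_norm_nonneg[of M p h] by simp
  then have "AE x in M. h x = 0" using Lp_norm_eq_0_iff[OF hL p0] by simp
  then have "AE x in M. f x \<in> \<real> \<and> 0 \<le> Re (f x)"
  proof (rule eventually_mono)
    fix x assume "h x = 0"
    then have "f x = complex_of_real (max 0 (Re (f x)))" by (simp add: h_def)
    then show "f x \<in> \<real> \<and> 0 \<le> Re (f x)" by (metis Re_complex_of_real Reals_of_real max.cobounded1)
  qed
  then show "l \<in> pos" using f emb_in_pos_iff by (auto simp: pos_fun_def)
qed

lemma closed_cone_pos: "closed_cone pos"
  unfolding closed_cone_def
proof (intro conjI ballI allI impI)
  show "closed pos" by (rule closed_pos)
  show "0 \<in> pos" using emb_in_pos_iff[OF Lp_fun_zero] by (simp add: emb_zero pos_fun_def Lp_fun_zero)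
  fix v assume "v \<in> pos"
  then obtain f where f: "pos_fun f" "v = emb f" by (auto simp: pos_def)
  show "c *\<^sub>R v \<in> pos" if "0 \<le> c" for c
  proof -
    have "AE x in M. f x \<in> \<real> \<and> 0 \<le> Re (f x)" using f by (simp add: pos_fun_def)
    then have "AE x in M. complex_of_real c * f x \<in> \<real> \<and> 0 \<le> Re (complex_of_real c * f x)"
      by (rule eventually_mono) (use that in auto)
    then have "pos_fun (\<lambda>x. complex_of_real c * f x)"
      using f by (simp add: pos_fun_def Lp_fun_scale)
    moreover have "c *\<^sub>R v = emb (\<lambda>x. complex_of_real c * f x)" using f by (simp add: emb_scaleR pos_fun_def)
    ultimately show ?thesis by (auto simp: pos_def)
  qed
  fix w assume "w \<in> pos"
  then obtain g where g: "pos_fun g" "w = emb g" by (auto simp: pos_def)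
  have "AE x in M. f x \<in> \<real> \<and> 0 \<le> Re (f x)" "AE x in M. g x \<in> \<real> \<and> 0 \<le> Re (g x)" using f g by (auto simp: pos_fun_def)
  then have "AE x in M. f x + g x \<in> \<real> \<and> 0 \<le> Re (f x + g x)" by eventually_elim auto
  then have "pos_fun (\<lambda>x. f x + g x)" using f g by (auto simp: pos_fun_def Lp_fun_add p0)
  moreover have "v + w = emb (\<lambda>x. f x + g x)" using f g by (simp add: emb_add pos_fun_def)
  ultimately show "v + w \<in> pos" by (auto simp: pos_def)
qed

lemma simple_functions_dense:
  assumes f: "f \<in> L"
  shows "\<exists>s. (\<forall>i::nat. simple_function M (s i) \<and> s i \<in> L) \<and> (\<lambda>i. emb (s i)) \<longlonglongrightarrow> emb f"
proof -
  have [measurable]: "f \<in> borel_measurable M" using f by (simp add: Lp_fun_def)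
  obtain s where s': "(\<forall>i. simple_function M (s i)) \<and> (\<forall>x\<in>space M. (\<lambda>i. s i x) \<longlonglongrightarrow> f x) \<and>
      (\<forall>i. \<forall>x\<in>space M. dist (s i x) 0 \<le> 2 * dist (f x) 0)"
    by (rule exE[OF borel_measurable_implies_sequence_metric[of f M 0]]) auto
  then have s: "\<And>i. simple_function M (s i)" "\<And>x. x \<in> space M \<Longrightarrow> (\<lambda>i. s i x) \<longlonglongrightarrow> f x"
    "\<And>i x. x \<in> space M \<Longrightarrow> dist (s i x) 0 \<le> 2 * dist (f x) 0"
    by auto
  have [measurable]: "s i \<in> borel_measurable M" for i using s(1) by (rule borel_measurable_simple_function)
  have s2: "AE x in M. norm (s i x) \<le> norm (2 * f x)" for i using s(3) by (auto simp: norm_mult)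
  have sL: "s i \<in> L" for i by (rule Lp_fun_dominated[OF _ Lp_fun_scale[OF f] p0 s2]) auto
  have "AE x in M. norm (s i x - f x) \<le> norm (3 * f x)" for i
    using s2[of i]
  proof (rule eventually_mono)
    fix x assume "norm (s i x) \<le> norm (2 * f x)"
    then show "norm (s i x - f x) \<le> norm (3 * f x)" using norm_triangle_ineq4[of "s i x" "f x"] by (simp add: norm_mult)
  qed
  then have "(\<lambda>i. nrm (\<lambda>x. s i x - f x)) \<longlonglongrightarrow> 0"
    by (intro Lp_dominated_convergence[OF _ _ Lp_fun_scale[OF f, of 3]]) (use s(2) in auto)
  then have "(\<lambda>i. emb (s i)) \<longlonglongrightarrow> emb f" by (intro tendsto_emb sL f)
  then show ?thesis using s(1) sL by blast
qed

text \<open>Pointwise inequalities require actual functions. Algebraic identities between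
  representatives hold only almost everywhere, hence the care with null sets below.\<close>

definition rep :: "'a Lp_target \<Rightarrow> 'a \<Rightarrow> complex" where
  "rep v = (SOME f. f \<in> L \<and> emb f = v)"

lemma rep: assumes "v \<in> E" shows "rep v \<in> L" "emb (rep v) = v"
proof -
  have "\<exists>f. f \<in> L \<and> emb f = v" using assms by (auto simp: E_def)
  from someI_ex[OF this] show "rep v \<in> L" "emb (rep v) = v" by (auto simp: rep_def)
qed

lemma rep_emb: "f \<in> L \<Longrightarrow> AE x in M. rep (emb f) x = f x"
  using rep[of "emb f"] emb_eq_iff by (auto simp: E_def)

lemma norm_eq_nrm_rep: "v \<in> E \<Longrightarrow> norm v = nrm (rep v)"
  using rep norm_emb by metis

lemma rep_add: "v \<in> E \<Longrightarrow> w \<in> E \<Longrightarrow> AE x in M. rep (v + w) x = rep v x + rep w x"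
  using rep_emb[of "\<lambda>x. rep v x + rep w x"] rep by (simp add: emb_add Lp_fun_add p0)

lemma rep_scaleR: "v \<in> E \<Longrightarrow> AE x in M. rep (c *\<^sub>R v) x = complex_of_real c * rep v x"
  using rep_emb[of "\<lambda>x. complex_of_real c * rep v x"] rep by (simp add: emb_scaleR Lp_fun_scale)

lemma rep_sum:
  assumes "\<And>i. i \<in> I \<Longrightarrow> v i \<in> E"
  shows "AE x in M. rep (\<Sum>i\<in>I. v i) x = (\<Sum>i\<in>I. rep (v i) x)"
proof -
  have "emb (\<lambda>x. \<Sum>i\<in>I. rep (v i) x) = (\<Sum>i\<in>I. emb (rep (v i)))" by (intro emb_sum rep assms)
  also have "\<dots> = (\<Sum>i\<in>I. v i)" by (intro sum.cong rep assms refl)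
  finally show ?thesis using rep_emb[OF Lp_fun_sum[OF rep(1)[OF assms] p0], where I1 = I and i3 = "\<lambda>i. i"] by simp
qed

lemma rep_pos:
  assumes "v \<in> pos" shows "AE x in M. rep v x \<in> \<real> \<and> 0 \<le> Re (rep v x)"
proof -
  have "v \<in> E" using assms pos_subset by blast
  then have "pos_fun (rep v)" using emb_in_pos_iff[OF rep(1)] rep(2) assms by simp
  then show ?thesis by (simp add: pos_fun_def)
qed

end

section \<open>Convolution with almost positive families of operators\<close>

text \<open>Finite sequences with the p-norm are the Lebesgue space of a counting measure, so
  Minkowski's inequality for them is an instance of \<open>nrm_sum_le\<close>.\<close>

lemma Lp_norm_count_space:
  "Lp_norm (count_space {..<m::nat}) p g = (\<Sum>k<m. norm (g k) powr p) powr (1 / p)"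
  unfolding Lp_norm_def by (subst lebesgue_integral_count_space_finite) auto

lemma Lp_fun_count_space: "g \<in> Lp_fun (count_space {..<m::nat}) p"
  unfolding Lp_fun_def by (auto intro!: integrable_count_space)

text \<open>Young's inequality for a p-summable and a summable sequence, for all \<open>y\<close>
  jointly. The convolution is a sum of shifts of \<open>z\<close> weighted by \<open>c\<close>,
  shifting and truncating do not increase the p-norm, and Minkowski's inequality adds up the
  weights.\<close>

lemma convolution_Young:
  fixes z c :: "nat \<Rightarrow> 'i \<Rightarrow> real"
  assumes p: "1 < p" and z: "\<And>j y. 0 \<le> z j y" and c: "\<And>s y. 0 \<le> c s y"
  shows "(\<Sum>k<m. (\<Sum>j\<le>k. \<Sum>y\<in>I. z j y * c (k - j) y) powr p)
    \<le> (\<Sum>s<m. \<Sum>y\<in>I. (\<Sum>j<m. z j y powr p) powr (1 / p) * c s y) powr p"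
proof (cases "finite I")
  case False
  then show ?thesis by simp
next
  case fin: True
  interpret N: Lp_space "count_space {..<m}" p by unfold_locales (rule p)
  \<comment> \<open>The sequence \<open>z\<close> for the index \<open>y\<close>, shifted by
    \<open>s\<close> and weighted by \<open>c s y\<close>.\<close>
  define g where "g = (\<lambda>(s, y) k. complex_of_real (if s \<le> k then z (k - s) y * c s y else 0))"
  let ?b = "\<lambda>y. (\<Sum>j<m. z j y powr p) powr (1 / p)"
  let ?D = "\<Sum>s<m. \<Sum>y\<in>I. ?b y * c s y"
  have conv: "complex_of_real (\<Sum>j\<le>k. \<Sum>y\<in>I. z j y * c (k - j) y) = (\<Sum>i\<in>{..<m} \<times> I. g i k)" if k: "k < m" for k
  proof -
    have "(\<Sum>i\<in>{..<m} \<times> I. g i k) = (\<Sum>s<m. \<Sum>y\<in>I. g (s, y) k)"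
      by (simp add: sum.cartesian_product)
    also have "\<dots> = (\<Sum>s\<in>{..<m}. if s \<le> k then \<Sum>y\<in>I. complex_of_real (z (k - s) y * c s y) else 0)"
      by (intro sum.cong) (auto simp: g_def)
    also have "\<dots> = (\<Sum>s\<le>k. \<Sum>y\<in>I. complex_of_real (z (k - s) y * c s y))"
      using k by (intro sum.mono_neutral_cong_right) auto
    also have "\<dots> = (\<Sum>j\<le>k. \<Sum>y\<in>I. complex_of_real (z j y * c (k - j) y))"
      by (rule sum.reindex_bij_witness[of _ "\<lambda>j. k - j" "\<lambda>s. k - s"]) auto
    finally show ?thesis by simp
  qed
  have gn: "Lp_norm (count_space {..<m}) p (g (s, y)) \<le> ?b y * c s y" if s: "s < m" for s y
  proof -
    have "(\<Sum>k<m. norm (g (s, y) k) powr p) = (\<Sum>k\<in>{s..<m}. z (k - s) y powr p * c s y powr p)"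
      using z c p by (intro sum.mono_neutral_cong_right) (auto simp: g_def powr_mult abs_mult norm_mult simp flip: of_real_mult)
    also have "\<dots> = (\<Sum>j<m - s. z j y powr p * c s y powr p)"
      by (rule sum.reindex_bij_witness[of _ "\<lambda>j. j + s" "\<lambda>k. k - s"]) auto
    also have "\<dots> \<le> (\<Sum>j<m. z j y powr p * c s y powr p)" by (intro sum_mono2) auto
    also have "\<dots> = (\<Sum>j<m. z j y powr p) * c s y powr p" by (simp add: sum_distrib_right)
    finally have "Lp_norm (count_space {..<m}) p (g (s, y)) \<le> ((\<Sum>j<m. z j y powr p) * c s y powr p) powr (1 / p)"
      unfolding Lp_norm_count_space using p by (intro powr_mono2 sum_nonneg) auto
    also have "\<dots> = ?b y * c s y" using p c by (simp add: powr_mult sum_nonneg powr_powr)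
    finally show ?thesis .
  qed
  have "Lp_norm (count_space {..<m}) p (\<lambda>k. \<Sum>i\<in>{..<m} \<times> I. g i k) \<le> (\<Sum>i\<in>{..<m} \<times> I. Lp_norm (count_space {..<m}) p (g i))"
    by (rule N.nrm_sum_le) (rule Lp_fun_count_space)
  also have "\<dots> \<le> (\<Sum>(s, y)\<in>{..<m} \<times> I. ?b y * c s y)" using gn by (intro sum_mono) auto
  also have "\<dots> = ?D" by (simp add: sum.cartesian_product)
  finally have le: "Lp_norm (count_space {..<m}) p (\<lambda>k. \<Sum>i\<in>{..<m} \<times> I. g i k) \<le> ?D" .
  have "(\<Sum>k<m. (\<Sum>j\<le>k. \<Sum>y\<in>I. z j y * c (k - j) y) powr p)
      = (\<Sum>k<m. norm (\<Sum>i\<in>{..<m} \<times> I. g i k) powr p)"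
  proof (rule sum.cong[OF refl])
    fix k assume "k \<in> {..<m}"
    then have k: "k < m" by simp
    have "0 \<le> (\<Sum>j\<le>k. \<Sum>y\<in>I. z j y * c (k - j) y)" using z c by (intro sum_nonneg mult_nonneg_nonneg)
    then show "(\<Sum>j\<le>k. \<Sum>y\<in>I. z j y * c (k - j) y) powr p = norm (\<Sum>i\<in>{..<m} \<times> I. g i k) powr p"
      unfolding conv[OF k, symmetric] norm_of_real by simp
  qed
  also have "\<dots> = Lp_norm (count_space {..<m}) p (\<lambda>k. \<Sum>i\<in>{..<m} \<times> I. g i k) powr p"
    unfolding Lp_norm_count_space using p by (simp add: powr_powr sum_nonneg)
  also have "\<dots> \<le> ?D powr p" using le p by (intro powr_mono2) (auto simp: Lp_norm_nonneg)
  finally show ?thesis .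
qed

context Lp_space begin

text \<open>Multiplication by a complex scalar, transported to \<open>E\<close> through
  representatives, since the target type is treated as a real Banach space.\<close>

definition cm :: "complex \<Rightarrow> 'a Lp_target \<Rightarrow> 'a Lp_target" where
  "cm c v = emb (\<lambda>x. c * rep v x)"

lemma cm_in: "v \<in> E \<Longrightarrow> cm c v \<in> E"
  by (auto simp: cm_def E_def rep intro!: imageI Lp_fun_scale rep[unfolded E_def])

lemma rep_cm: "v \<in> E \<Longrightarrow> AE x in M. rep (cm c v) x = c * rep v x"
  unfolding cm_def by (intro rep_emb Lp_fun_scale rep)

lemma cm_emb: assumes "f \<in> L" shows "cm c (emb f) = emb (\<lambda>x. c * f x)"
  unfolding cm_def
proof (subst emb_eq_iff)
  have e: "emb f \<in> E" using assms by (simp add: E_def)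
  show "(\<lambda>x. c * rep (emb f) x) \<in> L" "(\<lambda>x. c * f x) \<in> L" using assms e by (auto intro!: Lp_fun_scale rep)
  show "AE x in M. c * rep (emb f) x = c * f x" using rep_emb[OF assms] by eventually_elim simp
qed

lemma norm_powr_eq: "v \<in> E \<Longrightarrow> norm v powr p = (\<integral>x. norm (rep v x) powr p \<partial>M)"
  by (simp add: norm_eq_nrm_rep Lp_norm_powr p0)

lemma emb_in: "f \<in> L \<Longrightarrow> emb f \<in> E" by (simp add: E_def)

end

text \<open>
  A family of operators \<open>U\<^sub>s\<close> such that the negative part of \<open>U\<^sub>s h\<close> is bounded by \<open>\<parallel>h\<parallel> e\<^sub>s\<close> for all
  \<open>h \<ge> 0\<close>, and whose sum over \<open>s\<close> is controlled by \<open>K\<close>. On a finite sum \<open>\<Sum>\<^sub>y b\<^sub>y h\<^sub>y\<close> with \<open>b\<^sub>y h\<^sub>y \<ge> 0\<close>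
  the negative parts of all \<open>U\<^sub>s (b\<^sub>y h\<^sub>y)\<close> together are bounded by \<open>\<parallel>\<Sum>\<^sub>y b\<^sub>y h\<^sub>y\<parallel> e\<^sub>s\<close>: at a given point one
  applies the bound to the subsum over those \<open>y\<close> for which \<open>U\<^sub>s h\<^sub>y\<close> is negative there. Hence the moduli
  of the operators satisfy the same estimate, as if they were positive.
\<close>

locale almost_positive_family = Lp_space M p for M :: "'a measure" and p :: real +
  fixes U :: "nat \<Rightarrow> 'a Lp_target \<Rightarrow> 'a Lp_target" and e :: "nat \<Rightarrow> 'a Lp_target" and m :: nat and K :: real
  assumes U_in: "\<And>s v. v \<in> E \<Longrightarrow> U s v \<in> E"
    and U_add: "\<And>s v w. v \<in> E \<Longrightarrow> w \<in> E \<Longrightarrow> U s (v + w) = U s v + U s w"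
    and U_scaleR: "\<And>s v r. v \<in> E \<Longrightarrow> U s (r *\<^sub>R v) = r *\<^sub>R U s v"
    and U_cm: "\<And>s v c. v \<in> E \<Longrightarrow> U s (cm c v) = cm c (U s v)"
    and U_limit: "\<And>s X v. (\<And>n::nat. X n \<in> E) \<Longrightarrow> v \<in> E \<Longrightarrow> X \<longlonglongrightarrow> v \<Longrightarrow> (\<lambda>n. U s (X n)) \<longlonglongrightarrow> U s v"
    and e_pos: "\<And>s. e s \<in> pos"
    and U_lower: "\<And>s h. h \<in> pos \<Longrightarrow> U s h + norm h *\<^sub>R e s \<in> pos"
    and K0: "0 \<le> K"
    and U_total: "\<And>h. h \<in> pos \<Longrightarrow>
      \<exists>y\<in>pos. norm y \<le> K * norm h \<and> y - (\<Sum>s<m. U s h + (2 * norm h) *\<^sub>R e s) \<in> pos"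
begin

lemma E_ops: "0 \<in> E" "v \<in> E \<Longrightarrow> w \<in> E \<Longrightarrow> v + w \<in> E" "v \<in> E \<Longrightarrow> r *\<^sub>R v \<in> E" "(\<And>i. i \<in> I \<Longrightarrow> g i \<in> E) \<Longrightarrow> sum g I \<in> E"
  using subspace_E subspace_sum[OF subspace_E] by (auto simp: subspace_def)

lemma U_sum: "(\<And>i. i \<in> I \<Longrightarrow> g i \<in> E) \<Longrightarrow> U s (sum g I) = (\<Sum>i\<in>I. U s (g i))"
proof (induction I rule: infinite_finite_induct)
  case (insert x I) then show ?case by (simp add: U_add E_ops)
qed (use U_scaleR[of 0 s 0] E_ops in simp_all)

lemma e_in: "e s \<in> E" using e_pos pos_subset by blast

text \<open>The monotonicity assumption makes one multiple \<open>X\<close> of \<open>e s\<close>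
  serve as lower bound for every subsum. The modulus of each \<open>U s (h y)\<close> is then paid
  for by the total in \<open>U_total\<close>, whose factor 2 matches twice the negative
  parts.\<close>

lemma moduli_bound:
  fixes b :: "'i \<Rightarrow> real" and h :: "'i \<Rightarrow> 'a Lp_target"
  assumes I: "finite I" and b: "\<And>y. y \<in> I \<Longrightarrow> 0 \<le> b y" and h: "\<And>y. y \<in> I \<Longrightarrow> h y \<in> pos"
    and mono: "\<And>F. F \<subseteq> I \<Longrightarrow> norm (\<Sum>y\<in>F. b y *\<^sub>R h y) \<le> X" and X: "norm (\<Sum>y\<in>I. b y *\<^sub>R h y) = X"
  shows "\<exists>w\<in>pos. norm w \<le> K * X \<and>
    (AE x in M. (\<Sum>s<m. \<Sum>y\<in>I. b y * norm (rep (U s (h y)) x)) \<le> Re (rep w x))"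
proof -
  have hE: "y \<in> I \<Longrightarrow> h y \<in> E" for y using h pos_subset by blast
  have bhE: "F \<subseteq> I \<Longrightarrow> (\<Sum>y\<in>F. b y *\<^sub>R h y) \<in> pos" for F
    using b h closed_cone_pos by (intro closed_cone_sum closed_cone_scale) auto
  have bhE': "F \<subseteq> I \<Longrightarrow> (\<Sum>y\<in>F. b y *\<^sub>R h y) \<in> E" for F using bhE pos_subset by blast
  have UF: "U s (\<Sum>y\<in>F. b y *\<^sub>R h y) = (\<Sum>y\<in>F. b y *\<^sub>R U s (h y))" if F: "F \<subseteq> I" for F s
    using F hE by (subst U_sum) (auto intro!: E_ops U_scaleR sum.cong)
  have repU: "AE x in M. rep (U s (\<Sum>y\<in>F. b y *\<^sub>R h y)) x = (\<Sum>y\<in>F. complex_of_real (b y) * rep (U s (h y)) x)"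
    if F: "F \<subseteq> I" for F s
  proof -
    have "AE x in M. rep (U s (\<Sum>y\<in>F. b y *\<^sub>R h y)) x = (\<Sum>y\<in>F. rep (b y *\<^sub>R U s (h y)) x)"
      unfolding UF[OF F] using F hE by (intro rep_sum E_ops U_in) auto
    moreover have "AE x in M. \<forall>y\<in>F. rep (b y *\<^sub>R U s (h y)) x = complex_of_real (b y) * rep (U s (h y)) x"
      using F hE finite_subset[OF F I] by (intro AE_finite_allI rep_scaleR U_in) auto
    ultimately show ?thesis by eventually_elim simp
  qed
  obtain w where w: "w \<in> pos" "norm w \<le> K * X"
    "w - (\<Sum>s<m. U s (\<Sum>y\<in>I. b y *\<^sub>R h y) + (2 * X) *\<^sub>R e s) \<in> pos"
    using U_total[OF bhE[of I]] X by auto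
  have "AE x in M. (\<Sum>s<m. \<Sum>y\<in>I. b y * norm (rep (U s (h y)) x)) \<le> Re (rep w x)"
  proof -
    let ?H = "\<Sum>y\<in>I. b y *\<^sub>R h y"
    have e1: "AE x in M. \<forall>s\<in>{..<m}. rep (e s) x \<in> \<real> \<and> 0 \<le> Re (rep (e s) x)"
      by (intro AE_finite_allI rep_pos e_pos) auto
    have lowAE: "AE x in M. rep (U s g + norm g *\<^sub>R e s) x = rep (U s g) x + complex_of_real (norm g) * rep (e s) x"
      if g: "g \<in> E" for g s
    proof -
      have "AE x in M. rep (U s g + norm g *\<^sub>R e s) x = rep (U s g) x + rep (norm g *\<^sub>R e s) x"
        by (intro rep_add U_in g E_ops e_in)
      moreover have "AE x in M. rep (norm g *\<^sub>R e s) x = complex_of_real (norm g) * rep (e s) x"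
        by (intro rep_scaleR e_in)
      ultimately show ?thesis by eventually_elim simp
    qed
    have low: "AE x in M. rep (U s g) x + complex_of_real (norm g) * rep (e s) x \<in> \<real> \<and>
        0 \<le> Re (rep (U s g) x + complex_of_real (norm g) * rep (e s) x)" if g: "g \<in> pos" for g s
    proof -
      have "g \<in> E" using g pos_subset by blast
      from lowAE[OF this, of s] rep_pos[OF U_lower[OF g, of s]] show ?thesis by eventually_elim simp
    qed
    have r1: "AE x in M. \<forall>s\<in>{..<m}. \<forall>y\<in>I. rep (U s (h y)) x + complex_of_real (norm (h y)) * rep (e s) x \<in> \<real>"
    proof (intro AE_finite_allI)
      fix s y assume "y \<in> I"
      from low[OF h[OF this], of s]
      show "AE x in M. rep (U s (h y)) x + complex_of_real (norm (h y)) * rep (e s) x \<in> \<real>" by eventually_elim simp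
    qed (use I in auto)
    \<comment> \<open>The set of negative terms varies with the point. There are only finitely many
      subsets of \<open>I\<close>, so one null set is discarded for all of them before the point is
      fixed.\<close>
    have F1: "AE x in M. \<forall>s\<in>{..<m}. \<forall>F\<in>Pow I. 0 \<le> (\<Sum>y\<in>F. b y * Re (rep (U s (h y)) x)) + X * Re (rep (e s) x)"
    proof (intro AE_finite_allI)
      fix s F assume "F \<in> Pow I"
      then have F: "F \<subseteq> I" by simp
      let ?g = "\<Sum>y\<in>F. b y *\<^sub>R h y"
      show "AE x in M. 0 \<le> (\<Sum>y\<in>F. b y * Re (rep (U s (h y)) x)) + X * Re (rep (e s) x)"
        using low[OF bhE[OF F], of s] repU[OF F, of s] rep_pos[OF e_pos[of s]]
      proof eventually_elim
        case (elim x)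
        have "norm ?g * Re (rep (e s) x) \<le> X * Re (rep (e s) x)" using mono[OF F] elim by (intro mult_right_mono) auto
        then show ?case using elim by simp
      qed
    qed (use I in auto)
    have tot: "AE x in M. (\<Sum>s<m. (\<Sum>y\<in>I. b y * Re (rep (U s (h y)) x)) + 2 * X * Re (rep (e s) x)) \<le> Re (rep w x)"
    proof -
      let ?W = "\<lambda>s. U s ?H + (2 * X) *\<^sub>R e s"
      have WE: "?W s \<in> E" for s by (intro E_ops U_in bhE' order_refl e_in)
      have wE: "w \<in> E" using w pos_subset by blast
      have "AE x in M. rep (w + (- 1) *\<^sub>R (\<Sum>s<m. ?W s)) x = rep w x + rep ((- 1) *\<^sub>R (\<Sum>s<m. ?W s)) x"
        by (intro rep_add wE E_ops WE)
      moreover have "AE x in M. rep ((- 1) *\<^sub>R (\<Sum>s<m. ?W s)) x = complex_of_real (- 1) * rep (\<Sum>s<m. ?W s) x"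
        by (intro rep_scaleR E_ops WE)
      moreover have "AE x in M. rep (\<Sum>s<m. ?W s) x = (\<Sum>s<m. rep (?W s) x)" by (intro rep_sum WE)
      moreover have "AE x in M. \<forall>s\<in>{..<m}. rep (?W s) x = rep (U s ?H) x + rep ((2 * X) *\<^sub>R e s) x"
        by (intro AE_finite_allI rep_add U_in bhE' order_refl E_ops e_in) auto
      moreover have "AE x in M. \<forall>s\<in>{..<m}. rep ((2 * X) *\<^sub>R e s) x = complex_of_real (2 * X) * rep (e s) x"
        by (intro AE_finite_allI rep_scaleR e_in) auto
      moreover have "AE x in M. \<forall>s\<in>{..<m}. rep (U s ?H) x = (\<Sum>y\<in>I. complex_of_real (b y) * rep (U s (h y)) x)"
        by (intro AE_finite_allI repU) auto
      moreover have "AE x in M. 0 \<le> Re (rep (w + (- 1) *\<^sub>R (\<Sum>s<m. ?W s)) x)"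
        using rep_pos[OF w(3)] by eventually_elim simp
      ultimately show ?thesis
      proof eventually_elim
        case (elim x)
        have "(\<Sum>s<m. rep (?W s) x) = (\<Sum>s<m. (\<Sum>y\<in>I. complex_of_real (b y) * rep (U s (h y)) x) + complex_of_real (2 * X) * rep (e s) x)"
          using elim by (intro sum.cong) auto
        then have "Re (\<Sum>s<m. rep (?W s) x) = (\<Sum>s<m. (\<Sum>y\<in>I. b y * Re (rep (U s (h y)) x)) + 2 * X * Re (rep (e s) x))"
          by simp
        then show ?case using elim(1,2,3,7) by simp
      qed
    qed
    from e1 r1 F1 tot show ?thesis
    proof eventually_elim
      case (elim x)
      have "(\<Sum>y\<in>I. b y * norm (rep (U s (h y)) x)) \<le> (\<Sum>y\<in>I. b y * Re (rep (U s (h y)) x)) + 2 * X * Re (rep (e s) x)"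
        if s: "s < m" for s
      proof -
        define F where "F = {y\<in>I. Re (rep (U s (h y)) x) < 0}"
        have real: "rep (U s (h y)) x \<in> \<real>" if "y \<in> I" for y
        proof -
          have "rep (U s (h y)) x + complex_of_real (norm (h y)) * rep (e s) x \<in> \<real>" "rep (e s) x \<in> \<real>"
            using elim(1,2) that s by auto
          then have "rep (U s (h y)) x + complex_of_real (norm (h y)) * rep (e s) x - complex_of_real (norm (h y)) * rep (e s) x \<in> \<real>"
            by (intro Reals_diff Reals_mult) auto
          then show ?thesis by simp
        qed
        \<comment> \<open>The modulus of a real number is the number plus twice its negative part;
          this is the origin of the factor 2 in \<open>U_total\<close>.\<close>
        have nr: "norm (rep (U s (h y)) x) = Re (rep (U s (h y)) x) + 2 * (if y \<in> F then - Re (rep (U s (h y)) x) else 0)"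
          if "y \<in> I" for y
        proof -
          have "rep (U s (h y)) x = complex_of_real (Re (rep (U s (h y)) x))" using real[OF that] by simp
          then have "norm (rep (U s (h y)) x) = \<bar>Re (rep (U s (h y)) x)\<bar>" by (metis norm_of_real)
          then show ?thesis using that by (simp add: F_def)
        qed
        have "(\<Sum>y\<in>I. b y * norm (rep (U s (h y)) x)) =
            (\<Sum>y\<in>I. b y * Re (rep (U s (h y)) x) + 2 * (if y \<in> F then - (b y * Re (rep (U s (h y)) x)) else 0))"
          using nr by (intro sum.cong) (auto simp: algebra_simps)
        also have "\<dots> = (\<Sum>y\<in>I. b y * Re (rep (U s (h y)) x)) + 2 * (\<Sum>y\<in>I. if y \<in> F then - (b y * Re (rep (U s (h y)) x)) else 0)"
          by (simp add: sum.distrib sum_distrib_left)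
        also have "(\<Sum>y\<in>I. if y \<in> F then - (b y * Re (rep (U s (h y)) x)) else 0) = (\<Sum>y\<in>F. - (b y * Re (rep (U s (h y)) x)))"
          using I by (intro sum.mono_neutral_cong_right) (auto simp: F_def)
        also have "\<dots> \<le> X * Re (rep (e s) x)"
        proof -
          have "F \<in> Pow I" by (auto simp: F_def)
          then have "0 \<le> (\<Sum>y\<in>F. b y * Re (rep (U s (h y)) x)) + X * Re (rep (e s) x)"
            using elim(3)[rule_format, of s F] s by simp
          then show ?thesis by (simp add: sum_negf)
        qed
        finally show ?thesis by simp
      qed
      then have "(\<Sum>s<m. \<Sum>y\<in>I. b y * norm (rep (U s (h y)) x)) \<le>
          (\<Sum>s<m. (\<Sum>y\<in>I. b y * Re (rep (U s (h y)) x)) + 2 * X * Re (rep (e s) x))"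
        by (intro sum_mono) auto
      then show ?case using elim(4) by linarith
    qed
  qed
  with w show ?thesis by blast
qed

text \<open>The space splits into finitely many sets on which the whole tuple of functions is
  constant. The operators are applied only to the indicators \<open>h y\<close> of these sets, which
  are positive, and the complex values are pulled out by \<open>cm\<close>. At each point Young's
  inequality leaves the sum that \<open>moduli_bound\<close> controls.\<close>

lemma convolution_bound_simple:
  assumes simple: "\<And>j. j < m \<Longrightarrow> simple_function M (f j)" and fL: "\<And>j. j < m \<Longrightarrow> f j \<in> L"
  shows "(\<Sum>k<m. norm (\<Sum>j\<le>k. U (k - j) (emb (f j))) powr p) \<le> K powr p * (\<Sum>j<m. norm (emb (f j)) powr p)"
proof -
  define tup where "tup x = restrict (\<lambda>j. f j x) {..<m}" for x
  \<comment> \<open>Leaving out the zero tuple ensures that each remaining indicator is dominated by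
    a multiple of some \<open>f j\<close>, hence p-integrable.\<close>
  define I where "I = tup ` space M - {restrict (\<lambda>_. 0) {..<m}}"
  have finI: "finite I"
  proof -
    have "tup ` space M \<subseteq> PiE {..<m} (\<lambda>j. f j ` space M)"
      by (auto simp: tup_def split: if_splits)
    moreover have "finite (PiE {..<m} (\<lambda>j. f j ` space M))"
      by (intro finite_PiE) (auto intro: simple_functionD(1)[OF simple])
    ultimately show ?thesis unfolding I_def by (meson finite_Diff finite_subset)
  qed
  have Inz: "\<exists>j<m. y j \<noteq> 0" if y: "y \<in> I" for y
  proof (rule ccontr)
    assume a: "\<not> ?thesis"
    obtain x where x: "x \<in> space M" "y = tup x" using y by (auto simp: I_def)
    have "y = restrict (\<lambda>_. 0) {..<m}"
    proof
      fix j show "y j = restrict (\<lambda>_. 0) {..<m} j"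
        using a x by (cases "j < m") (auto simp: tup_def)
    qed
    then show False using y by (simp add: I_def)
  qed
  have fM [measurable]: "f j \<in> borel_measurable M" if "j < m" for j using fL[OF that] by (rule Lp_fun_measurable)
  have tup_iff: "tup x = tup x' \<longleftrightarrow> (\<forall>j<m. f j x = f j x')" for x x'
    by (auto simp: tup_def fun_eq_iff restrict_def split: if_splits)
  define chi where "chi y x = (if tup x = y then 1 else 0 :: complex)" for y x
  have chiM: "chi y \<in> borel_measurable M" if y: "y \<in> I" for y
  proof -
    obtain x' where x': "x' \<in> space M" "y = tup x'" using y by (auto simp: I_def)
    have "{x \<in> space M. tup x = y} = {x \<in> space M. \<forall>j\<in>{..<m}. f j x = f j x'}"
      unfolding x' tup_iff by auto
    also have "\<dots> \<in> sets M"
    proof (rule sets.sets_Collect_finite_All)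
      fix j assume "j \<in> {..<m}"
      then have "j < m" by simp
      then show "{x \<in> space M. f j x = f j x'} \<in> sets M"
        using measurable_sets[OF fM, of j "{f j x'}"] by (simp add: vimage_def Int_def conj_commute)
    qed auto
    finally show ?thesis unfolding chi_def by (intro measurable_If) auto
  qed
  have chiL: "chi y \<in> L" if y: "y \<in> I" for y
  proof -
    obtain j where j: "j < m" "y j \<noteq> 0" using Inz[OF y] by blast
    show ?thesis
    proof (rule Lp_fun_dominated[OF chiM[OF y] Lp_fun_scale[OF fL[OF j(1)]] p0])
      show "AE x in M. norm (chi y x) \<le> norm (inverse (y j) * f j x)"
        using j by (auto simp: chi_def tup_def intro!: AE_I2)
    qed
  qed
  define h where "h y = emb (chi y)" for y
  have hpos: "h y \<in> pos" if "y \<in> I" for y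
    unfolding h_def using chiL[OF that] by (subst emb_in_pos_iff) (auto simp: pos_fun_def chi_def)
  have hE: "h y \<in> E" if "y \<in> I" for y using hpos[OF that] pos_subset by blast
  \<comment> \<open>The p-norm of the tuple \<open>y\<close> over time. Thus
    \<open>\<Sum>y\<in>I. b y *\<^sub>R h y\<close> represents the pointwise p-norm of the family
    \<open>f\<close>, and its norm \<open>X\<close> satisfies \<open>Xp\<close>.\<close>
  define b where "b y = (\<Sum>j<m. norm (y j) powr p) powr (1 / p)" for y :: "nat \<Rightarrow> complex"
  have b0: "0 \<le> b y" for y by (simp add: b_def)
  have f_eq: "f j x = (\<Sum>y\<in>I. y j * chi y x)" if x: "x \<in> space M" and j: "j < m" for j x
  proof (cases "tup x \<in> I")
    case True
    have "(\<Sum>y\<in>I. y j * chi y x) = (\<Sum>y\<in>I. if y = tup x then tup x j else 0)"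
      by (intro sum.cong) (auto simp: chi_def)
    then show ?thesis using True finI j by (simp add: tup_def)
  next
    case False
    then have "tup x = restrict (\<lambda>_. 0) {..<m}" using x by (auto simp: I_def)
    then have "f j x = 0" using j by (auto simp: tup_def fun_eq_iff restrict_def split: if_splits)
    moreover have "(\<Sum>y\<in>I. y j * chi y x) = 0" using False by (intro sum.neutral) (auto simp: chi_def)
    ultimately show ?thesis by simp
  qed
  have bsum: "(\<Sum>y\<in>I. complex_of_real (b y) * chi y x) = complex_of_real ((\<Sum>j<m. norm (f j x) powr p) powr (1 / p))"
    if x: "x \<in> space M" for x
  proof (cases "tup x \<in> I")
    case True
    have "(\<Sum>y\<in>I. complex_of_real (b y) * chi y x) = (\<Sum>y\<in>I. if y = tup x then complex_of_real (b (tup x)) else 0)"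
      by (intro sum.cong) (auto simp: chi_def)
    then show ?thesis using True finI by (simp add: b_def tup_def)
  next
    case False
    then have "tup x = restrict (\<lambda>_. 0) {..<m}" using x by (auto simp: I_def)
    then have "f j x = 0" if "j < m" for j using that by (auto simp: tup_def fun_eq_iff restrict_def split: if_splits)
    moreover have "(\<Sum>y\<in>I. complex_of_real (b y) * chi y x) = 0" using False by (intro sum.neutral) (auto simp: chi_def)
    ultimately show ?thesis using p0 by simp
  qed
  have bchi: "(\<Sum>y\<in>F. b y *\<^sub>R h y) = emb (\<lambda>x. \<Sum>y\<in>F. complex_of_real (b y) * chi y x)" if "F \<subseteq> I" for F
    using that chiL by (subst emb_sum) (auto simp: h_def emb_scaleR Lp_fun_scale intro!: sum.cong)
  have bL: "(\<lambda>x. \<Sum>y\<in>F. complex_of_real (b y) * chi y x) \<in> L" if "F \<subseteq> I" for F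
    using that chiL p0 by (intro Lp_fun_sum Lp_fun_scale) auto
  define X where "X = norm (\<Sum>y\<in>I. b y *\<^sub>R h y)"
  have mono: "norm (\<Sum>y\<in>F. b y *\<^sub>R h y) \<le> X" if F: "F \<subseteq> I" for F
  proof -
    have "norm (\<Sum>y\<in>F. complex_of_real (b y) * chi y x) \<le> norm (\<Sum>y\<in>I. complex_of_real (b y) * chi y x)" for x
    proof -
      have e: "(\<Sum>y\<in>G. complex_of_real (b y) * chi y x) = complex_of_real (\<Sum>y\<in>G. if tup x = y then b y else 0)" for G
        unfolding of_real_sum by (intro sum.cong) (auto simp: chi_def)
      have "(\<Sum>y\<in>F. if tup x = y then b y else 0) \<le> (\<Sum>y\<in>I. if tup x = y then b y else 0)"
        using F finI b0 by (intro sum_mono2) auto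
      moreover have "0 \<le> (\<Sum>y\<in>F. if tup x = y then b y else 0)" using b0 by (intro sum_nonneg) auto
      ultimately show ?thesis unfolding e norm_of_real by linarith
    qed
    then have "nrm (\<lambda>x. \<Sum>y\<in>F. complex_of_real (b y) * chi y x) \<le> nrm (\<lambda>x. \<Sum>y\<in>I. complex_of_real (b y) * chi y x)"
      by (intro Lp_norm_mono p0 bL Lp_fun_measurable[OF bL] F) auto
    then show ?thesis using F by (simp add: X_def bchi norm_emb bL)
  qed
  have Xp: "X powr p = (\<Sum>j<m. norm (emb (f j)) powr p)"
  proof -
    have "X powr p = (\<integral>x. norm (\<Sum>y\<in>I. complex_of_real (b y) * chi y x) powr p \<partial>M)"
      by (simp add: X_def bchi norm_emb bL Lp_norm_powr p0)
    also have "\<dots> = (\<integral>x. (\<Sum>j<m. norm (f j x) powr p) \<partial>M)"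
      by (rule Bochner_Integration.integral_cong) (use p0 in \<open>auto simp: bsum powr_powr sum_nonneg\<close>)
    also have "\<dots> = (\<Sum>j<m. \<integral>x. norm (f j x) powr p \<partial>M)"
      using fL by (intro Bochner_Integration.integral_sum Lp_fun_integrable) auto
    also have "\<dots> = (\<Sum>j<m. norm (emb (f j)) powr p)"
      using fL by (intro sum.cong) (auto simp: norm_emb Lp_norm_powr p0)
    finally show ?thesis .
  qed
  have "\<exists>w\<in>pos. norm w \<le> K * X \<and>
      (AE x in M. (\<Sum>s<m. \<Sum>y\<in>I. b y * norm (rep (U s (h y)) x)) \<le> Re (rep w x))"
    by (rule moduli_bound[OF finI b0 hpos mono X_def[symmetric]])
  then obtain w where w: "w \<in> pos" "norm w \<le> K * X"
    "AE x in M. (\<Sum>s<m. \<Sum>y\<in>I. b y * norm (rep (U s (h y)) x)) \<le> Re (rep w x)"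
    by blast
  have wE: "w \<in> E" using w pos_subset by blast
  let ?V = "\<lambda>k. \<Sum>j\<le>k. U (k - j) (emb (f j))"
  have VE: "?V k \<in> E" if "k < m" for k using that fL by (intro E_ops U_in emb_in) auto
  have emb_f: "emb (f j) = (\<Sum>y\<in>I. cm (y j) (h y))" if j: "j < m" for j
  proof -
    have "emb (f j) = emb (\<lambda>x. \<Sum>y\<in>I. y j * chi y x)"
      using fL[OF j] chiL p0 j f_eq by (subst emb_eq_iff) (auto intro!: Lp_fun_sum Lp_fun_scale AE_I2)
    also have "\<dots> = (\<Sum>y\<in>I. emb (\<lambda>x. y j * chi y x))" using chiL by (intro emb_sum Lp_fun_scale) auto
    also have "\<dots> = (\<Sum>y\<in>I. cm (y j) (h y))" using chiL by (intro sum.cong) (auto simp: h_def cm_emb)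
    finally show ?thesis .
  qed
  have repV: "AE x in M. rep (?V k) x = (\<Sum>j\<le>k. \<Sum>y\<in>I. y j * rep (U (k - j) (h y)) x)" if k: "k < m" for k
  proof -
    have V: "?V k = (\<Sum>j\<le>k. \<Sum>y\<in>I. cm (y j) (U (k - j) (h y)))"
    proof (intro sum.cong refl)
      fix j assume "j \<in> {..k}"
      then have j: "j < m" using k by simp
      show "U (k - j) (emb (f j)) = (\<Sum>y\<in>I. cm (y j) (U (k - j) (h y)))"
        unfolding emb_f[OF j] using hE by (subst U_sum) (auto intro!: cm_in sum.cong U_cm)
    qed
    have "AE x in M. rep (?V k) x = (\<Sum>j\<le>k. rep (\<Sum>y\<in>I. cm (y j) (U (k - j) (h y))) x)"
      unfolding V using hE by (intro rep_sum E_ops cm_in U_in) auto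
    moreover have "AE x in M. \<forall>j\<in>{..k}. rep (\<Sum>y\<in>I. cm (y j) (U (k - j) (h y))) x = (\<Sum>y\<in>I. rep (cm (y j) (U (k - j) (h y))) x)"
      using hE by (intro AE_finite_allI rep_sum cm_in U_in) auto
    moreover have "AE x in M. \<forall>j\<in>{..k}. \<forall>y\<in>I. rep (cm (y j) (U (k - j) (h y))) x = y j * rep (U (k - j) (h y)) x"
      using hE finI by (intro AE_finite_allI rep_cm U_in) auto
    ultimately show ?thesis by eventually_elim simp
  qed
  \<comment> \<open>Young's inequality is used at a fixed point \<open>x\<close>, with
    \<open>norm (y j)\<close> as the p-summable sequence and \<open>norm (rep (U s (h y)) x)\<close>
    as the summable one.\<close>
  have pointwise: "AE x in M. (\<Sum>k<m. norm (rep (?V k) x) powr p) \<le> norm (rep w x) powr p"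
  proof -
    have "AE x in M. \<forall>k\<in>{..<m}. rep (?V k) x = (\<Sum>j\<le>k. \<Sum>y\<in>I. y j * rep (U (k - j) (h y)) x)"
      using repV by (intro AE_finite_allI) auto
    with w(3) show ?thesis
    proof eventually_elim
      case (elim x)
      let ?c = "\<lambda>s y. norm (rep (U s (h y)) x)"
      let ?D = "\<Sum>s<m. \<Sum>y\<in>I. b y * ?c s y"
      have "(\<Sum>k<m. norm (rep (?V k) x) powr p) \<le> (\<Sum>k<m. (\<Sum>j\<le>k. \<Sum>y\<in>I. norm (y j) * ?c (k - j) y) powr p)"
      proof (rule sum_mono)
        fix k assume k: "k \<in> {..<m}"
        have "norm (rep (?V k) x) \<le> (\<Sum>j\<le>k. \<Sum>y\<in>I. norm (y j * rep (U (k - j) (h y)) x))"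
          using elim(2) k by (auto intro!: order_trans[OF norm_sum] sum_mono)
        then show "norm (rep (?V k) x) powr p \<le> (\<Sum>j\<le>k. \<Sum>y\<in>I. norm (y j) * ?c (k - j) y) powr p"
          using p0 by (intro powr_mono2) (auto simp: norm_mult)
      qed
      also have "\<dots> \<le> ?D powr p" unfolding b_def by (rule convolution_Young[OF p1]) auto
      also have "\<dots> \<le> norm (rep w x) powr p"
      proof (rule powr_mono2)
        show "?D \<le> norm (rep w x)" using elim(1) complex_Re_le_cmod order_trans by blast
      qed (use p0 b0 in \<open>auto intro!: sum_nonneg\<close>)
      finally show ?case .
    qed
  qed
  have int: "integrable M (\<lambda>x. norm (rep v x) powr p)" if "v \<in> E" for v
    by (intro Lp_fun_integrable rep that)
  have "(\<Sum>k<m. norm (?V k) powr p) = (\<Sum>k<m. \<integral>x. norm (rep (?V k) x) powr p \<partial>M)"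
    using VE by (intro sum.cong) (auto simp: norm_powr_eq)
  also have "\<dots> = (\<integral>x. (\<Sum>k<m. norm (rep (?V k) x) powr p) \<partial>M)"
    using VE int by (intro Bochner_Integration.integral_sum[symmetric]) auto
  also have "\<dots> \<le> (\<integral>x. norm (rep w x) powr p \<partial>M)"
    using VE int wE pointwise by (intro integral_mono_AE Bochner_Integration.integrable_sum) auto
  also have "\<dots> = norm w powr p" using wE by (simp add: norm_powr_eq)
  also have "\<dots> \<le> (K * X) powr p" using w p0 by (intro powr_mono2) auto
  also have "\<dots> = K powr p * X powr p" using K0 by (simp add: powr_mult X_def)
  finally show ?thesis unfolding Xp .
qed

text \<open>Only finitely many terms occur, so both sides are continuous in the vectors
  \<open>u j\<close>, and simple functions are dense.\<close>

lemma convolution_bound: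
  assumes u: "\<And>j. j < m \<Longrightarrow> u j \<in> E"
  shows "(\<Sum>k<m. norm (\<Sum>j\<le>k. U (k - j) (u j)) powr p) \<le> K powr p * (\<Sum>j<m. norm (u j) powr p)"
proof -
  have "\<exists>s. (\<forall>i::nat. simple_function M (s i) \<and> s i \<in> L) \<and> (\<lambda>i. emb (s i)) \<longlonglongrightarrow> u j" if "j < m" for j
    using simple_functions_dense[OF rep(1)[OF u[OF that]]] rep(2)[OF u[OF that]] by simp
  then obtain s where s: "\<And>j i. j < m \<Longrightarrow> simple_function M (s j i)" "\<And>j i. j < m \<Longrightarrow> s j i \<in> L"
    "\<And>j. j < m \<Longrightarrow> (\<lambda>i. emb (s j i)) \<longlonglongrightarrow> u j" by metis
  show ?thesis
  proof (rule LIMSEQ_le)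
    show "(\<lambda>i. \<Sum>k<m. norm (\<Sum>j\<le>k. U (k - j) (emb (s j i))) powr p) \<longlonglongrightarrow> (\<Sum>k<m. norm (\<Sum>j\<le>k. U (k - j) (u j)) powr p)"
      using s u p0 by (intro tendsto_sum tendsto_powr' tendsto_norm U_limit emb_in tendsto_const) auto
    show "(\<lambda>i. K powr p * (\<Sum>j<m. norm (emb (s j i)) powr p)) \<longlonglongrightarrow> K powr p * (\<Sum>j<m. norm (u j) powr p)"
      using s p0 by (intro tendsto_mult tendsto_const tendsto_sum tendsto_powr' tendsto_norm) auto
    show "\<exists>N. \<forall>i\<ge>N. (\<Sum>k<m. norm (\<Sum>j\<le>k. U (k - j) (emb (s j i))) powr p) \<le> K powr p * (\<Sum>j<m. norm (emb (s j i)) powr p)"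
      by (intro exI[of _ 0] allI impI convolution_bound_simple s)
  qed
qed

end

section \<open>Exponential decay of eventually positive semigroups\<close>

context strongly_continuous_semigroup begin

lemma exponential_decay_of_contraction:
  assumes "0 < a" and half: "\<And>x. x \<in> E \<Longrightarrow> norm (S a x) \<le> norm x / 2"
  shows "\<exists>C e. 0 < e \<and> (\<forall>t\<ge>0. \<forall>x\<in>E. norm (S t x) \<le> C * exp (- e * t) * norm x)"
proof -
  obtain B where B: "1 \<le> B" "\<And>t x. t \<in> {0..a} \<Longrightarrow> x \<in> E \<Longrightarrow> norm (S t x) \<le> B * norm x" using locally_bounded by blast
  have "norm (S t x) \<le> B * exp \<bar>ln (1 / 2)\<bar> * exp (- (ln 2 / a) * t) * norm x" if "0 \<le> t" "x \<in> E" for t x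
    using exponential_bound_of_step[OF assms(1) _ B(2), of "1 / 2" t x] B(1) half that by (simp add: ln_div)
  moreover have "0 < ln 2 / a" using assms(1) by simp
  ultimately show ?thesis by blast
qed

end

section \<open>Complex scalars and complex semigroups\<close>

context Lp_space begin

lemma cm_add: assumes "v \<in> E" "w \<in> E" shows "cm c (v + w) = cm c v + cm c w"
proof -
  have vw: "v + w \<in> E" using assms subspace_E by (simp add: subspace_def)
  have "AE x in M. c * rep (v + w) x = c * rep v x + c * rep w x"
    using rep_add[OF assms] by eventually_elim (simp add: ring_distribs)
  then show ?thesis unfolding cm_def using assms vw
    by (simp add: emb_add[symmetric] Lp_fun_scale rep emb_eq_iff Lp_fun_add p0)
qed

lemma cm_scaleR: assumes "v \<in> E" shows "cm c (r *\<^sub>R v) = r *\<^sub>R cm c v"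
proof -
  have rv: "r *\<^sub>R v \<in> E" using assms subspace_E by (simp add: subspace_def)
  have "AE x in M. c * rep (r *\<^sub>R v) x = complex_of_real r * (c * rep v x)"
    using rep_scaleR[OF assms, of r] by eventually_elim simp
  then show ?thesis unfolding cm_def using assms rv
    by (simp add: emb_scaleR[symmetric] Lp_fun_scale rep emb_eq_iff)
qed

lemma cm_diff: assumes "v \<in> E" "w \<in> E" shows "cm c (v - w) = cm c v - cm c w"
proof -
  have "(- 1) *\<^sub>R w \<in> E" using assms(2) subspace_E unfolding subspace_def by blast
  then show ?thesis using cm_add[OF assms(1), of "(- 1) *\<^sub>R w" c] cm_scaleR[OF assms(2), of c "- 1"] by simp
qed

lemma norm_cm: assumes "v \<in> E" shows "norm (cm c v) = norm c * norm v"
proof -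
  have "norm (cm c v) powr p = (norm c * norm v) powr p"
    using assms by (simp add: cm_def norm_emb Lp_fun_scale rep Lp_norm_powr p0 norm_mult powr_mult norm_eq_nrm_rep Lp_norm_nonneg)
  then have "(norm (cm c v) powr p) powr (1 / p) = ((norm c * norm v) powr p) powr (1 / p)" by simp
  then show ?thesis using p0 by (simp add: powr_powr)
qed

end

locale complex_Lp_semigroup =
  Lp_space M p + strongly_continuous_semigroup "Lp_space.E M p" S
  for M :: "'a measure" and p :: real and S :: "real \<Rightarrow> 'a Lp_target \<Rightarrow> 'a Lp_target" +
  assumes S_cm: "\<And>t v c. 0 \<le> t \<Longrightarrow> v \<in> E \<Longrightarrow> S t (cm c v) = cm c (S t v)"
begin

lemma gen_cm: assumes "gen x y" shows "gen (cm c x) (cm c y)"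
proof -
  have xy: "x \<in> E" "y \<in> E" using assms gen_in by auto
  have "((\<lambda>t. norm ((1 / t) *\<^sub>R (S t x - x) - y)) \<longlongrightarrow> 0) (at_right 0)"
    using assms by (simp add: gen_def LIM_zero tendsto_norm_zero)
  then have "((\<lambda>t. norm c * norm ((1 / t) *\<^sub>R (S t x - x) - y)) \<longlongrightarrow> 0) (at_right 0)"
    by (rule tendsto_mult_right_zero)
  moreover have "\<forall>\<^sub>F t in at_right 0. norm c * norm ((1 / t) *\<^sub>R (S t x - x) - y) = norm ((1 / t) *\<^sub>R (S t (cm c x) - cm c x) - cm c y)"
  proof -
    have "norm c * norm ((1 / t) *\<^sub>R (S t x - x) - y) = norm ((1 / t) *\<^sub>R (S t (cm c x) - cm c x) - cm c y)" if "0 < t" for t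
    proof -
      have "(1 / t) *\<^sub>R (S t (cm c x) - cm c x) - cm c y = cm c ((1 / t) *\<^sub>R (S t x - x) - y)"
        using that xy by (simp add: S_cm cm_diff cm_scaleR E_diff E_scale S_in)
      then show ?thesis using that xy by (simp add: norm_cm E_diff E_scale S_in)
    qed
    then show ?thesis by (rule eventually_at_right_0I)
  qed
  ultimately have "((\<lambda>t. norm ((1 / t) *\<^sub>R (S t (cm c x) - cm c x) - cm c y)) \<longlongrightarrow> 0) (at_right 0)"
    by (rule Lim_transform_eventually)
  then have "((\<lambda>t. (1 / t) *\<^sub>R (S t (cm c x) - cm c x)) \<longlongrightarrow> cm c y) (at_right 0)"
    by (simp add: LIM_zero_cancel tendsto_norm_zero_iff)
  then show ?thesis using xy by (simp add: gen_def cm_in)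
qed

end

locale eventually_positive_semigroup = complex_Lp_semigroup +
  assumes eventually_pos: "\<And>v. v \<in> pos \<Longrightarrow> \<exists>t0\<ge>0. \<forall>t\<ge>t0. S t v \<in> pos"
begin

lemma resolvent_0_cm: assumes "resolvent 0 Q" "f \<in> E" shows "Q (cm c f) = cm c (Q f)"
proof -
  have "gen (cm c (Q f)) (cm c (- f))" using gen_cm resolvent_gen[OF assms] by simp
  moreover have "cm c (- f) = - cm c f" using cm_scaleR[OF assms(2), of c "- 1"] by simp
  ultimately show ?thesis using resolvent_left[OF assms(1), of "cm c (Q f)" "- cm c f"] by simp
qed

text \<open>The largest subset of \<open>pos\<close> that is invariant under the semigroup, on which
  the lemmas about invariant cones can be used.\<close>

definition orbit_pos where "orbit_pos = {v \<in> E. \<forall>t\<ge>0. S t v \<in> pos}"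

lemma orbit_pos_in: "orbit_pos \<subseteq> E" and orbit_pos_pos: "v \<in> orbit_pos \<Longrightarrow> v \<in> pos"
  using S_0 by (auto simp: orbit_pos_def)

lemma orbit_pos_S: "0 \<le> t \<Longrightarrow> v \<in> orbit_pos \<Longrightarrow> S t v \<in> orbit_pos"
  by (auto simp: orbit_pos_def S_in S_plus[symmetric])

lemma closed_cone_orbit_pos: "closed_cone orbit_pos"
  unfolding closed_cone_def
proof (intro conjI ballI allI impI)
  show "closed orbit_pos"
    unfolding closed_sequential_limits
  proof (intro allI impI, elim conjE)
    fix X l assume X: "\<forall>n. X n \<in> orbit_pos" "X \<longlonglongrightarrow> l"
    then have XE: "X n \<in> E" for n using orbit_pos_in by blast
    then have l: "l \<in> E" using X closed closed_sequentially by blast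
    have "S t l \<in> pos" if "0 \<le> t" for t
    proof (rule closed_cone_limit[OF closed_cone_pos])
      show "(\<lambda>n. S t (X n)) \<longlonglongrightarrow> S t l" using that XE l X by (intro S_limit)
      show "S t (X n) \<in> pos" for n using X that by (auto simp: orbit_pos_def)
    qed
    then show "l \<in> orbit_pos" using l by (simp add: orbit_pos_def)
  qed
qed (use closed_cone_pos in \<open>auto simp: orbit_pos_def E_0 E_add E_scale S_zero S_add S_scale
       intro: closed_cone_add closed_cone_scale simp: closed_cone_def\<close>)

text \<open>By Baire's theorem the waiting time is uniform up to a multiple of a fixed orbit.\<close>

lemma uniform_lower_bound:
  "\<exists>a e. 0 \<le> a \<and> e \<in> orbit_pos \<and> (\<forall>h\<in>pos. S a h + norm h *\<^sub>R e \<in> orbit_pos)"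
proof -
  define C where "C n = {f \<in> pos. \<forall>t\<ge>real n. S t f \<in> pos}" for n
  have cl: "closed (C n)" for n
    unfolding closed_sequential_limits
  proof (intro allI impI, elim conjE)
    fix X l assume X: "\<forall>k. X k \<in> C n" "X \<longlonglongrightarrow> l"
    then have XE: "X k \<in> E" and Xp: "X k \<in> pos" for k using pos_subset by (auto simp: C_def)
    have l: "l \<in> pos" using closed_cone_limit[OF closed_cone_pos X(2) Xp] .
    have "S t l \<in> pos" if t: "real n \<le> t" for t
    proof (rule closed_cone_limit[OF closed_cone_pos])
      show "(\<lambda>k. S t (X k)) \<longlonglongrightarrow> S t l" using t XE l X pos_subset by (intro S_limit) auto
      show "S t (X k) \<in> pos" for k using X t by (auto simp: C_def)
    qed
    then show "l \<in> C n" using l by (simp add: C_def)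
  qed
  have cov: "pos \<subseteq> (\<Union>n. C n)"
  proof
    fix f assume f: "f \<in> pos"
    obtain t0 where t0: "\<forall>t\<ge>t0. S t f \<in> pos" using eventually_pos[OF f] by blast
    obtain n where "t0 \<le> real n" using real_arch_simple by blast
    then show "f \<in> (\<Union>n. C n)" using f t0 by (auto simp: C_def intro!: exI[of _ n])
  qed
  obtain n f0 r where f0: "f0 \<in> pos" "0 < r" "ball f0 r \<inter> pos \<subseteq> C n"
  proof (rule Baire_closed_cover[OF closed_pos _ cl _ cov])
    show "pos \<noteq> {}" using closed_cone_pos by (auto simp: closed_cone_def)
    show "C n \<subseteq> pos" for n by (auto simp: C_def)
  qed
  have CP: "S (real n) f \<in> orbit_pos" if "f \<in> C n" for f
  proof -
    have "f \<in> E" using that pos_subset by (auto simp: C_def)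
    then show ?thesis using that by (auto simp: orbit_pos_def C_def S_in S_plus[symmetric])
  qed
  \<comment> \<open>Applying \<open>S n\<close> to \<open>f0 + c *\<^sub>R h\<close> with
    \<open>c = r / (2 * norm h)\<close> and dividing by \<open>c\<close> leaves the summand
    \<open>(1 / c) *\<^sub>R S n f0\<close>, which is \<open>norm h *\<^sub>R e\<close>.\<close>
  define e where "e = (2 / r) *\<^sub>R S (real n) f0"
  have f0C: "f0 \<in> C n" using f0 by auto
  have eP: "e \<in> orbit_pos"
    unfolding e_def using f0 CP[OF f0C] by (intro closed_cone_scale[OF closed_cone_orbit_pos]) auto
  have "S (real n) h + norm h *\<^sub>R e \<in> orbit_pos" if h: "h \<in> pos" for h
  proof (cases "h = 0")
    case True
    then show ?thesis using closed_cone_orbit_pos by (simp add: S_zero closed_cone_def)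
  next
    case False
    define c where "c = r / (2 * norm h)"
    have c: "0 < c" "c * norm h = r / 2" using False f0(2) by (auto simp: c_def)
    have hE: "h \<in> E" "f0 \<in> E" using h f0 pos_subset by auto
    have "f0 + c *\<^sub>R h \<in> pos" using f0 h c by (intro closed_cone_add[OF closed_cone_pos] closed_cone_scale[OF closed_cone_pos]) auto
    moreover have "f0 + c *\<^sub>R h \<in> ball f0 r" using c f0(2) by (simp add: dist_norm)
    ultimately have "S (real n) (f0 + c *\<^sub>R h) \<in> orbit_pos" using f0(3) CP by blast
    then have "(1 / c) *\<^sub>R S (real n) (f0 + c *\<^sub>R h) \<in> orbit_pos"
      using c by (intro closed_cone_scale[OF closed_cone_orbit_pos]) auto
    moreover have "(1 / c) *\<^sub>R S (real n) (f0 + c *\<^sub>R h) = S (real n) h + norm h *\<^sub>R e"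
      using c False f0(2) hE by (simp add: S_add S_scale E_scale scaleR_add_right e_def c_def add.commute)
    ultimately show ?thesis by simp
  qed
  then show ?thesis using eP by (intro exI[of _ "real n"] exI[of _ e]) simp
qed

text \<open>The convolution bound applied to the orbit of \<open>f\<close> sampled at multiples of
  \<open>d\<close>. The decisive point is that the constant depends neither on \<open>d\<close> nor
  on \<open>m\<close>.\<close>

lemma discrete_convolution_estimate:
  assumes Q: "resolvent 0 Q" and Qpos: "\<And>f. f \<in> orbit_pos \<Longrightarrow> Q f \<in> orbit_pos"
    and a: "0 \<le> a" and e: "e \<in> orbit_pos" and low: "\<And>h. h \<in> pos \<Longrightarrow> S a h + norm h *\<^sub>R e \<in> orbit_pos"
    and q: "0 \<le> q" "\<And>f. f \<in> E \<Longrightarrow> norm (Q f) \<le> q * norm f"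
    and \<beta>: "0 \<le> \<beta>" "\<And>f. f \<in> E \<Longrightarrow> norm (S a f) \<le> \<beta> * norm f"
    and d: "0 \<le> d" and f: "f \<in> E"
  shows "(\<Sum>k<m. (real (Suc k) * norm (S (real k * d) (Q (S a f) - S d (Q (S a f))))) powr p)
    \<le> (q * (\<beta> + 2 * norm e)) powr p * (\<Sum>j<m. norm (S (real j * d) f) powr p)"
proof -
  define J where "J v = Q v - S d (Q v)" for v
  have QE: "v \<in> E \<Longrightarrow> Q v \<in> E" for v by (rule resolvent_in[OF Q])
  have JE: "v \<in> E \<Longrightarrow> J v \<in> E" for v using d by (auto simp: J_def intro!: E_diff S_in QE)
  have Jadd: "J (v + w) = J v + J w" if "v \<in> E" "w \<in> E" for v w
    using that d resolvent_add[OF Q] by (simp add: J_def S_add QE)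
  have Jscale: "J (r *\<^sub>R v) = r *\<^sub>R J v" if "v \<in> E" for v r
    using that d resolvent_scale[OF Q] by (simp add: J_def S_scale QE scaleR_diff_right)
  have Jpos: "J v \<in> orbit_pos" if "v \<in> orbit_pos" for v
    unfolding J_def
    by (rule resolvent_0_increment_positive[OF closed_cone_orbit_pos orbit_pos_in orbit_pos_S Q that d])
  have JS: "J (S t v) = S t (J v)" if "0 \<le> t" "v \<in> E" for t v
  proof -
    have "S d (S t (Q v)) = S t (S d (Q v))" using that d QE by (simp add: S_plus[symmetric] add.commute)
    then show ?thesis using that d resolvent_S[OF Q that(2,1)] by (simp add: J_def S_diff QE S_in)
  qed
  \<comment> \<open>Here \<open>J v\<close> is the integral of the orbit over [0, d], so consecutive
    pieces add up exactly, whatever the step is.\<close>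
  have tele: "(\<Sum>s<n. S (real s * d) (J v)) = Q v - S (real n * d) (Q v)" if v: "v \<in> E" for v n
  proof (induction n)
    case 0 then show ?case using v by (simp add: S_0 QE)
  next
    case (Suc n)
    have "S (real n * d) (J v) = S (real n * d) (Q v) - S (real (Suc n) * d) (Q v)"
      using S_plus[of "real n * d" d "Q v"] d v by (simp add: J_def S_diff QE S_in algebra_simps)
    then show ?case using Suc by simp
  qed
  have eE: "e \<in> E" using e orbit_pos_in by blast
  \<comment> \<open>The operator with index \<open>s\<close> is the integral of
    \<open>S (t + a) v\<close> over \<open>t\<close> from \<open>s d\<close> to
    \<open>(s + 1) d\<close>, and the lower bound is the integral of the orbit of \<open>e\<close>
    over the same interval.\<close>
  interpret almost_positive_family M p "\<lambda>s v. S (real s * d) (J (S a v))" "\<lambda>s. S (real s * d) (J e)" m "q * (\<beta> + 2 * norm e)"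
  proof
    fix s :: nat and v w r c
    have sd: "0 \<le> real s * d" using d by simp
    show "v \<in> E \<Longrightarrow> S (real s * d) (J (S a v)) \<in> E" using sd a by (intro S_in JE)
    show "v \<in> E \<Longrightarrow> w \<in> E \<Longrightarrow> S (real s * d) (J (S a (v + w))) = S (real s * d) (J (S a v)) + S (real s * d) (J (S a w))"
      using sd a by (simp add: S_add Jadd S_in JE)
    show "v \<in> E \<Longrightarrow> S (real s * d) (J (S a (r *\<^sub>R v))) = r *\<^sub>R S (real s * d) (J (S a v))"
      using sd a by (simp add: S_scale Jscale S_in JE)
    show "S (real s * d) (J (S a (cm c v))) = cm c (S (real s * d) (J (S a v)))" if v: "v \<in> E"
    proof -
      have "J (cm c v) = cm c (J v)" if "v \<in> E" for v
        using that d by (simp add: J_def resolvent_0_cm[OF Q] S_cm QE cm_diff S_in)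
      then show ?thesis using sd a v by (simp add: S_cm S_in JE)
    qed
  next
    fix s :: nat and X :: "nat \<Rightarrow> 'a Lp_target" and v
    assume X: "\<And>n. X n \<in> E" "v \<in> E" "X \<longlonglongrightarrow> v"
    have 1: "(\<lambda>n. S a (X n)) \<longlonglongrightarrow> S a v" using a X by (intro S_limit)
    have "(\<lambda>n. q * norm (S a (X n) - S a v)) \<longlonglongrightarrow> 0"
      using 1 by (intro tendsto_mult_right_zero) (simp add: LIM_zero tendsto_norm_zero)
    moreover have "norm (Q (S a (X n)) - Q (S a v)) \<le> q * norm (S a (X n) - S a v)" for n
    proof -
      have SE: "S a (X n) \<in> E" "S a v \<in> E" using X a S_in by auto
      have "Q (S a (X n) + (- 1) *\<^sub>R S a v) = Q (S a (X n)) + (- 1) *\<^sub>R Q (S a v)"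
        using SE resolvent_add[OF Q SE(1) E_scale[OF SE(2)], of "- 1"] resolvent_scale[OF Q SE(2), of "- 1"] by simp
      then show ?thesis using q(2)[of "S a (X n) - S a v"] SE by (simp add: E_diff)
    qed
    ultimately have "(\<lambda>n. Q (S a (X n)) - Q (S a v)) \<longlonglongrightarrow> 0"
      by (intro Lim_null_comparison[of "\<lambda>n. Q (S a (X n)) - Q (S a v)" "\<lambda>n. q * norm (S a (X n) - S a v)"]) auto
    then have 2: "(\<lambda>n. Q (S a (X n))) \<longlonglongrightarrow> Q (S a v)" by (simp add: LIM_zero_cancel)
    then have "(\<lambda>n. J (S a (X n))) \<longlonglongrightarrow> J (S a v)"
      unfolding J_def using d a X by (intro tendsto_diff S_limit QE S_in)
    then show "(\<lambda>n. S (real s * d) (J (S a (X n)))) \<longlonglongrightarrow> S (real s * d) (J (S a v))"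
      using d a X by (intro S_limit JE S_in) auto
  next
    fix s :: nat
    show "S (real s * d) (J e) \<in> pos" using d e by (intro orbit_pos_pos orbit_pos_S Jpos) auto
    fix h assume h: "h \<in> pos"
    then have hE: "h \<in> E" using pos_subset by blast
    have "S (real s * d) (J (S a h)) + norm h *\<^sub>R S (real s * d) (J e) = S (real s * d) (J (S a h + norm h *\<^sub>R e))"
      using d a hE eE by (simp add: Jadd Jscale S_in E_scale S_add S_scale JE)
    also have "\<dots> \<in> pos" using d low[OF h] by (intro orbit_pos_pos orbit_pos_S Jpos) auto
    finally show "S (real s * d) (J (S a h)) + norm h *\<^sub>R S (real s * d) (J e) \<in> pos" .
  next
    show "0 \<le> q * (\<beta> + 2 * norm e)" using q \<beta> by simp
    fix h assume h: "h \<in> pos"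
    then have hE: "h \<in> E" using pos_subset by blast
    \<comment> \<open>The terms of \<open>U_total\<close> sum up to \<open>Q g\<close> minus a
      positive vector, so \<open>Q g\<close> is the majorant sought. Its norm gives the constant
      \<open>q * (\<beta> + 2 * norm e)\<close>.\<close>
    define g where "g = S a h + (2 * norm h) *\<^sub>R e"
    have gE: "g \<in> E" unfolding g_def using a hE eE by (intro E_add S_in E_scale)
    have "g = (S a h + norm h *\<^sub>R e) + norm h *\<^sub>R e" by (simp add: g_def scaleR_add_left[symmetric])
    then have gP: "g \<in> orbit_pos"
      using low[OF h] e by (auto intro!: closed_cone_add[OF closed_cone_orbit_pos] closed_cone_scale[OF closed_cone_orbit_pos])
    have "(\<Sum>s<m. S (real s * d) (J (S a h)) + (2 * norm h) *\<^sub>R S (real s * d) (J e)) = (\<Sum>s<m. S (real s * d) (J g))"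
      using d a hE eE by (intro sum.cong) (auto simp: g_def Jadd Jscale S_in E_scale S_add S_scale JE)
    also have "\<dots> = Q g - S (real m * d) (Q g)" by (rule tele[OF gE])
    finally have "Q g - (\<Sum>s<m. S (real s * d) (J (S a h)) + (2 * norm h) *\<^sub>R S (real s * d) (J e)) = S (real m * d) (Q g)"
      by simp
    moreover have "S (real m * d) (Q g) \<in> pos" using d gP by (intro orbit_pos_pos orbit_pos_S Qpos) auto
    moreover have "Q g \<in> pos" using gP by (intro orbit_pos_pos Qpos)
    moreover have "norm (Q g) \<le> q * (\<beta> + 2 * norm e) * norm h"
    proof -
      have "norm g \<le> norm (S a h) + norm ((2 * norm h) *\<^sub>R e)" unfolding g_def by (rule norm_triangle_ineq)
      also have "\<dots> \<le> \<beta> * norm h + 2 * norm h * norm e" using \<beta>(2)[OF hE] by simp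
      finally have "norm g \<le> (\<beta> + 2 * norm e) * norm h" by (simp add: algebra_simps)
      then have "q * norm g \<le> q * ((\<beta> + 2 * norm e) * norm h)" using q(1) by (rule mult_left_mono)
      then show ?thesis using q(2)[OF gE] by (simp add: mult.assoc)
    qed
    ultimately show "\<exists>y\<in>pos. norm y \<le> q * (\<beta> + 2 * norm e) * norm h \<and>
      y - (\<Sum>s<m. S (real s * d) (J (S a h)) + (2 * norm h) *\<^sub>R S (real s * d) (J e)) \<in> pos"
      by (intro bexI[of _ "Q g"]) auto
  qed
  \<comment> \<open>By the semigroup law all \<open>k + 1\<close> terms of the convolution coincide;
    this is where the weight comes from.\<close>
  have "(\<Sum>j\<le>k. S (real (k - j) * d) (J (S a (S (real j * d) f)))) = real (Suc k) *\<^sub>R S (real k * d) (J (S a f))" for k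
  proof -
    have "S (real (k - j) * d) (J (S a (S (real j * d) f))) = S (real k * d) (J (S a f))" if "j \<in> {..k}" for j
    proof -
      have j: "j \<le> k" using that by simp
      have "S a (S (real j * d) f) = S (real j * d) (S a f)" using a d f by (simp add: S_plus[symmetric] add.commute)
      then have "S (real (k - j) * d) (J (S a (S (real j * d) f))) = S (real (k - j) * d) (S (real j * d) (J (S a f)))"
        using a d f by (simp add: JS S_in)
      also have "\<dots> = S (real (k - j) * d + real j * d) (J (S a f))" using a d f by (simp add: S_plus JE S_in)
      also have "real (k - j) * d + real j * d = real k * d" using j by (simp add: of_nat_diff algebra_simps)
      finally show ?thesis .
    qed
    then have "(\<Sum>j\<le>k. S (real (k - j) * d) (J (S a (S (real j * d) f)))) = (\<Sum>j\<le>k. S (real k * d) (J (S a f)))"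
      by (intro sum.cong) auto
    then show ?thesis by (simp only: sum_constant_scaleR card_atMost)
  qed
  then have "norm (\<Sum>j\<le>k. S (real (k - j) * d) (J (S a (S (real j * d) f)))) = real (Suc k) * norm (S (real k * d) (J (S a f)))" for k
    by simp
  with convolution_bound[of "\<lambda>j. S (real j * d) f"] show ?thesis
    using d f S_in by (simp add: J_def del: of_nat_Suc)
qed

lemma norm_orbit_continuous: "f \<in> E \<Longrightarrow> continuous_on {0..b} (\<lambda>t. norm (S t f) powr p)"
  using p0 by (intro continuous_on_powr' continuous_on_norm orbit_continuous continuous_intros) auto

lemma weighted_orbit_continuous: "f \<in> E \<Longrightarrow> continuous_on {0..b} (\<lambda>t. (t * norm (S t f)) powr p)"
  using p0 by (intro continuous_on_powr' continuous_on_mult continuous_on_norm orbit_continuous continuous_intros) auto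

text \<open>The discrete estimate with step \<open>l / m\<close>, multiplied by the step, is an
  inequality between Riemann sums once the increments divided by the step are replaced by their
  limit \<open>g\<close>.\<close>

lemma weighted_orbit_estimate:
  assumes Q: "resolvent 0 Q" and a: "0 \<le> a" and K: "0 \<le> K"
    and est: "\<And>d f m. 0 \<le> d \<Longrightarrow> f \<in> E \<Longrightarrow>
      (\<Sum>k<m. (real (Suc k) * norm (S (real k * d) (Q (S a f) - S d (Q (S a f))))) powr p)
      \<le> K powr p * (\<Sum>j<m. norm (S (real j * d) f) powr p)"
    and f: "f \<in> E" and l: "0 < l"
  shows "integral {0..l} (\<lambda>t. (t * norm (S t (S a f))) powr p) \<le> (2 * K) powr p * integral {0..l} (\<lambda>t. norm (S t f) powr p)"
proof -
  define g where "g = S a f"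
  have g: "g \<in> E" using a f by (simp add: g_def S_in)
  obtain B where B: "1 \<le> B" "\<And>t x. t \<in> {0..l} \<Longrightarrow> x \<in> E \<Longrightarrow> norm (S t x) \<le> B * norm x" using locally_bounded by blast
  define z where "z h = (1 / h) *\<^sub>R (Q g - S h (Q g))" for h
  have zE: "z h \<in> E" if "0 \<le> h" for h
    using that resolvent_in[OF Q g] by (auto simp: z_def intro!: E_scale E_diff S_in)
  have h_lim: "filterlim (\<lambda>m. l / real m) (at_right 0) sequentially"
  proof (intro filterlim_at_withinI)
    show "(\<lambda>m. l / real m) \<longlonglongrightarrow> 0" by (rule lim_const_over_n)
    show "\<forall>\<^sub>F m in sequentially. l / real m \<in> {0<..} - {0}" using l
      by (auto intro!: eventually_sequentiallyI[of 1])
  qed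
  have zlim: "(\<lambda>m. z (l / real m)) \<longlonglongrightarrow> g"
    unfolding z_def by (rule filterlim_compose[OF resolvent_0_increment_limit[OF Q g] h_lim])
  \<comment> \<open>The price of that replacement: each of the \<open>m\<close> grid points costs at
    most \<open>2 powr p\<close> times the p-th power of \<open>l * \<eta>\<close>, and
    \<open>m\<close> times the step is \<open>l\<close>.\<close>
  define r where "r m = 2 powr p * l * (l * (B * norm (z (l / real m) - g))) powr p" for m
  have r_lim: "r \<longlonglongrightarrow> 0"
  proof -
    have "(\<lambda>m. l * (B * norm (z (l / real m) - g))) \<longlonglongrightarrow> 0"
      using zlim by (intro tendsto_mult_right_zero) (simp add: LIM_zero tendsto_norm_zero)
    then have "(\<lambda>m. (l * (B * norm (z (l / real m) - g))) powr p) \<longlonglongrightarrow> 0"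
      by (rule tendsto_zero_powrI[OF _ tendsto_const]) (use p0 B l in auto)
    then show ?thesis unfolding r_def by (rule tendsto_mult_right_zero)
  qed
  let ?L = "\<lambda>m. (l / real m) *\<^sub>R (\<Sum>k<m. (real k * l / real m * norm (S (real k * l / real m) g)) powr p)"
  let ?R = "\<lambda>m. (l / real m) *\<^sub>R (\<Sum>k<m. norm (S (real k * l / real m) f) powr p)"
  have L_lim: "?L \<longlonglongrightarrow> integral {0..l} (\<lambda>t. (t * norm (S t g)) powr p)"
    using riemann_sums_tendsto[OF weighted_orbit_continuous[OF g]] l by simp
  have R_lim: "?R \<longlonglongrightarrow> integral {0..l} (\<lambda>t. norm (S t f) powr p)"
    using riemann_sums_tendsto[OF norm_orbit_continuous[OF f]] l by simp
  have bound: "?L m \<le> (2 * K) powr p * ?R m + r m" if m: "1 \<le> m" for m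
  proof -
    define h where "h = l / real m"
    have h: "0 < h" "real m * h = l" using m l by (auto simp: h_def)
    define \<eta> where "\<eta> = B * norm (z h - g)"
    have \<eta>: "0 \<le> \<eta>" using B by (simp add: \<eta>_def)
    let ?v = "\<lambda>k. real (Suc k) * norm (S (real k * h) (Q g - S h (Q g)))"
    have summand: "(real k * h * norm (S (real k * h) g)) powr p \<le> 2 powr p * (?v k powr p + (l * \<eta>) powr p)" if k: "k < m" for k
    proof -
      have kh: "0 \<le> real k * h" "real k * h \<le> l" using h k by (auto simp: h(2)[symmetric] intro!: mult_right_mono)
      have "S (real k * h) g = S (real k * h) (z h) - S (real k * h) (z h - g)"
        using kh g zE h by (simp add: S_diff)
      then have "norm (S (real k * h) g) \<le> norm (S (real k * h) (z h)) + norm (S (real k * h) (z h - g))"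
        by (metis norm_triangle_ineq4)
      also have "norm (S (real k * h) (z h - g)) \<le> \<eta>"
        unfolding \<eta>_def using kh g zE h by (intro B E_diff) auto
      finally have "real k * h * norm (S (real k * h) g) \<le> real k * h * (norm (S (real k * h) (z h)) + \<eta>)"
        using kh by (intro mult_left_mono) auto
      also have "\<dots> = real k * h * norm (S (real k * h) (z h)) + real k * h * \<eta>" by (simp add: algebra_simps)
      also have "\<dots> \<le> ?v k + l * \<eta>"
      proof (rule add_mono)
        have "S (real k * h) (z h) = (1 / h) *\<^sub>R S (real k * h) (Q g - S h (Q g))"
          unfolding z_def using kh h resolvent_in[OF Q g] by (intro S_scale E_diff S_in) auto
        then have "real k * h * norm (S (real k * h) (z h)) = real k * norm (S (real k * h) (Q g - S h (Q g)))"
          using h by simp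
        also have "\<dots> \<le> ?v k" by (intro mult_right_mono) auto
        finally show "real k * h * norm (S (real k * h) (z h)) \<le> ?v k" .
        show "real k * h * \<eta> \<le> l * \<eta>" using kh \<eta> by (intro mult_right_mono)
      qed
      finally have "(real k * h * norm (S (real k * h) g)) powr p \<le> (?v k + l * \<eta>) powr p"
        using kh p0 by (intro powr_mono2) auto
      also have "\<dots> \<le> 2 powr p * (?v k powr p + (l * \<eta>) powr p)" using \<eta> l p0 by (intro powr_add_le) auto
      finally show ?thesis .
    qed
    have "(\<Sum>k<m. (real k * h * norm (S (real k * h) g)) powr p) \<le> (\<Sum>k<m. 2 powr p * (?v k powr p + (l * \<eta>) powr p))"
      using summand by (intro sum_mono) auto
    also have "\<dots> = 2 powr p * (\<Sum>k<m. ?v k powr p) + 2 powr p * (real m * (l * \<eta>) powr p)"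
      by (simp add: sum.distrib sum_distrib_left[symmetric] ring_distribs del: of_nat_Suc)
    also have "(\<Sum>k<m. ?v k powr p) \<le> K powr p * (\<Sum>j<m. norm (S (real j * h) f) powr p)"
      unfolding g_def using h f by (intro est) auto
    finally have "(\<Sum>k<m. (real k * h * norm (S (real k * h) g)) powr p)
        \<le> 2 powr p * (K powr p * (\<Sum>j<m. norm (S (real j * h) f) powr p)) + 2 powr p * (real m * (l * \<eta>) powr p)"
      by simp
    then have "h * (\<Sum>k<m. (real k * h * norm (S (real k * h) g)) powr p)
        \<le> h * (2 powr p * (K powr p * (\<Sum>j<m. norm (S (real j * h) f) powr p)) + 2 powr p * (real m * (l * \<eta>) powr p))"
      using h by (intro mult_left_mono) auto
    also have "\<dots> = (2 * K) powr p * (h * (\<Sum>j<m. norm (S (real j * h) f) powr p)) + 2 powr p * (real m * h) * (l * \<eta>) powr p"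
      using K by (simp add: powr_mult algebra_simps)
    also have "2 powr p * (real m * h) * (l * \<eta>) powr p = r m" unfolding h(2) by (simp add: r_def \<eta>_def h_def)
    finally show ?thesis by (simp add: h_def)
  qed
  have "(\<lambda>m. (2 * K) powr p * ?R m + r m) \<longlonglongrightarrow> (2 * K) powr p * integral {0..l} (\<lambda>t. norm (S t f) powr p) + 0"
    by (intro tendsto_add tendsto_mult tendsto_const R_lim r_lim)
  then show ?thesis using LIMSEQ_le[OF L_lim] bound by (auto simp: g_def)
qed

text \<open>\<open>\<Phi> f\<close> measures the orbit over a window of length \<open>b\<close>. On
  the next window the weight is at least \<open>N\<close>, which yields
  \<open>\<Phi> (S b f) \<le> (1 / 3) * (\<Phi> f + \<Phi> (S b f))\<close> and hence halving.
  Comparing \<open>\<Phi>\<close> with the norm then gives a contraction at one time.\<close>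

lemma decay_of_weighted_estimate:
  assumes a: "0 \<le> a" and K: "0 \<le> K"
    and est: "\<And>f l. f \<in> E \<Longrightarrow> 0 < l \<Longrightarrow>
      integral {0..l} (\<lambda>t. (t * norm (S t (S a f))) powr p) \<le> K powr p * integral {0..l} (\<lambda>t. norm (S t f) powr p)"
  shows "\<exists>C e. 0 < e \<and> (\<forall>t\<ge>0. \<forall>x\<in>E. norm (S t x) \<le> C * exp (- e * t) * norm x)"
proof -
  \<comment> \<open>The factor 3 makes \<open>K / N\<close> at most \<open>1 / 3\<close>, small
    enough to absorb \<open>\<Phi> (S b f)\<close> on the right; the summand 1 keeps
    \<open>N\<close> positive when \<open>K = 0\<close>.\<close>
  define N where "N = 3 * K + 1"
  define b where "b = N + a"
  have N: "0 < N" "K \<le> N / 3" and b: "0 < b" using K a by (auto simp: N_def b_def)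
  obtain B where B: "1 \<le> B" "\<And>t x. t \<in> {0..b} \<Longrightarrow> x \<in> E \<Longrightarrow> norm (S t x) \<le> B * norm x" using locally_bounded by blast
  define \<Phi> where "\<Phi> f = integral {0..b} (\<lambda>t. norm (S t f) powr p)" for f
  define F where "F f t = norm (S t f) powr p" for f t
  have Fint: "F f integrable_on {u..v}" if "f \<in> E" "0 \<le> u" for f u v
    unfolding F_def[abs_def] using that
    by (intro integrable_continuous_real continuous_on_subset[OF norm_orbit_continuous[of f v]]) auto
  have F0: "0 \<le> F f t" for f t by (simp add: F_def)
  have \<Phi>_F: "\<Phi> f = integral {0..b} (F f)" for f by (simp add: \<Phi>_def F_def[abs_def])
  have halving: "\<Phi> (S b f) \<le> \<Phi> f / 2" if f: "f \<in> E" for f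
  proof -
    \<comment> \<open>Chosen so that the interval [N, l], shifted by the waiting time
      \<open>a\<close>, is exactly [b, 2 b].\<close>
    define l where "l = 2 * N + a"
    have l: "0 < l" "N \<le> l" using N a by (auto simp: l_def)
    have sf: "S a f \<in> E" using a f by (rule S_in)
    have Wint: "(\<lambda>t. (t * norm (S t (S a f))) powr p) integrable_on {u..l}" if "0 \<le> u" for u
      using that by (intro integrable_continuous_real continuous_on_subset[OF weighted_orbit_continuous[OF sf, of l]]) auto
    have I1: "integral {b..2 * b} (F f) = \<Phi> (S b f)"
    proof -
      have "integral {0..b} (F f \<circ> (+) b) = integral {0 + b..b + b} (F f)" by (rule integral_shift_Icc_real)
      moreover have "integral {0..b} (F f \<circ> (+) b) = \<Phi> (S b f)"
        unfolding \<Phi>_def by (rule integral_cong) (use b f S_plus[of _ b f] in \<open>simp add: F_def add.commute\<close>)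
      ultimately show ?thesis by simp
    qed
    have "N powr p * integral {b..2 * b} (F f) = integral {N..l} (\<lambda>t. N powr p * norm (S t (S a f)) powr p)"
    proof -
      have "integral {N..l} (F f \<circ> (+) a) = integral {N + a..l + a} (F f)" by (rule integral_shift_Icc_real)
      also have "{N + a..l + a} = {b..2 * b}" by (simp add: b_def l_def)
      also have "integral {N..l} (F f \<circ> (+) a) = integral {N..l} (\<lambda>t. norm (S t (S a f)) powr p)"
        by (rule integral_cong) (use a f N S_plus[of _ a f] in \<open>simp add: F_def add.commute\<close>)
      finally show ?thesis by simp
    qed
    also have "\<dots> \<le> integral {N..l} (\<lambda>t. (t * norm (S t (S a f))) powr p)"
    proof (rule integral_le)
      show "(\<lambda>t. N powr p * norm (S t (S a f)) powr p) integrable_on {N..l}"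
        using N Fint[OF sf, of N l] unfolding F_def by (intro integrable_on_mult_right) auto
      show "(\<lambda>t. (t * norm (S t (S a f))) powr p) integrable_on {N..l}" using N by (intro Wint) auto
      show "N powr p * norm (S t (S a f)) powr p \<le> (t * norm (S t (S a f))) powr p" if "t \<in> {N..l}" for t
        using that N p0 by (auto simp: powr_mult intro!: mult_right_mono powr_mono2)
    qed
    also have "\<dots> \<le> integral {0..l} (\<lambda>t. (t * norm (S t (S a f))) powr p)"
      using N by (intro integral_subset_le Wint) auto
    also have "\<dots> \<le> K powr p * integral {0..l} (F f)" unfolding F_def using f l by (intro est)
    also have "\<dots> \<le> (N / 3) powr p * integral {0..2 * b} (F f)"
    proof (intro mult_mono powr_mono2)
      show "integral {0..l} (F f) \<le> integral {0..2 * b} (F f)"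
        using f F0 a by (intro integral_subset_le Fint) (auto simp: l_def b_def)
    qed (use K N p0 f l in \<open>auto intro!: integral_nonneg Fint F0\<close>)
    also have "integral {0..2 * b} (F f) = \<Phi> f + \<Phi> (S b f)"
      using Henstock_Kurzweil_Integration.integral_combine[of 0 b "2 * b" "F f"] b Fint[OF f] I1
      by (simp add: \<Phi>_def F_def[abs_def])
    also have "(N / 3) powr p = N powr p * (1 / 3) powr p" using N by (simp add: powr_mult[symmetric])
    finally have "N powr p * \<Phi> (S b f) \<le> N powr p * ((1 / 3) powr p * (\<Phi> f + \<Phi> (S b f)))"
      unfolding I1 by (simp add: mult.assoc)
    then have "\<Phi> (S b f) \<le> (1 / 3) powr p * (\<Phi> f + \<Phi> (S b f))" using N by simp
    also have "\<dots> \<le> (1 / 3) * (\<Phi> f + \<Phi> (S b f))"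
    proof (rule mult_right_mono)
      show "(1 / 3) powr p \<le> (1 / 3 :: real)" using powr_mono'[of 1 p "1 / 3"] p1 by simp
      show "0 \<le> \<Phi> f + \<Phi> (S b f)"
        unfolding \<Phi>_F using b f by (intro add_nonneg_nonneg integral_nonneg Fint F0 S_in) auto
    qed
    finally show ?thesis by simp
  qed
  have \<Phi>_upper: "\<Phi> f \<le> b * (B * norm f) powr p" if f: "f \<in> E" for f
  proof -
    have "integral {0..b} (F f) \<le> integral {0..b} (\<lambda>t. (B * norm f) powr p)"
      using f B p0 by (intro integral_le Fint) (auto simp: F_def intro!: powr_mono2)
    then show ?thesis using b by (simp add: \<Phi>_F)
  qed
  have \<Phi>_lower: "b * norm (S b f) powr p \<le> B powr p * \<Phi> f" if f: "f \<in> E" for f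
  proof -
    have "integral {0..b} (\<lambda>t. norm (S b f) powr p) \<le> integral {0..b} (\<lambda>t. B powr p * F f t)"
    proof (rule integral_le)
      show "norm (S b f) powr p \<le> B powr p * F f t" if t: "t \<in> {0..b}" for t
      proof -
        have "S b f = S (b - t) (S t f)" using S_plus[of "b - t" t f] t f by simp
        then have "norm (S b f) \<le> B * norm (S t f)" using B(2)[of "b - t" "S t f"] t f by (simp add: S_in)
        then have "norm (S b f) powr p \<le> (B * norm (S t f)) powr p" using p0 by (intro powr_mono2) auto
        then show ?thesis using B by (simp add: F_def powr_mult)
      qed
      show "(\<lambda>t. B powr p * F f t) integrable_on {0..b}" using f by (intro integrable_on_mult_right Fint) auto
    qed auto
    then show ?thesis using b by (simp add: \<Phi>_F)
  qed
  have iter: "\<Phi> (S (real n * b) f) \<le> (1 / 2) ^ n * \<Phi> f" if f: "f \<in> E" for f n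
  proof (induction n)
    case (Suc n)
    have "S (real (Suc n) * b) f = S b (S (real n * b) f)"
      using S_plus[of b "real n * b" f] b f by (simp add: algebra_simps)
    then have "\<Phi> (S (real (Suc n) * b) f) \<le> \<Phi> (S (real n * b) f) / 2"
      using halving[of "S (real n * b) f"] b f by (simp add: S_in)
    then show ?case using Suc by simp
  qed (use f S_0 in simp)
  \<comment> \<open>The two comparisons of \<open>\<Phi>\<close> with the norm cost a factor
    \<open>B\<close> each, so \<open>B * (1 / (2 * B * B)) * B = 1 / 2\<close> remains. The
    comparison from below uses one more window, hence \<open>Suc n\<close> in
    \<open>T0\<close>.\<close>
  obtain n where n: "(1 / 2) ^ n < (1 / (2 * B * B)) powr p"
    using real_arch_pow_inv[of "(1 / (2 * B * B)) powr p" "1 / 2"] B by auto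
  define T0 where "T0 = real (Suc n) * b"
  have T0: "0 < T0" using b by (simp add: T0_def)
  have "norm (S T0 f) \<le> norm f / 2" if f: "f \<in> E" for f
  proof -
    have "S T0 f = S b (S (real n * b) f)"
      using S_plus[of b "real n * b" f] b f by (simp add: T0_def algebra_simps)
    then have "b * norm (S T0 f) powr p \<le> B powr p * \<Phi> (S (real n * b) f)"
      using \<Phi>_lower[of "S (real n * b) f"] b f by (simp add: S_in)
    also have "\<dots> \<le> B powr p * ((1 / 2) ^ n * (b * (B * norm f) powr p))"
      using iter[OF f, of n] \<Phi>_upper[OF f] by (intro mult_left_mono order_trans[OF iter[OF f]]) auto
    also have "\<dots> \<le> B powr p * ((1 / (2 * B * B)) powr p * (b * (B * norm f) powr p))"
      using n b by (intro mult_left_mono mult_right_mono) auto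
    also have "\<dots> = b * (B * (1 / (2 * B * B)) * (B * norm f)) powr p"
      using B by (simp only: powr_mult) simp
    also have "B * (1 / (2 * B * B)) * (B * norm f) = norm f / 2" using B by simp
    finally have "norm (S T0 f) powr p \<le> (norm f / 2) powr p" using b by simp
    then have "\<not> norm f / 2 < norm (S T0 f)"
      using powr_less_mono2[OF p0, of "norm f / 2" "norm (S T0 f)"] by auto
    then show ?thesis by simp
  qed
  then show ?thesis by (rule exponential_decay_of_contraction[OF T0])
qed

lemma exponential_decay:
  assumes "\<And>l. 0 \<le> l \<Longrightarrow> \<exists>R. resolvent l R"
  shows "\<exists>C e. 0 < e \<and> (\<forall>t\<ge>0. \<forall>x\<in>E. norm (S t x) \<le> C * exp (- e * t) * norm x)"
proof -
  obtain Q where Q: "resolvent 0 Q" using assms[of 0] by auto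
  obtain q' where q': "\<And>f. f \<in> E \<Longrightarrow> norm (Q f) \<le> q' * norm f" using resolvent_bdd[OF Q] by blast
  have q: "norm (Q f) \<le> \<bar>q'\<bar> * norm f" if "f \<in> E" for f
    using q'[OF that] mult_right_mono[OF abs_ge_self[of q'] norm_ge_zero[of f]] by linarith
  have Qpos: "Q f \<in> orbit_pos" if "f \<in> orbit_pos" for f
    by (rule resolvent_positive[OF closed_cone_orbit_pos orbit_pos_in orbit_pos_S assms Q that])
  obtain a e where ae: "0 \<le> a" "e \<in> orbit_pos" "\<And>h. h \<in> pos \<Longrightarrow> S a h + norm h *\<^sub>R e \<in> orbit_pos"
    using uniform_lower_bound by blast
  obtain \<beta> where \<beta>: "0 \<le> \<beta>" "\<And>f. f \<in> E \<Longrightarrow> norm (S a f) \<le> \<beta> * norm f" using S_norm_nonneg_bound[OF ae(1)] by blast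
  define K where "K = \<bar>q'\<bar> * (\<beta> + 2 * norm e)"
  have K: "0 \<le> K" using \<beta> by (simp add: K_def)
  have est: "(\<Sum>k<m. (real (Suc k) * norm (S (real k * d) (Q (S a f) - S d (Q (S a f))))) powr p)
      \<le> K powr p * (\<Sum>j<m. norm (S (real j * d) f) powr p)" if "0 \<le> d" "f \<in> E" for d f m
    unfolding K_def by (rule discrete_convolution_estimate[OF Q Qpos ae abs_ge_zero q \<beta> that])
  show ?thesis
    by (rule decay_of_weighted_estimate[OF ae(1), of "2 * K"]) (use K weighted_orbit_estimate[OF Q ae(1) K est] in auto)
qed

end

section \<open>Spectral bound and growth bound\<close>

context Lp_space begin

lemma cm_cm: assumes "v \<in> E" shows "cm c (cm d v) = cm (c * d) v"
proof -
  have "cm c (emb (\<lambda>x. d * rep v x)) = emb (\<lambda>x. c * (d * rep v x))"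
    using assms by (intro cm_emb Lp_fun_scale rep)
  then show ?thesis by (simp add: cm_def mult.assoc)
qed

lemma cm_of_real: "v \<in> E \<Longrightarrow> cm (of_real r) v = r *\<^sub>R v"
  using emb_scaleR[OF rep(1), of v r] rep(2) by (simp add: cm_def)

lemma cm_one: "v \<in> E \<Longrightarrow> cm 1 v = v"
  using cm_of_real[of v 1] by simp

lemma cm_add_left: assumes "v \<in> E" shows "cm (c + d) v = cm c v + cm d v"
  using assms unfolding cm_def by (simp add: emb_add[symmetric] Lp_fun_scale rep ring_distribs)

lemma cm_minus_left: assumes "v \<in> E" shows "cm (- c) v = - cm c v"
  using cm_add_left[OF assms, of c "- c"] cm_of_real[OF assms, of 0] by (simp add: eq_neg_iff_add_eq_0 add.commute)

lemma cm_diff_left: assumes "v \<in> E" shows "cm (c - d) v = cm c v - cm d v"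
  using cm_add_left[OF assms, of c "- d"] cm_minus_left[OF assms, of d] by simp

lemma cm_tendsto:
  assumes "(c \<longlongrightarrow> d) F" "(u \<longlongrightarrow> y) F" "\<And>t. u t \<in> E" "y \<in> E"
  shows "((\<lambda>t. cm (c t) (u t)) \<longlongrightarrow> cm d y) F"
proof -
  have "((\<lambda>t. norm (c t) * norm (u t - y) + norm (c t - d) * norm y) \<longlongrightarrow> norm d * norm (y - y) + norm (d - d) * norm y) F"
    using assms by (intro tendsto_intros)
  then have "((\<lambda>t. norm (c t) * norm (u t - y) + norm (c t - d) * norm y) \<longlongrightarrow> 0) F" by simp
  moreover have "norm (cm (c t) (u t) - cm d y) \<le> norm (c t) * norm (u t - y) + norm (c t - d) * norm y" for t
  proof -
    have "u t - y \<in> E" using assms subspace_E subspace_diff by blast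
    have "cm (c t) (u t) - cm d y = cm (c t) (u t - y) + cm (c t - d) y"
      using assms by (simp add: cm_diff cm_diff_left)
    also have "norm \<dots> \<le> norm (cm (c t) (u t - y)) + norm (cm (c t - d) y)" by (rule norm_triangle_ineq)
    finally show ?thesis using assms \<open>u t - y \<in> E\<close> by (simp add: norm_cm)
  qed
  ultimately have "((\<lambda>t. cm (c t) (u t) - cm d y) \<longlongrightarrow> 0) F"
    by (intro Lim_null_comparison[of "\<lambda>t. cm (c t) (u t) - cm d y"]) auto
  then show ?thesis by (simp add: LIM_zero_cancel)
qed

text \<open>The product rule at time 0. The family \<open>A\<close> is left general so that the rule
  serves both to rescale a semigroup and to undo the rescaling.\<close>

lemma cm_exp_derivative:
  assumes A: "\<And>t. 0 < t \<Longrightarrow> A t \<in> E" and xy: "x \<in> E" "y \<in> E"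
    and lim: "((\<lambda>t. (1 / t) *\<^sub>R (A t - x)) \<longlongrightarrow> y) (at_right 0)"
  shows "((\<lambda>t. (1 / t) *\<^sub>R (cm (exp (l * of_real t)) (A t) - x)) \<longlongrightarrow> y + cm l x) (at_right 0)"
proof -
  define u where "u t = (if 0 < t then (1 / t) *\<^sub>R (A t - x) else 0)" for t
  have sE: "v \<in> E \<Longrightarrow> r *\<^sub>R v \<in> E" "v \<in> E \<Longrightarrow> w \<in> E \<Longrightarrow> v - w \<in> E" "0 \<in> E" for v w r
    using subspace_E subspace_diff by (auto simp: subspace_def)
  have uE: "u t \<in> E" for t using A xy by (auto simp: u_def intro!: sE)
  have ev: "\<forall>\<^sub>F t in at_right 0. u t = (1 / t) *\<^sub>R (A t - x)"
    by (rule eventually_at_right_0I) (simp add: u_def)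
  have u_lim: "(u \<longlongrightarrow> y) (at_right 0)" using lim ev by (simp add: tendsto_cong)
  have c_lim: "((\<lambda>t. exp (l * of_real t)) \<longlongrightarrow> exp (l * of_real 0)) (at_right 0)"
    by (intro tendsto_intros)
  have "((\<lambda>z. exp (l * z)) has_field_derivative l) (at (0 :: complex))" by (auto intro!: derivative_eq_intros)
  then have D: "((\<lambda>z. (exp (l * z) - 1) / z) \<longlongrightarrow> l) (at (0 :: complex))" by (simp add: has_field_derivative_iff)
  have r: "filterlim complex_of_real (at 0) (at_right 0)"
  proof (rule filterlim_atI)
    have "(complex_of_real \<longlongrightarrow> complex_of_real 0) (at_right 0)" by (intro tendsto_intros)
    then show "(complex_of_real \<longlongrightarrow> 0) (at_right 0)" by simp
    show "\<forall>\<^sub>F t in at_right 0. complex_of_real t \<noteq> 0" by (rule eventually_at_right_0I) simp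
  qed
  have d_lim: "((\<lambda>t. (exp (l * of_real t) - 1) / of_real t) \<longlongrightarrow> l) (at_right 0)"
    by (rule filterlim_compose[OF D r])
  have "((\<lambda>t. cm (exp (l * of_real t)) (u t) + cm ((exp (l * of_real t) - 1) / of_real t) x)
      \<longlongrightarrow> cm (exp (l * of_real 0)) y + cm l x) (at_right 0)"
    by (intro tendsto_add cm_tendsto c_lim u_lim d_lim tendsto_const uE xy)
  moreover have "\<forall>\<^sub>F t in at_right 0. cm (exp (l * of_real t)) (u t) + cm ((exp (l * of_real t) - 1) / of_real t) x
      = (1 / t) *\<^sub>R (cm (exp (l * of_real t)) (A t) - x)"
  proof -
    have "cm (exp (l * of_real t)) (u t) + cm ((exp (l * of_real t) - 1) / of_real t) x
      = (1 / t) *\<^sub>R (cm (exp (l * of_real t)) (A t) - x)" if t: "0 < t" for t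
    proof -
      let ?c = "exp (l * of_real t)"
      have "cm ?c (u t) = (1 / t) *\<^sub>R (cm ?c (A t) - cm ?c x)"
        using t A xy by (simp add: u_def cm_scaleR cm_diff sE)
      moreover have "cm ((?c - 1) / of_real t) x = (1 / t) *\<^sub>R (cm ?c x - x)"
      proof -
        have "cm ((?c - 1) / of_real t) x = cm (of_real (1 / t)) (cm (?c - 1) x)"
          using xy by (simp add: cm_cm)
        also have "\<dots> = (1 / t) *\<^sub>R cm (?c - 1) x" using xy by (intro cm_of_real cm_in)
        finally show ?thesis using xy by (simp add: cm_diff_left cm_one)
      qed
      ultimately show ?thesis by (simp add: scaleR_add_right[symmetric])
    qed
    then show ?thesis by (rule eventually_at_right_0I)
  qed
  ultimately have "((\<lambda>t. (1 / t) *\<^sub>R (cm (exp (l * of_real t)) (A t) - x))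
      \<longlongrightarrow> cm (exp (l * of_real 0)) y + cm l x) (at_right 0)"
    by (rule Lim_transform_eventually)
  then show ?thesis using xy by (simp add: cm_one)
qed

end

context complex_Lp_semigroup begin

abbreviation rescaled where "rescaled l \<equiv> \<lambda>t v. cm (exp (- l * of_real t)) (S t v)"

lemma norm_cm_exp: "v \<in> E \<Longrightarrow> norm (cm (exp (- l * of_real t)) v) = exp (- Re l * t) * norm v"
  by (simp add: norm_cm norm_exp_eq_Re)

lemma complex_rescale: "complex_Lp_semigroup M p (rescaled l)"
proof unfold_locales
  fix t :: real assume t: "0 \<le> t"
  then obtain K where "\<forall>x\<in>E. norm (S t x) \<le> K * norm x" using S_bdd by blast
  then have "\<forall>x\<in>E. norm (cm (exp (- l * of_real t)) (S t x)) \<le> (exp (- Re l * t) * K) * norm x"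
    using t by (auto simp: norm_cm norm_exp_eq_Re S_in mult.assoc)
  then show "\<exists>K. \<forall>x\<in>E. norm (cm (exp (- l * of_real t)) (S t x)) \<le> K * norm x" by blast
next
  fix s t :: real and x assume st: "0 \<le> s" "0 \<le> t" "x \<in> E"
  have "exp (- l * of_real (s + t)) = exp (- l * of_real s) * exp (- l * of_real t)"
    by (simp add: ring_distribs flip: exp_add)
  then show "cm (exp (- l * of_real (s + t))) (S (s + t) x)
      = cm (exp (- l * of_real s)) (S s (cm (exp (- l * of_real t)) (S t x)))"
    using st by (simp add: S_plus S_cm S_in cm_cm)
next
  fix x assume x: "x \<in> E"
  define u where "u t = (if 0 \<le> t then S t x else x)" for t
  have ev: "\<forall>\<^sub>F t in at_right 0. u t = S t x"
    by (rule eventually_at_right_0I) (simp add: u_def)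
  have "(u \<longlongrightarrow> x) (at_right 0)" using S_cont[OF x] ev by (simp add: tendsto_cong)
  moreover have "((\<lambda>t. exp (- l * of_real t)) \<longlongrightarrow> exp (- l * of_real 0)) (at_right 0)"
    by (intro tendsto_intros)
  ultimately have "((\<lambda>t. cm (exp (- l * of_real t)) (u t)) \<longlongrightarrow> cm (exp (- l * of_real 0)) x) (at_right 0)"
    using x by (intro cm_tendsto[where y = x and u = u]) (auto simp: u_def[of t for t] S_in)
  moreover have "\<forall>\<^sub>F t in at_right 0. cm (exp (- l * of_real t)) (u t) = cm (exp (- l * of_real t)) (S t x)"
    using ev by eventually_elim simp
  ultimately have "((\<lambda>t. cm (exp (- l * of_real t)) (S t x)) \<longlongrightarrow> cm (exp (- l * of_real 0)) x) (at_right 0)"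
    by (rule Lim_transform_eventually)
  then show "((\<lambda>t. cm (exp (- l * of_real t)) (S t x)) \<longlongrightarrow> x) (at_right 0)" using x by (simp add: cm_one)
qed (auto simp: subspace_E closed_E cm_in S_in cm_add S_add S_scale cm_scaleR S_0 cm_one S_cm cm_cm mult.commute)

text \<open>The rescaled semigroup is generated by the old generator minus \<open>l\<close>. One
  inclusion multiplies by the exponential, the other by its inverse.\<close>

lemma gen_complex_rescale_iff:
  "strongly_continuous_semigroup.gen E (rescaled l) x y \<longleftrightarrow>
   x \<in> E \<and> y \<in> E \<and> gen x (y + cm l x)"
proof -
  interpret r: complex_Lp_semigroup M p "rescaled l" by (rule complex_rescale)
  have 1: "r.gen x (z + cm (- l) x)" if g: "gen x z" for z
  proof -
    have xz: "x \<in> E" "z \<in> E" using g gen_in by auto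
    have "((\<lambda>t. (1 / t) *\<^sub>R (cm (exp (- l * of_real t)) (S t x) - x)) \<longlongrightarrow> z + cm (- l) x) (at_right 0)"
      using g xz by (intro cm_exp_derivative) (auto simp: gen_def S_in)
    then show ?thesis using xz unfolding r.gen_def by (simp add: E_add cm_in)
  qed
  have 2: "gen x (y + cm l x)" if g: "r.gen x y"
  proof -
    have xy: "x \<in> E" "y \<in> E" using g r.gen_in by auto
    have "((\<lambda>t. (1 / t) *\<^sub>R (cm (exp (l * of_real t)) (cm (exp (- l * of_real t)) (S t x)) - x))
        \<longlongrightarrow> y + cm l x) (at_right 0)"
      using g[unfolded r.gen_def] by (intro cm_exp_derivative) (auto simp: S_in cm_in)
    moreover have "\<forall>\<^sub>F t in at_right 0. (1 / t) *\<^sub>R (cm (exp (l * of_real t)) (cm (exp (- l * of_real t)) (S t x)) - x)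
        = (1 / t) *\<^sub>R (S t x - x)"
    proof -
      have "cm (exp (l * of_real t)) (cm (exp (- l * of_real t)) (S t x)) = S t x" if "0 < t" for t
        using that xy by (simp add: cm_cm S_in cm_one flip: exp_add)
      then show ?thesis by (intro eventually_at_right_0I) simp
    qed
    ultimately have "((\<lambda>t. (1 / t) *\<^sub>R (S t x - x)) \<longlongrightarrow> y + cm l x) (at_right 0)"
      by (rule Lim_transform_eventually)
    then show ?thesis using xy by (simp add: gen_def E_add cm_in)
  qed
  show ?thesis
  proof
    assume "x \<in> E \<and> y \<in> E \<and> gen x (y + cm l x)"
    then show "r.gen x y" using 1[of "y + cm l x"] by (simp add: cm_minus_left)
  qed (use 2 r.gen_in in blast)
qed

end

section \<open>Dictionary between classes of functions and vectors of \<open>E\<close>\<close>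

context Lp_space begin

abbreviation LP where "LP \<equiv> Lp M p"

lemma Lp_class_eq: "f \<in> L \<Longrightarrow> Lp_class M p f = {g \<in> L. AE x in M. f x = g x}"
  by (auto simp: Lp_class_def ae_eq_def)

lemma vecs_iff: "X \<in> vecs LP \<longleftrightarrow> (\<exists>f\<in>L. X = Lp_class M p f)"
  by (auto simp: Lp_def quotient_def Lp_class_def)

text \<open>With \<open>cls\<close> as its inverse this is an isometry of the carrier onto
  \<open>E\<close> that respects sums, complex multiples and positivity.\<close>

definition iota :: "('a \<Rightarrow> complex) set \<Rightarrow> 'a Lp_target" where "iota X = emb (Lp_rep X)"

definition cls :: "'a Lp_target \<Rightarrow> ('a \<Rightarrow> complex) set" where "cls v = Lp_class M p (rep v)"

lemma Lp_rep_class: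
  assumes "f \<in> L" shows "Lp_rep (Lp_class M p f) \<in> L" "AE x in M. f x = Lp_rep (Lp_class M p f) x"
proof -
  have "f \<in> Lp_class M p f" using assms by (simp add: Lp_class_eq)
  then have "Lp_rep (Lp_class M p f) \<in> Lp_class M p f" unfolding Lp_rep_def by (rule someI[where P = "\<lambda>g. g \<in> Lp_class M p f"])
  then show "Lp_rep (Lp_class M p f) \<in> L" "AE x in M. f x = Lp_rep (Lp_class M p f) x"
    using assms by (auto simp: Lp_class_eq)
qed

lemma iota_class: "f \<in> L \<Longrightarrow> iota (Lp_class M p f) = emb f"
  using Lp_rep_class[of f] emb_eq_iff[of f "Lp_rep (Lp_class M p f)"] by (simp add: iota_def)

lemma Lp_rep_in: "X \<in> vecs LP \<Longrightarrow> Lp_rep X \<in> L"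
  using Lp_rep_class(1) by (auto simp: vecs_iff)

lemma iota_in: "X \<in> vecs LP \<Longrightarrow> iota X \<in> E"
  using Lp_rep_in by (auto simp: iota_def E_def)

lemma cls_in: "v \<in> E \<Longrightarrow> cls v \<in> vecs LP"
  using rep(1) by (auto simp: cls_def vecs_iff)

lemma iota_cls: "v \<in> E \<Longrightarrow> iota (cls v) = v"
  using rep by (simp add: cls_def iota_class)

lemma class_eq_iff: "f \<in> L \<Longrightarrow> g \<in> L \<Longrightarrow> Lp_class M p f = Lp_class M p g \<longleftrightarrow> emb f = emb g"
proof
  assume fg: "f \<in> L" "g \<in> L" and "emb f = emb g"
  then have *: "AE x in M. f x = g x" using emb_eq_iff by blast
  have "(AE x in M. f x = h x) \<longleftrightarrow> (AE x in M. g x = h x)" for h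
  proof
    assume "AE x in M. f x = h x" with * show "AE x in M. g x = h x" by eventually_elim simp
  next
    assume "AE x in M. g x = h x" with * show "AE x in M. f x = h x" by eventually_elim simp
  qed
  then show "Lp_class M p f = Lp_class M p g" using fg by (simp add: Lp_class_eq)
qed (metis iota_class)

lemma iota_inj:
  assumes "X \<in> vecs LP" "Y \<in> vecs LP" "iota X = iota Y" shows "X = Y"
proof -
  obtain f g where fg: "f \<in> L" "X = Lp_class M p f" "g \<in> L" "Y = Lp_class M p g"
    using assms by (auto simp: vecs_iff)
  then have "emb f = emb g" using assms(3) iota_class by simp
  then show ?thesis using fg class_eq_iff by blast
qed

lemma cls_iota: "X \<in> vecs LP \<Longrightarrow> cls (iota X) = X"
  by (intro iota_inj cls_in iota_in) (simp_all add: iota_cls iota_in)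

lemma vadd_Lp:
  assumes "X \<in> vecs LP" "Y \<in> vecs LP"
  shows "vadd LP X Y \<in> vecs LP" "iota (vadd LP X Y) = iota X + iota Y"
proof -
  have *: "vadd LP X Y = Lp_class M p (\<lambda>x. Lp_rep X x + Lp_rep Y x)" by (simp add: Lp_def)
  have L: "(\<lambda>x. Lp_rep X x + Lp_rep Y x) \<in> L" using assms by (intro Lp_fun_add Lp_rep_in p0)
  show "vadd LP X Y \<in> vecs LP" unfolding * vecs_iff using L by blast
  show "iota (vadd LP X Y) = iota X + iota Y"
    unfolding * iota_class[OF L] using assms by (simp add: iota_def emb_add Lp_rep_in)
qed

lemma vscale_Lp:
  assumes "X \<in> vecs LP"
  shows "vscale LP c X \<in> vecs LP" "iota (vscale LP c X) = cm c (iota X)"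
proof -
  have *: "vscale LP c X = Lp_class M p (\<lambda>x. c * Lp_rep X x)" by (simp add: Lp_def)
  have L: "(\<lambda>x. c * Lp_rep X x) \<in> L" using assms by (intro Lp_fun_scale Lp_rep_in)
  show "vscale LP c X \<in> vecs LP" unfolding * vecs_iff using L by blast
  show "iota (vscale LP c X) = cm c (iota X)"
    unfolding * iota_class[OF L] using assms by (simp add: iota_def cm_emb Lp_rep_in)
qed

lemma vminus_Lp:
  assumes "X \<in> vecs LP" "Y \<in> vecs LP"
  shows "vminus LP X Y \<in> vecs LP" "iota (vminus LP X Y) = iota X - iota Y"
  using assms cm_of_real[OF iota_in[OF assms(2)], of "- 1"]
  by (simp_all add: vminus_def vadd_Lp vscale_Lp)

lemma vnorm_Lp: "X \<in> vecs LP \<Longrightarrow> vnorm LP X = norm (iota X)"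
  by (simp add: Lp_def iota_def norm_emb Lp_rep_in[unfolded Lp_def] Lp_norm_def)

lemma vpos_Lp: "X \<in> vpos LP \<longleftrightarrow> X \<in> vecs LP \<and> iota X \<in> pos"
proof (cases "X \<in> vecs LP")
  case True
  then obtain f where f: "f \<in> L" "X = Lp_class M p f" by (auto simp: vecs_iff)
  have "(\<forall>g\<in>X. AE x in M. g x \<in> \<real> \<and> 0 \<le> Re (g x)) \<longleftrightarrow> pos_fun f"
  proof
    assume "\<forall>g\<in>X. AE x in M. g x \<in> \<real> \<and> 0 \<le> Re (g x)"
    then show "pos_fun f" using f by (auto simp: pos_fun_def Lp_class_eq)
  next
    assume "pos_fun f"
    then have *: "AE x in M. f x \<in> \<real> \<and> 0 \<le> Re (f x)" by (simp add: pos_fun_def)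
    show "\<forall>g\<in>X. AE x in M. g x \<in> \<real> \<and> 0 \<le> Re (g x)"
    proof
      fix g assume "g \<in> X"
      then have "AE x in M. f x = g x" using f by (simp add: Lp_class_eq)
      with * show "AE x in M. g x \<in> \<real> \<and> 0 \<le> Re (g x)" by eventually_elim simp
    qed
  qed
  moreover have "X \<in> vpos LP \<longleftrightarrow> (\<forall>g\<in>X. AE x in M. g x \<in> \<real> \<and> 0 \<le> Re (g x))"
    using True by (simp add: Lp_def)
  ultimately show ?thesis using True f by (simp add: iota_class emb_in_pos_iff)
qed (simp add: Lp_def)

end

section \<open>The given semigroup, its generator and its resolvent set, carried over to
  \<open>E\<close>\<close>

locale Lp_C0_semigroup = Lp_space M p for M :: "'a measure" and p :: real +
  fixes T :: "real \<Rightarrow> ('a \<Rightarrow> complex) set \<Rightarrow> ('a \<Rightarrow> complex) set"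
  assumes C0: "C0_semigroup (Lp M p) T"
begin

definition Tv :: "real \<Rightarrow> 'a Lp_target \<Rightarrow> 'a Lp_target" where "Tv t v = iota (T t (cls v))"

lemma T_bounded_operator: "0 \<le> t \<Longrightarrow> bounded_operator LP (T t)"
  using C0 by (simp add: C0_semigroup_def)

lemma T_in: "0 \<le> t \<Longrightarrow> X \<in> vecs LP \<Longrightarrow> T t X \<in> vecs LP"
  using T_bounded_operator by (simp add: bounded_operator_def)

lemma iota_T: "0 \<le> t \<Longrightarrow> X \<in> vecs LP \<Longrightarrow> iota (T t X) = Tv t (iota X)"
  by (simp add: Tv_def cls_iota)

lemma cls_add: "v \<in> E \<Longrightarrow> w \<in> E \<Longrightarrow> cls (v + w) = vadd LP (cls v) (cls w)"
  using subspace_E by (intro iota_inj cls_in vadd_Lp) (simp_all add: subspace_def iota_cls vadd_Lp cls_in)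

lemma cls_cm: "v \<in> E \<Longrightarrow> cls (cm c v) = vscale LP c (cls v)"
  by (intro iota_inj cls_in vscale_Lp cm_in) (simp_all add: iota_cls vscale_Lp cls_in cm_in)

sublocale complex_Lp_semigroup M p Tv
proof unfold_locales
  fix t :: real and x y :: "'a Lp_target" and c :: real assume t: "0 \<le> t" and x: "x \<in> E"
  note bo = T_bounded_operator[OF t, unfolded bounded_operator_def]
  show "Tv t x \<in> E" unfolding Tv_def using t x by (intro iota_in T_in cls_in)
  show "Tv t (x + y) = Tv t x + Tv t y" if "y \<in> E"
    using bo x that t by (simp add: Tv_def cls_add cls_in vadd_Lp T_in)
  show cm: "Tv t (cm c v) = cm c (Tv t v)" if "v \<in> E" for c v
    using bo that t by (simp add: Tv_def cls_cm cls_in vscale_Lp T_in)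
  show "Tv t (c *\<^sub>R x) = c *\<^sub>R Tv t x"
    using cm[OF x, of "complex_of_real c"] x \<open>Tv t x \<in> E\<close> by (simp add: cm_of_real)
next
  fix t :: real assume t: "0 \<le> t"
  obtain K where "\<And>X. X \<in> vecs LP \<Longrightarrow> vnorm LP (T t X) \<le> K * vnorm LP X"
    using T_bounded_operator[OF t] unfolding bounded_operator_def by blast
  then have "norm (Tv t x) \<le> K * norm x" if "x \<in> E" for x
    using that t cls_in[OF that] by (force simp: vnorm_Lp T_in iota_T iota_cls)
  then show "\<exists>K. \<forall>x\<in>E. norm (Tv t x) \<le> K * norm x" by blast
next
  fix x assume x: "x \<in> E"
  show "Tv 0 x = x" using C0 x by (simp add: Tv_def C0_semigroup_def cls_in iota_cls)
  show "Tv (s + t) x = Tv s (Tv t x)" if "0 \<le> s" "0 \<le> t" for s t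
  proof -
    have "T (s + t) (cls x) = T s (T t (cls x))" using C0 that cls_in[OF x] unfolding C0_semigroup_def by blast
    then show ?thesis using that x by (simp add: Tv_def cls_iota T_in cls_in)
  qed
  have "((\<lambda>t. vnorm LP (vminus LP (T t (cls x)) (cls x))) \<longlongrightarrow> 0) (at_right 0)"
    using C0 x by (simp add: C0_semigroup_def cls_in)
  moreover have "\<forall>\<^sub>F t in at_right 0. vnorm LP (vminus LP (T t (cls x)) (cls x)) = norm (Tv t x - x)"
    using x by (intro eventually_at_right_0I) (simp add: vnorm_Lp vminus_Lp T_in cls_in iota_T iota_cls)
  ultimately have "((\<lambda>t. norm (Tv t x - x)) \<longlongrightarrow> 0) (at_right 0)" by (rule Lim_transform_eventually)
  then show "((\<lambda>t. Tv t x) \<longlongrightarrow> x) (at_right 0)" by (simp add: LIM_zero_cancel tendsto_norm_zero_iff)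
qed (auto simp: subspace_E closed_E Tv_def cls_cm)

abbreviation D where "D \<equiv> generator_dom LP T"
abbreviation A where "A \<equiv> generator LP T"

lemma has_generator_value_iff:
  assumes X: "X \<in> vecs LP" and Y: "Y \<in> vecs LP"
  shows "has_generator_value LP T X Y \<longleftrightarrow> gen (iota X) (iota Y)"
proof -
  have "vnorm LP (vminus LP (vscale LP (of_real (1 / t)) (vminus LP (T t X) X)) Y)
      = norm ((1 / t) *\<^sub>R (Tv t (iota X) - iota X) - iota Y)" if t: "0 < t" for t
  proof -
    have T: "T t X \<in> vecs LP" using t X T_in by simp
    have "iota (vminus LP (T t X) X) = Tv t (iota X) - iota X" using t X T by (simp add: vminus_Lp iota_T)
    moreover have "Tv t (iota X) - iota X \<in> E" using t X by (intro E_diff S_in iota_in) auto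
    ultimately show ?thesis
      using X Y T cm_of_real[of "Tv t (iota X) - iota X" "1 / t"] by (simp add: vnorm_Lp vminus_Lp vscale_Lp)
  qed
  then have "has_generator_value LP T X Y \<longleftrightarrow>
      ((\<lambda>t. norm ((1 / t) *\<^sub>R (Tv t (iota X) - iota X) - iota Y)) \<longlongrightarrow> 0) (at_right 0)"
    unfolding has_generator_value_def by (intro tendsto_cong eventually_at_right_0I)
  also have "\<dots> \<longleftrightarrow> ((\<lambda>t. (1 / t) *\<^sub>R (Tv t (iota X) - iota X)) \<longlongrightarrow> iota Y) (at_right 0)"
    by (simp only: tendsto_norm_zero_iff LIM_zero_iff)
  finally show ?thesis using X Y by (simp add: gen_def iota_in)
qed

lemma generator_dom_iff: "X \<in> D \<longleftrightarrow> X \<in> vecs LP \<and> (\<exists>y. gen (iota X) y)"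
proof
  assume "X \<in> D"
  then obtain Y where "X \<in> vecs LP" "Y \<in> vecs LP" "has_generator_value LP T X Y"
    by (auto simp: generator_dom_def)
  then show "X \<in> vecs LP \<and> (\<exists>y. gen (iota X) y)" using has_generator_value_iff by blast
next
  assume a: "X \<in> vecs LP \<and> (\<exists>y. gen (iota X) y)"
  then obtain y where y: "gen (iota X) y" by blast
  then have yE: "y \<in> E" using gen_in by blast
  then have "has_generator_value LP T X (cls y)" using a y by (simp add: has_generator_value_iff cls_in iota_cls)
  then show "X \<in> D" using a cls_in[OF yE] by (auto simp: generator_dom_def)
qed

text \<open>Limits are unique and \<open>iota\<close> is injective, so on \<open>D\<close> the
  description operator in \<open>generator\<close> picks the actual derivative of the orbit.\<close>

lemma generator_gen:
  assumes "X \<in> D" shows "A X \<in> vecs LP" "gen (iota X) (iota (A X))"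
proof -
  have X: "X \<in> vecs LP" using assms generator_dom_iff by blast
  have "\<exists>!Y. Y \<in> vecs LP \<and> has_generator_value LP T X Y"
  proof (rule ex_ex1I)
    show "\<exists>Y. Y \<in> vecs LP \<and> has_generator_value LP T X Y"
      using assms by (auto simp: generator_dom_def)
    fix Y Z assume "Y \<in> vecs LP \<and> has_generator_value LP T X Y"
      "Z \<in> vecs LP \<and> has_generator_value LP T X Z"
    then show "Y = Z" using X has_generator_value_iff gen_unique iota_inj by metis
  qed
  from theI'[OF this] have "A X \<in> vecs LP \<and> has_generator_value LP T X (A X)" by (simp add: generator_def)
  then show "A X \<in> vecs LP" "gen (iota X) (iota (A X))" using X has_generator_value_iff by auto
qed

definition shifted :: "complex \<Rightarrow> ('a \<Rightarrow> complex) set \<Rightarrow> ('a \<Rightarrow> complex) set" where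
  "shifted l X = vminus LP (vscale LP l X) (A X)"

lemma shifted_in: "X \<in> D \<Longrightarrow> shifted l X \<in> vecs LP"
  using generator_gen generator_dom_iff by (simp add: shifted_def vminus_Lp vscale_Lp)

lemma shifted_eq_iff:
  assumes X: "X \<in> D" and F: "F \<in> vecs LP"
  shows "shifted l X = F \<longleftrightarrow> gen (iota X) (cm l (iota X) - iota F)"
proof -
  have XV: "X \<in> vecs LP" using X generator_dom_iff by blast
  have "shifted l X = F \<longleftrightarrow> iota (shifted l X) = iota F" using iota_inj shifted_in[OF X] F by blast
  also have "iota (shifted l X) = cm l (iota X) - iota (A X)"
    using XV generator_gen(1)[OF X] by (simp add: shifted_def vminus_Lp vscale_Lp)
  also have "cm l (iota X) - iota (A X) = iota F \<longleftrightarrow> iota (A X) = cm l (iota X) - iota F" by (auto simp: algebra_simps)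
  also have "\<dots> \<longleftrightarrow> gen (iota X) (cm l (iota X) - iota F)"
    using generator_gen(2)[OF X] gen_unique by auto
  finally show ?thesis .
qed

lemma gen_imp_cls_dom: "gen x y \<Longrightarrow> cls x \<in> D"
  using gen_in generator_dom_iff cls_in iota_cls by metis

lemma resolvent_set_iff:
  "l \<in> resolvent_set LP D A \<longleftrightarrow>
    bij_betw (shifted l) D (vecs LP) \<and> bounded_operator LP (inv_into D (shifted l))"
  by (simp add: resolvent_set_def shifted_def[abs_def])

text \<open>Unique solvability with a norm bound suffices: sums and complex multiples of solutions
  solve the corresponding equations, so uniqueness makes the inverse linear.\<close>

lemma resolvent_setI:
  assumes inj: "\<And>x. gen x (cm l x) \<Longrightarrow> x = 0"
    and ex: "\<And>f. f \<in> E \<Longrightarrow> \<exists>x. gen x (cm l x - f) \<and> norm x \<le> K * norm f"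
  shows "l \<in> resolvent_set LP D A"
proof -
  have unique: "x = y" if xy: "gen x (cm l x - f)" "gen y (cm l y - f)" for x y f
  proof -
    have E: "x \<in> E" "y \<in> E" using xy gen_in by auto
    have "gen (x + (- 1) *\<^sub>R y) ((cm l x - f) + (- 1) *\<^sub>R (cm l y - f))" by (intro gen_add gen_scale xy)
    then have "gen (x - y) (cm l (x - y))" using E by (simp add: cm_diff)
    then show ?thesis using inj[of "x - y"] by simp
  qed
  have bij: "bij_betw (shifted l) D (vecs LP)"
    unfolding bij_betw_def
  proof
    show "inj_on (shifted l) D"
    proof (rule inj_onI)
      fix X Y assume XY: "X \<in> D" "Y \<in> D" "shifted l X = shifted l Y"
      have "gen (iota X) (cm l (iota X) - iota (shifted l Y))" "gen (iota Y) (cm l (iota Y) - iota (shifted l Y))"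
        using XY shifted_eq_iff shifted_in by blast+
      then have "iota X = iota Y" by (rule unique)
      then show "X = Y" using XY iota_inj generator_dom_iff by blast
    qed
    show "shifted l ` D = vecs LP"
    proof
      show "shifted l ` D \<subseteq> vecs LP" using shifted_in by blast
      show "vecs LP \<subseteq> shifted l ` D"
      proof
        fix F assume F: "F \<in> vecs LP"
        obtain x where x: "gen x (cm l x - iota F)" using ex[OF iota_in[OF F]] by blast
        have "iota (cls x) = x" using x gen_in iota_cls by blast
        then have "shifted l (cls x) = F" using x F gen_imp_cls_dom[OF x] by (simp add: shifted_eq_iff)
        then show "F \<in> shifted l ` D" using gen_imp_cls_dom[OF x] by blast
      qed
    qed
  qed
  let ?R = "inv_into D (shifted l)"
  have R: "?R F \<in> D" "shifted l (?R F) = F" if "F \<in> vecs LP" for F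
    using bij that by (auto simp: bij_betw_def inv_into_into f_inv_into_f)
  have RV: "?R F \<in> vecs LP" if "F \<in> vecs LP" for F using R(1)[OF that] generator_dom_iff by blast
  have Rgen: "gen (iota (?R F)) (cm l (iota (?R F)) - iota F)" if "F \<in> vecs LP" for F
    using R[OF that] that shifted_eq_iff by blast
  have "bounded_operator LP ?R"
    unfolding bounded_operator_def
  proof (intro conjI ballI allI)
    fix F assume F: "F \<in> vecs LP"
    then show "?R F \<in> vecs LP" by (rule RV)
    show "?R (vadd LP F G) = vadd LP (?R F) (?R G)" if G: "G \<in> vecs LP" for G
    proof (intro iota_inj vadd_Lp RV F G)
      show "iota (?R (vadd LP F G)) = iota (vadd LP (?R F) (?R G))"
      proof (rule unique)
        show "gen (iota (?R (vadd LP F G))) (cm l (iota (?R (vadd LP F G))) - iota (vadd LP F G))"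
          using F G by (intro Rgen vadd_Lp)
        show "gen (iota (vadd LP (?R F) (?R G))) (cm l (iota (vadd LP (?R F) (?R G))) - iota (vadd LP F G))"
          using gen_add[OF Rgen[OF F] Rgen[OF G]] F G RV by (simp add: vadd_Lp cm_add iota_in algebra_simps)
      qed
    qed
    show "?R (vscale LP c F) = vscale LP c (?R F)" for c
    proof (intro iota_inj vscale_Lp RV F)
      show "iota (?R (vscale LP c F)) = iota (vscale LP c (?R F))"
      proof (rule unique)
        show "gen (iota (?R (vscale LP c F))) (cm l (iota (?R (vscale LP c F))) - iota (vscale LP c F))"
          using F by (intro Rgen vscale_Lp)
        show "gen (iota (vscale LP c (?R F))) (cm l (iota (vscale LP c (?R F))) - iota (vscale LP c F))"
          using gen_cm[OF Rgen[OF F], of c] F RV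
          by (simp add: vscale_Lp cm_diff cm_in cm_cm iota_in mult.commute)
      qed
    qed
  next
    have "vnorm LP (?R F) \<le> K * vnorm LP F" if F: "F \<in> vecs LP" for F
    proof -
      obtain x where x: "gen x (cm l x - iota F)" "norm x \<le> K * norm (iota F)" using ex[OF iota_in[OF F]] by blast
      have "iota (?R F) = x" by (rule unique[OF Rgen[OF F] x(1)])
      then show ?thesis using x(2) F RV by (simp add: vnorm_Lp)
    qed
    then show "\<exists>K. \<forall>F\<in>vecs LP. vnorm LP (?R F) \<le> K * vnorm LP F" by blast
  qed
  then show ?thesis using bij resolvent_set_iff by blast
qed

text \<open>Rescaling by \<open>l\<close> makes the semigroup exponentially stable, so its
  generator, which is \<open>A - l\<close>, is invertible with bounded inverse.\<close>

lemma growth_imp_resolvent_set: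
  assumes "\<And>t x. 0 \<le> t \<Longrightarrow> x \<in> E \<Longrightarrow> norm (Tv t x) \<le> C * exp (w * t) * norm x" and "w < Re l"
  shows "l \<in> resolvent_set LP D A"
proof -
  let ?S = "rescaled l"
  interpret r: complex_Lp_semigroup M p ?S by (rule complex_rescale)
  have e: "0 < Re l - w" using assms(2) by simp
  have decay: "norm (?S t x) \<le> C * exp (- (Re l - w) * t) * norm x" if "0 \<le> t" "x \<in> E" for t x
  proof -
    have "norm (?S t x) = exp (- Re l * t) * norm (Tv t x)" using that by (intro norm_cm_exp S_in)
    also have "\<dots> \<le> exp (- Re l * t) * (C * exp (w * t) * norm x)" using assms(1)[OF that] by (intro mult_left_mono) auto
    also have "\<dots> = C * (exp (- Re l * t) * exp (w * t)) * norm x" by (simp add: mult_ac)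
    also have "exp (- Re l * t) * exp (w * t) = exp (- (Re l - w) * t)" by (simp add: algebra_simps flip: exp_add)
    finally show ?thesis .
  qed
  obtain K where K: "\<And>f. f \<in> E \<Longrightarrow> \<exists>x. r.gen x (- f) \<and> norm x \<le> K * norm f"
    using r.exponentially_stable_generator_surjective[OF e decay] by blast
  show ?thesis
  proof (rule resolvent_setI)
    fix x assume x: "gen x (cm l x)"
    then have "r.gen x 0" unfolding gen_complex_rescale_iff using gen_in E_0 by simp
    then show "x = 0" using r.exponentially_stable_generator_injective[OF e decay] by blast
  next
    fix f assume "f \<in> E"
    from K[OF this] obtain x where x: "r.gen x (- f)" "norm x \<le> K * norm f" by blast
    from x(1) have "gen x (- f + cm l x)" unfolding gen_complex_rescale_iff by blast
    then show "\<exists>x. gen x (cm l x - f) \<and> norm x \<le> K * norm f" using x(2) by auto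
  qed
qed

text \<open>A real resolvent point \<open>a + r\<close> of the generator becomes the point
  \<open>r\<close> after rescaling by \<open>a\<close>, which is the form that
  \<open>exponential_decay\<close> expects.\<close>

lemma resolvent_of_resolvent_set:
  assumes "complex_of_real (a + r) \<in> resolvent_set LP D A"
  shows "\<exists>R. strongly_continuous_semigroup.resolvent E (rescaled (of_real a)) r R"
proof -
  let ?S = "rescaled (of_real a)"
  let ?l = "complex_of_real (a + r)"
  interpret r: complex_Lp_semigroup M p ?S by (rule complex_rescale)
  have bij: "bij_betw (shifted ?l) D (vecs LP)" and bo: "bounded_operator LP (inv_into D (shifted ?l))"
    using assms resolvent_set_iff by auto
  define R where "R f = iota (inv_into D (shifted ?l) (cls f))" for f
  have shift: "cm ?l x = cm (of_real a) x + r *\<^sub>R x" if "x \<in> E" for x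
    using that by (simp add: cm_add_left cm_of_real)
  have "r.gen (R f) (r *\<^sub>R R f - f)" if f: "f \<in> E" for f
  proof -
    let ?X = "inv_into D (shifted ?l) (cls f)"
    have X: "?X \<in> D" "shifted ?l ?X = cls f"
      using bij cls_in[OF f] by (auto simp: bij_betw_def inv_into_into f_inv_into_f)
    then have g: "gen (R f) (cm ?l (R f) - f)" using f by (simp add: shifted_eq_iff cls_in iota_cls R_def)
    have RE: "R f \<in> E" using g gen_in by blast
    show ?thesis unfolding gen_complex_rescale_iff
      using g RE f by (simp add: shift E_diff E_scale algebra_simps del: of_real_add)
  qed
  moreover have "R (r *\<^sub>R x - y) = x" if g: "r.gen x y" for x y
  proof -
    have E: "x \<in> E" "y \<in> E" and g': "gen x (y + cm (of_real a) x)" using g unfolding gen_complex_rescale_iff by auto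
    have F: "r *\<^sub>R x - y \<in> E" using E by (intro E_diff E_scale)
    have "cm ?l x - (r *\<^sub>R x - y) = y + cm (of_real a) x"
      using E by (simp add: shift del: of_real_add)
    with g' have "gen x (cm ?l x - (r *\<^sub>R x - y))" by metis
    then have "shifted ?l (cls x) = cls (r *\<^sub>R x - y)"
      using E F gen_imp_cls_dom[OF g'] by (simp add: shifted_eq_iff cls_in iota_cls del: of_real_add)
    then have "inv_into D (shifted ?l) (cls (r *\<^sub>R x - y)) = cls x"
      using bij gen_imp_cls_dom[OF g'] by (metis bij_betw_def inv_into_f_f)
    then show ?thesis using E by (simp add: R_def iota_cls)
  qed
  moreover have "\<exists>K. \<forall>f\<in>E. norm (R f) \<le> K * norm f"
  proof -
    obtain K where K: "\<And>F. F \<in> vecs LP \<Longrightarrow> vnorm LP (inv_into D (shifted ?l) F) \<le> K * vnorm LP F"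
      using bo unfolding bounded_operator_def by blast
    have "norm (R f) \<le> K * norm f" if f: "f \<in> E" for f
    proof -
      have "inv_into D (shifted ?l) (cls f) \<in> vecs LP"
        using bo cls_in[OF f] unfolding bounded_operator_def by blast
      then show ?thesis using K[OF cls_in[OF f]] f by (simp add: vnorm_Lp cls_in iota_cls R_def)
    qed
    then show ?thesis by blast
  qed
  ultimately have "r.resolvent r R" unfolding r.resolvent_def by blast
  then show ?thesis by blast
qed

text \<open>The operator norm is a supremum of reals, so the quotients must first be shown to be
  bounded above.\<close>

lemma operator_norm_bound:
  assumes t: "0 \<le> t" and x: "x \<in> E" shows "norm (Tv t x) \<le> operator_norm LP (T t) * norm x"
proof -
  obtain K where K: "0 \<le> K" "\<And>x. x \<in> E \<Longrightarrow> norm (Tv t x) \<le> K * norm x" using S_norm_nonneg_bound[OF t] by blast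
  have q: "vnorm LP (T t X) / vnorm LP X = norm (Tv t (iota X)) / norm (iota X)" if "X \<in> vecs LP" for X
    using that t by (simp add: vnorm_Lp T_in iota_T)
  have "bdd_above ((\<lambda>X. vnorm LP (T t X) / vnorm LP X) ` vecs LP)"
  proof (rule bdd_aboveI2)
    fix X assume X: "X \<in> vecs LP"
    have "norm (Tv t (iota X)) / norm (iota X) \<le> K"
      using K(1) K(2)[OF iota_in[OF X]] by (cases "iota X = 0") (auto simp: divide_le_eq)
    then show "vnorm LP (T t X) / vnorm LP X \<le> K" using q[OF X] by simp
  qed
  then have "vnorm LP (T t (cls x)) / vnorm LP (cls x) \<le> operator_norm LP (T t)"
    unfolding operator_norm_def using cls_in[OF x] by (intro cSUP_upper)
  then have *: "norm (Tv t x) / norm x \<le> operator_norm LP (T t)" using q[OF cls_in[OF x]] x by (simp add: iota_cls)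
  show ?thesis
  proof (cases "x = 0")
    case True then show ?thesis using S_zero[OF t] by simp
  next
    case False then show ?thesis using * by (simp add: divide_le_eq)
  qed
qed

lemma operator_norm_le:
  assumes t: "0 \<le> t" and "0 \<le> K" and K: "\<And>x. x \<in> E \<Longrightarrow> norm (Tv t x) \<le> K * norm x"
  shows "operator_norm LP (T t) \<le> K"
  unfolding operator_norm_def
proof (rule cSUP_least)
  show "vecs LP \<noteq> {}" using cls_in[OF E_0] by blast
  fix X assume X: "X \<in> vecs LP"
  have "norm (Tv t (iota X)) / norm (iota X) \<le> K"
    using assms(2) K[OF iota_in[OF X]] by (cases "iota X = 0") (auto simp: divide_le_eq)
  then show "vnorm LP (T t X) / vnorm LP X \<le> K" using X t by (simp add: vnorm_Lp T_in iota_T)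
qed

lemma spectral_bound_le_growth_bound: "spectral_bound LP D A \<le> growth_bound LP T"
  unfolding spectral_bound_def growth_bound_def
proof (intro SUP_least INF_greatest)
  fix l w assume l: "l \<in> spectrum LP D A"
    and "w \<in> {w. \<exists>C\<ge>1. \<forall>t\<ge>0. operator_norm LP (T t) \<le> C * exp (w * t)}"
  then obtain C where C: "\<And>t. 0 \<le> t \<Longrightarrow> operator_norm LP (T t) \<le> C * exp (w * t)" by blast
  have "norm (Tv t x) \<le> C * exp (w * t) * norm x" if "0 \<le> t" "x \<in> E" for t x
    using operator_norm_bound[OF that] mult_right_mono[OF C[OF that(1)], of "norm x"] by simp
  then have "\<not> w < Re l" using growth_imp_resolvent_set[of C w l] l by (auto simp: spectrum_def)
  then show "ereal (Re l) \<le> ereal w" by simp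
qed

text \<open>Since \<open>a\<close> exceeds the spectral bound, every \<open>a + l\<close> with
  \<open>l \<ge> 0\<close> is a resolvent point, as \<open>exponential_decay\<close> requires of the
  semigroup rescaled by \<open>a\<close>. The factor \<open>exp (- a * t)\<close> is positive and
  preserves eventual positivity.\<close>

lemma growth_bound_le:
  assumes pos: "individually_eventually_positive LP T" and a: "spectral_bound LP D A < ereal a"
  shows "growth_bound LP T \<le> ereal a"
proof -
  let ?S = "rescaled (of_real a)"
  interpret r: complex_Lp_semigroup M p ?S by (rule complex_rescale)
  have S_real: "?S t v = exp (- a * t) *\<^sub>R Tv t v" if "0 \<le> t" "v \<in> E" for t v
    using cm_of_real[OF S_in[OF that], of "exp (- a * t)"] by (simp add: exp_of_real[symmetric])
  interpret r: eventually_positive_semigroup M p ?S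
  proof
    fix v assume v: "v \<in> Lp_space.pos M p"
    then have vE: "v \<in> E" using pos_subset by blast
    have "cls v \<in> vpos LP" using v vE by (simp add: vpos_Lp cls_in iota_cls)
    then obtain t0 where t0: "0 \<le> t0" "\<And>t. t0 \<le> t \<Longrightarrow> T t (cls v) \<in> vpos LP"
      using pos unfolding individually_eventually_positive_def by blast
    have "?S t v \<in> Lp_space.pos M p" if t: "t0 \<le> t" for t
    proof -
      have "Tv t v \<in> Lp_space.pos M p" using t0(2)[OF t] by (simp add: vpos_Lp Tv_def)
      then have "exp (- a * t) *\<^sub>R Tv t v \<in> Lp_space.pos M p"
        by (intro closed_cone_scale[OF closed_cone_pos]) auto
      then show ?thesis using S_real[of t v] t t0(1) vE by simp
    qed
    then show "\<exists>t0\<ge>0. \<forall>t\<ge>t0. ?S t v \<in> Lp_space.pos M p" using t0(1) by blast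
  qed
  have res: "\<exists>R. r.resolvent l R" if l: "0 \<le> l" for l
  proof (rule resolvent_of_resolvent_set, rule ccontr)
    assume "complex_of_real (a + l) \<notin> resolvent_set LP D A"
    then have "complex_of_real (a + l) \<in> spectrum LP D A" by (simp add: spectrum_def)
    then have "ereal (Re (complex_of_real (a + l))) \<le> spectral_bound LP D A"
      unfolding spectral_bound_def by (rule SUP_upper)
    from order_le_less_trans[OF this a] show False using l by simp
  qed
  obtain C e where e: "0 < e" and C: "\<And>t x. 0 \<le> t \<Longrightarrow> x \<in> E \<Longrightarrow> norm (?S t x) \<le> C * exp (- e * t) * norm x"
    using r.exponential_decay[OF res] by blast
  \<comment> \<open>The maximum with 1 meets the condition \<open>1 \<le> C\<close> in the
    definition of the growth bound.\<close>
  have "operator_norm LP (T t) \<le> max C 1 * exp (a * t)" if t: "0 \<le> t" for t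
  proof (rule operator_norm_le[OF t])
    fix x assume x: "x \<in> E"
    have "exp (- a * t) * norm (Tv t x) = norm (?S t x)" unfolding S_real[OF t x] by simp
    also have "\<dots> \<le> C * exp (- e * t) * norm x" by (rule C[OF t x])
    also have "\<dots> \<le> max C 1 * 1 * norm x" using e t by (intro mult_right_mono mult_mono) auto
    finally have le: "exp (- a * t) * norm (Tv t x) \<le> max C 1 * 1 * norm x" .
    have "norm (Tv t x) = exp (a * t) * (exp (- a * t) * norm (Tv t x))" by (simp add: exp_minus)
    also have "\<dots> \<le> exp (a * t) * (max C 1 * 1 * norm x)" by (rule mult_left_mono[OF le]) simp
    finally show "norm (Tv t x) \<le> max C 1 * exp (a * t) * norm x" by (simp add: mult_ac)
  qed simp
  then show ?thesis unfolding growth_bound_def by (intro INF_lower) (auto intro!: exI[of _ "max C 1"])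
qed

end

theorem theorem1p1:
  fixes M :: "'a measure" and p :: real
    and T :: "real \<Rightarrow> ('a \<Rightarrow> complex) set \<Rightarrow> ('a \<Rightarrow> complex) set"
  assumes "1 < p"
    and "C0_semigroup (Lp M p) T"
    and "individually_eventually_positive (Lp M p) T"
  shows "growth_bound (Lp M p) T =
    spectral_bound (Lp M p) (generator_dom (Lp M p) T) (generator (Lp M p) T)"
proof -
  interpret Lp_C0_semigroup M p T by unfold_locales (use assms in auto)
  have "\<not> spectral_bound (Lp M p) D A < growth_bound (Lp M p) T"
  proof
    assume "spectral_bound (Lp M p) D A < growth_bound (Lp M p) T"
    \<comment> \<open>A real number strictly between the two bounds exists also when the spectral
      bound is minus infinity, so an empty spectrum is covered.\<close>
    then obtain a where "spectral_bound (Lp M p) D A < ereal a" "ereal a < growth_bound (Lp M p) T"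
      using ereal_dense2 by blast
    then show False using growth_bound_le[OF assms(3)] by (simp add: not_less[symmetric])
  qed
  then show ?thesis using spectral_bound_le_growth_bound by (simp add: antisym)
qed

end
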